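(* Let $G$ have property $\mathcal{P}$ and let $\|\cdot\|_G$ be its Orlicz norm. Given $A\in\mathbb{R}^{n\times d}$ and $b\in\mathbb{R}^n$, consider the following algorithm: let $t_1=\Theta(d^2)$, $t_2=\Theta(d)$; let $\Pi_1\in\mathbb{R}^{t_1\times n}$ be a random sparse embedding matrix, $\Pi_2\in\mathbb{R}^{t_2\times t_1}$ a random Gaussian matrix, and $D\in\mathbb{R}^{n\times n}$ a random diagonal matrix whose diagonal entries are independently drawn from the distribution with cumulative distribution function $1-e^{-G(t)}$; output $\hat{x}=(\Pi_2\Pi_1D^{-1}A)^\dagger\,\Pi_2\Pi_1D^{-1}b$ (where $\dagger$ denotes the Moore–Penrose pseudoinverse). Then with probability at least $0.8$, $$\|A\hat{x}-b\|_G\leq O(\beta_G\, d\log^2 n)\min_{x\in\mathbb{R}^d}\|Ax-b\|_G,$$ where $\beta_G$ is a constant which may depend on $G$. In addition, the running time of the algorithm is $\mathrm{nnz}(A)+\mathrm{poly}(d)$.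
   Context: A function $G:\mathbb{R}\to\mathbb{R}_+$ has property $\mathcal{P}$ if: (1) $G$ is a nonzero, monotone nondecreasing, convex function on $[0,\infty)$; (2) $G(0)=0$, $G(1)=1$, and $G(x)=G(-x)$ for all $x$; (3) there is $s>0$ such that $G(x)=sx+(1-s)$ for all $x>1$; (4) there is $\delta_G>0$ such that $G$ is twice differentiable on $(0,\delta_G)$, the right derivatives $G'_+(0)$ and $G''_+(0)$ exist (where $G''_+(x)=\lim_{h\to0^+}(G'(x+h)-G'_+(x))/h$), and either $G'_+(0)>0$ or $G''_+(0)>0$; (5) there is $C_G>0$ such that $G(y)/G(x)\leq C_G(y/x)^2$ for all $0<x<y$. The Orlicz norm is $\|x\|_G=\inf\{\alpha>0:\sum_i G(|x_i|/\alpha)\leq1\}$. A random sparse embedding matrix $\Pi_1\in\mathbb{R}^{t_1\times n}$ is $\Phi Y$ where $Y$ is $n\times n$ diagonal with independent uniform $\pm1$ entries and $\Phi\in\{0,1\}^{t_1\times n}$ has $\Phi_{h(i),i}=1$ and zeros elsewhere, for a random hash $h:[n]\to[t_1]$ with each $h(i)$ uniform on $[t_1]$. A random Gaussian matrix in $\mathbb{R}^{t_2\times t_1}$ has i.i.d. $N(0,1)$ entries scaled by $1/\sqrt{t_2}$. All random matrices are independent. $\mathrm{nnz}(A)$ is the number of nonzero entries of $A$.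
   Formalization: The error bound is stated for n ≥ 2, d ≥ 1 (else its right side is 0). The running time is O(nnz(A)+nnz(b))+poly(d), hence O(nnz(A))+poly(d) when nnz(b) ≤ nnz(A), since all nonzeros of b must be read; each random draw costs one unit. *)

theory Defs
  imports
    "HOL-Probability.Probability"
    "HOL-Library.Landau_Symbols"
    "HOL-Computational_Algebra.Polynomial"
    "Jordan_Normal_Form.Matrix"
begin

hide_const (open) Finite_Cartesian_Product.vec Finite_Cartesian_Product.mat
no_notation Finite_Cartesian_Product.vec_nth (infixl "$" 90)

section \<open>Orlicz functions and norms\<close>

definition property_P :: "(real \<Rightarrow> real) \<Rightarrow> bool" where
  "property_P G \<longleftrightarrow>
     (\<forall>x. 0 \<le> G x) \<and>
     ((\<exists>x\<in>{0..}. G x \<noteq> 0) \<and> mono_on {0..} G \<and> convex_on {0..} G) \<and>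
     (G 0 = 0 \<and> G 1 = 1 \<and> (\<forall>x. G (- x) = G x)) \<and>
     (\<exists>s>0. \<forall>x>1. G x = s * x + (1 - s)) \<and>
     (\<exists>\<delta>>0. (\<forall>x\<in>{0<..<\<delta>}. G differentiable (at x) \<and> deriv G differentiable (at x)) \<and>
        (\<exists>g1 g2. (G has_real_derivative g1) (at_right 0) \<and>
           ((\<lambda>h. (deriv G h - g1) / h) \<longlongrightarrow> g2) (at_right 0) \<and>
           (g1 > 0 \<or> g2 > 0))) \<and>
     (\<exists>C>0. \<forall>x y. 0 < x \<and> x < y \<longrightarrow> G y / G x \<le> C * (y / x)\<^sup>2)"

definition orlicz_norm :: "(real \<Rightarrow> real) \<Rightarrow> real vec \<Rightarrow> real" where
  "orlicz_norm G x = Inf {\<alpha>. 0 < \<alpha> \<and> (\<Sum>i<dim_vec x. G (\<bar>x $ i\<bar> / \<alpha>)) \<le> 1}"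

section \<open>The randomized regression algorithm\<close>

definition nnz_mat :: "real mat \<Rightarrow> nat" where
  "nnz_mat A = card {(i, j). i < dim_row A \<and> j < dim_col A \<and> A $$ (i, j) \<noteq> 0}"

definition nnz_vec :: "real vec \<Rightarrow> nat" where
  "nnz_vec b = card {i. i < dim_vec b \<and> b $ i \<noteq> 0}"

text \<open>The Moore--Penrose pseudoinverse, by the four Penrose equations.\<close>

definition is_pinv :: "real mat \<Rightarrow> real mat \<Rightarrow> bool" where
  "is_pinv M X \<longleftrightarrow>
     X \<in> carrier_mat (dim_col M) (dim_row M) \<and>
     M * X * M = M \<and> X * M * X = X \<and>
     transpose_mat (M * X) = M * X \<and> transpose_mat (X * M) = X * M"

definition pinv :: "real mat \<Rightarrow> real mat" where
  "pinv M = (THE X. is_pinv M X)"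

text \<open>The law of the diagonal entries of \<open>D\<close>: it is carried by the nonnegative reals and has
  distribution function \<open>1 - exp (- G t)\<close> there.\<close>

definition weight_distr :: "(real \<Rightarrow> real) \<Rightarrow> real measure" where
  "weight_distr G = interval_measure (\<lambda>t. if t < 0 then 0 else 1 - exp (- G t))"

text \<open>A draw \<open>(w, \<sigma>, h, g)\<close> consists of the diagonal of \<open>D\<close>, the signs on the diagonal
  of \<open>Y\<close>, the hash function, and the unscaled entries of the Gaussian matrix; all
  coordinates are independent.\<close>

type_synonym draw = "(nat \<Rightarrow> real) \<times> (nat \<Rightarrow> real) \<times> (nat \<Rightarrow> nat) \<times> (nat \<times> nat \<Rightarrow> real)"

definition draws :: "(real \<Rightarrow> real) \<Rightarrow> nat \<Rightarrow> nat \<Rightarrow> nat \<Rightarrow> draw measure" where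
  "draws G n t1 t2 =
     PiM {..<n} (\<lambda>_. weight_distr G) \<Otimes>\<^sub>M
     PiM {..<n} (\<lambda>_. uniform_count_measure {-1, 1}) \<Otimes>\<^sub>M
     PiM {..<n} (\<lambda>_. uniform_count_measure {..<t1}) \<Otimes>\<^sub>M
     PiM ({..<t2} \<times> {..<t1}) (\<lambda>_. density lborel (\<lambda>x. ennreal (std_normal_density x)))"

definition sparse_embedding :: "nat \<Rightarrow> nat \<Rightarrow> (nat \<Rightarrow> real) \<Rightarrow> (nat \<Rightarrow> nat) \<Rightarrow> real mat" where
  "sparse_embedding t1 n \<sigma> h =
     Matrix.mat t1 n (\<lambda>(r, i). if h i = r then 1 else 0) * mat_diag n \<sigma>"

definition gaussian_matrix :: "nat \<Rightarrow> nat \<Rightarrow> (nat \<times> nat \<Rightarrow> real) \<Rightarrow> real mat" where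
  "gaussian_matrix t2 t1 g = Matrix.mat t2 t1 (\<lambda>(k, r). g (k, r) / sqrt (real t2))"

text \<open>The diagonal of \<open>D\<close> is almost surely positive, and then \<open>mat_diag n (\<lambda>i. inverse (w i))\<close>
  is the inverse of \<open>D\<close>.\<close>

fun sketch :: "nat \<Rightarrow> nat \<Rightarrow> nat \<Rightarrow> draw \<Rightarrow> real mat" where
  "sketch n t1 t2 (w, \<sigma>, h, g) =
     gaussian_matrix t2 t1 g * sparse_embedding t1 n \<sigma> h * mat_diag n (\<lambda>i. inverse (w i))"

definition x_hat :: "real mat \<Rightarrow> real vec \<Rightarrow> nat \<Rightarrow> nat \<Rightarrow> draw \<Rightarrow> real vec" where
  "x_hat A b t1 t2 \<omega> =
     (let S = sketch (dim_row A) t1 t2 \<omega> in pinv (S * A) *\<^sub>v (S *\<^sub>v b))"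

text \<open>The parameter choice: \<open>t1 = \<Theta>(d\<^sup>2)\<close> and \<open>t2 = \<Theta>(d)\<close>, with implied constants
  in the lower bounds at least \<open>c1\<close> and \<open>c2\<close>.\<close>

definition sketch_sizes :: "real \<Rightarrow> real \<Rightarrow> (nat \<Rightarrow> nat) \<Rightarrow> (nat \<Rightarrow> nat) \<Rightarrow> bool" where
  "sketch_sizes c1 c2 t1 t2 \<longleftrightarrow>
     (\<lambda>d. real (t1 d)) \<in> \<Theta>(\<lambda>d. real d ^ 2) \<and> (\<lambda>d. real (t2 d)) \<in> \<Theta>(\<lambda>d. real d) \<and>
     (\<forall>d. c1 * real d ^ 2 \<le> real (t1 d) \<and> c2 * real d \<le> real (t2 d))"

section \<open>A real random access machine\<close>

text \<open>Running time is measured for a small structured language over index memory and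
  exact real memory. A program is a finite syntax tree, so it uses finitely many array names;
  every constant, array access, operation, comparison, assignment and loop iteration costs one
  unit. Index arithmetic is restricted to addition and truncated subtraction, and the only real
  constants are 0 and 1. An index variable is an index array used at position 0, a real vector
  is a two-dimensional real array used at column 0.\<close>

datatype iexp =
    Num nat
  | IGet string iexp
  | IAdd iexp iexp
  | ISub iexp iexp

datatype rexp =
    RZero
  | ROne
  | RGet string iexp iexp
  | RAdd rexp rexp
  | RSub rexp rexp
  | RMul rexp rexp
  | RDiv rexp rexp

datatype test =
    ILe iexp iexp
  | RLe rexp rexp

datatype com =
    Skip
  | ISet string iexp iexp
  | RSet string iexp iexp rexp
  | Seq com com
  | Cond test com com
  | For string iexp com

record store =
  imem :: "string \<Rightarrow> nat \<Rightarrow> nat"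
  rmem :: "string \<Rightarrow> nat \<Rightarrow> nat \<Rightarrow> real"

primrec ival :: "store \<Rightarrow> iexp \<Rightarrow> nat" where
  "ival s (Num k) = k"
| "ival s (IGet a e) = imem s a (ival s e)"
| "ival s (IAdd e f) = ival s e + ival s f"
| "ival s (ISub e f) = ival s e - ival s f"

primrec icost :: "iexp \<Rightarrow> nat" where
  "icost (Num k) = 1"
| "icost (IGet a e) = 1 + icost e"
| "icost (IAdd e f) = 1 + icost e + icost f"
| "icost (ISub e f) = 1 + icost e + icost f"

primrec rval :: "store \<Rightarrow> rexp \<Rightarrow> real" where
  "rval s RZero = 0"
| "rval s ROne = 1"
| "rval s (RGet a e f) = rmem s a (ival s e) (ival s f)"
| "rval s (RAdd x y) = rval s x + rval s y"
| "rval s (RSub x y) = rval s x - rval s y"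
| "rval s (RMul x y) = rval s x * rval s y"
| "rval s (RDiv x y) = rval s x / rval s y"

primrec rcost :: "rexp \<Rightarrow> nat" where
  "rcost RZero = 1"
| "rcost ROne = 1"
| "rcost (RGet a e f) = 1 + icost e + icost f"
| "rcost (RAdd x y) = 1 + rcost x + rcost y"
| "rcost (RSub x y) = 1 + rcost x + rcost y"
| "rcost (RMul x y) = 1 + rcost x + rcost y"
| "rcost (RDiv x y) = 1 + rcost x + rcost y"

primrec holds :: "store \<Rightarrow> test \<Rightarrow> bool" where
  "holds s (ILe e f) \<longleftrightarrow> ival s e \<le> ival s f"
| "holds s (RLe x y) \<longleftrightarrow> rval s x \<le> rval s y"

primrec tcost :: "test \<Rightarrow> nat" where
  "tcost (ILe e f) = 1 + icost e + icost f"
| "tcost (RLe x y) = 1 + rcost x + rcost y"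

definition iupd :: "string \<Rightarrow> nat \<Rightarrow> nat \<Rightarrow> store \<Rightarrow> store" where
  "iupd a i v s = s\<lparr>imem := (imem s)(a := (imem s a)(i := v))\<rparr>"

definition rupd :: "string \<Rightarrow> nat \<Rightarrow> nat \<Rightarrow> real \<Rightarrow> store \<Rightarrow> store" where
  "rupd a i j v s = s\<lparr>rmem := (rmem s)(a := (rmem s a)(i := (rmem s a i)(j := v)))\<rparr>"

text \<open>\<open>exec c s\<close> is the pair of the cost and the final store. The bound of a loop is
  evaluated once, on entry.\<close>

primrec exec :: "com \<Rightarrow> store \<Rightarrow> nat \<times> store" where
  "exec Skip s = (1, s)"
| "exec (ISet a e f) s = (1 + icost e + icost f, iupd a (ival s e) (ival s f) s)"
| "exec (RSet a e f x) s =
     (1 + icost e + icost f + rcost x, rupd a (ival s e) (ival s f) (rval s x) s)"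
| "exec (Seq c1 c2) s =
     (let (k1, s1) = exec c1 s; (k2, s2) = exec c2 s1 in (k1 + k2, s2))"
| "exec (Cond t c1 c2) s =
     (let (k, s') = (if holds s t then exec c1 s else exec c2 s) in (tcost t + k, s'))"
| "exec (For v e c) s =
     fold (\<lambda>i (k, s1). let (k', s2) = exec c (iupd v 0 i s1) in (1 + k + k', s2))
       [0..<ival s e] (1 + icost e, s)"

text \<open>Sparse coordinate representations: the nonzero entries, in any order.\<close>

definition coords_mat :: "real mat \<Rightarrow> (nat \<times> nat \<times> real) list \<Rightarrow> bool" where
  "coords_mat A as \<longleftrightarrow> distinct as \<and>
     set as = {(i, j, A $$ (i, j)) | i j. i < dim_row A \<and> j < dim_col A \<and> A $$ (i, j) \<noteq> 0}"

definition coords_vec :: "real vec \<Rightarrow> (nat \<times> real) list \<Rightarrow> bool" where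
  "coords_vec b bs \<longleftrightarrow> distinct bs \<and> set bs = {(i, b $ i) | i. i < dim_vec b \<and> b $ i \<noteq> 0}"

definition nth0 :: "'a::zero list \<Rightarrow> nat \<Rightarrow> 'a" where
  "nth0 xs i = (if i < length xs then xs ! i else 0)"

text \<open>Initial store: sizes, the sparse representations of \<open>A\<close> and \<open>b\<close>, and the draw, where
  reading a random entry costs one unit like any other array access. All other cells are 0.
  The Gaussian matrix is given with its scaling.\<close>

fun init_store ::
  "nat \<Rightarrow> nat \<Rightarrow> nat \<Rightarrow> nat \<Rightarrow> (nat \<times> nat \<times> real) list \<Rightarrow> (nat \<times> real) list \<Rightarrow> draw \<Rightarrow> store"
where
  "init_store n d t1 t2 as bs (w, \<sigma>, h, g) =
     \<lparr>imem = (\<lambda>_ _. 0)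
        (''n'' := (\<lambda>_. 0)(0 := n),
         ''d'' := (\<lambda>_. 0)(0 := d),
         ''t1'' := (\<lambda>_. 0)(0 := t1),
         ''t2'' := (\<lambda>_. 0)(0 := t2),
         ''nnzA'' := (\<lambda>_. 0)(0 := length as),
         ''rowA'' := nth0 (map (\<lambda>(i, j, a). i) as),
         ''colA'' := nth0 (map (\<lambda>(i, j, a). j) as),
         ''nnzb'' := (\<lambda>_. 0)(0 := length bs),
         ''rowb'' := nth0 (map fst bs),
         ''hash'' := (\<lambda>i. if i < n then h i else 0)),
      rmem = (\<lambda>_ _ _. 0)
        (''valA'' := (\<lambda>k j. if j = 0 then nth0 (map (\<lambda>(i, j, a). a) as) k else 0),
         ''valb'' := (\<lambda>k j. if j = 0 then nth0 (map snd bs) k else 0),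
         ''D'' := (\<lambda>i j. if i < n \<and> j = 0 then w i else 0),
         ''Y'' := (\<lambda>i j. if i < n \<and> j = 0 then \<sigma> i else 0),
         ''Gauss'' := (\<lambda>k r. if k < t2 \<and> r < t1 then gaussian_matrix t2 t1 g $$ (k, r) else 0))\<rparr>"

definition output_vec :: "nat \<Rightarrow> store \<Rightarrow> real vec" where
  "output_vec d s = Matrix.vec d (\<lambda>j. rmem s ''x'' j 0)"

end

theory Submission
  imports Defs
begin

text \<open>Let \<open>D\<close> be the diagonal matrix of the random weights.  A fixed vector \<open>v\<close> is not expanded:
  \<open>\<parallel>D\<^sup>-\<^sup>1 v\<parallel>\<^sub>2\<close> is at most \<open>O (sqrt (ln n)) \<parallel>v\<parallel>\<^sub>G\<close>, by a dyadic second-moment computation that uses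
  the quadratic growth condition on \<open>G\<close>.  The column space of \<open>A\<close>, of dimension \<open>r\<close>, is not contracted:
  \<open>P (\<forall>i. \<bar>y\<^sub>i\<bar> \<le> s D\<^sub>i) = exp (- \<Sum> G (y\<^sub>i / s)) \<le> exp (- 1 / s)\<close> if \<open>\<Sum> G (y\<^sub>i) = 1\<close> and \<open>s \<le> 1\<close>, and a union
  bound over a grid with \<open>n\<^sup>O\<^sup>(\<^sup>r\<^sup>)\<close> points gives \<open>\<parallel>y\<parallel>\<^sub>G \<le> O (d ln n) \<parallel>D\<^sup>-\<^sup>1 y\<parallel>\<^sub>2\<close> for all \<open>y\<close> in it.  Given
  \<open>D\<close>, the sparse embedding is a subspace embedding of \<open>D\<^sup>-\<^sup>1 A\<close> by a second-moment bound for the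
  collision chaos, and the Gaussian matrix by Chernoff bounds on a lattice net.  Since
  the output minimizes the sketched residual, comparing it with a nearly optimal \<open>x\<close> loses
  only the product of these factors.  The minimizer itself is a rational function of the data given by
  Gram--Schmidt with \<open>x / 0 = 0\<close>, which yields both the program and the measurability of the output.\<close>

section \<open>Gram--Schmidt orthogonalization\<close>

text \<open>The splitting \<open>A x - b = A (x - x0) + (A x0 - b)\<close>, with \<open>x0\<close>
  nearly optimal, shapes the proof. The second vector is fixed, so it needs only upper bounds that
  hold for one vector; the first ranges over the column space of \<open>A\<close> and needs only
  lower bounds. Uniform upper bounds are out of reach: \<open>1 / D i\<close> has an infinite second
  moment, so \<open>D\<close> may stretch some directions strongly. Hence \<open>b\<close> is never
  adjoined to the subspace. The sketched residual of the minimizer is orthogonal to the sketched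
  columns, so by Pythagoras the sketch of \<open>A (x - x0)\<close> is no longer than the sketch of
  \<open>A x0 - b\<close>. The factor \<open>d * ln n\<close> is the price of the net:
  \<open>1 / s\<close> must exceed a multiple of \<open>r * ln n\<close> for the probability
  \<open>exp (- 1 / s)\<close> to beat the number of grid points. Expansion costs a further
  \<open>sqrt (ln n)\<close>, and the squared logarithm of the claim covers the product. The failure
  probability is \<open>1/25\<close> for each of the two weight events and \<open>1/10\<close> for
  the sketch.\<close>

definition dotp :: "nat \<Rightarrow> (nat \<Rightarrow> real) \<Rightarrow> (nat \<Rightarrow> real) \<Rightarrow> real" where
  "dotp D u v = (\<Sum>j<D. u j * v j)"

lemma dotp_commute: "dotp D u v = dotp D v u"
  by (simp add: dotp_def mult.commute)

lemma dotp_diff_left: "dotp D (\<lambda>j. u j - v j) w = dotp D u w - dotp D v w"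
  by (simp add: dotp_def left_diff_distrib sum_subtractf)

lemma dotp_add_left: "dotp D (\<lambda>j. u j + v j) w = dotp D u w + dotp D v w"
  by (simp add: dotp_def distrib_right sum.distrib)

lemma dotp_scale_left: "dotp D (\<lambda>j. c * u j) w = c * dotp D u w"
  by (simp add: dotp_def sum_distrib_left mult.assoc)

lemma dotp_sum_left: "dotp D (\<lambda>j. \<Sum>l\<in>L. f l j) w = (\<Sum>l\<in>L. dotp D (f l) w)"
  by (simp add: dotp_def sum_distrib_right) (rule sum.swap)

lemma dotp_sum_right: "dotp D w (\<lambda>j. \<Sum>l\<in>L. f l j) = (\<Sum>l\<in>L. dotp D w (f l))"
  by (simp add: dotp_commute[of D w] dotp_sum_left)

lemma dotp_scale_right: "dotp D w (\<lambda>j. c * u j) = c * dotp D w u"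
  by (simp add: dotp_def sum_distrib_left mult_ac)

lemma dotp_nonneg: "0 \<le> dotp D u u"
  by (simp add: dotp_def sum_nonneg)

lemma dotp_self_eq_0: "dotp D u u = 0 \<Longrightarrow> j < D \<Longrightarrow> u j = 0"
  unfolding dotp_def by (subst (asm) sum_nonneg_eq_0_iff) auto

lemma dotp_self_0: "dotp D u u = 0 \<Longrightarrow> dotp D v u = 0"
  unfolding dotp_def[of D v] by (rule sum.neutral) (simp add: dotp_self_eq_0[of D u])

lemma dotp_cong: "(\<And>j. j < D \<Longrightarrow> u j = u' j) \<Longrightarrow> (\<And>j. j < D \<Longrightarrow> v j = v' j) \<Longrightarrow> dotp D u v = dotp D u' v'"
  by (simp add: dotp_def)

text \<open>If \<open>q\<close> vanishes, then \<open>x / 0 = 0\<close> makes this the identity.\<close>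

definition reduce :: "nat \<Rightarrow> (nat \<Rightarrow> real) \<Rightarrow> (nat \<Rightarrow> real) \<Rightarrow> nat \<Rightarrow> real" where
  "reduce D q u = (\<lambda>j. u j - dotp D u q / dotp D q q * q j)"

text \<open>This is the modified Gram--Schmidt process: each coefficient is taken from the already
  reduced vector, as an in-place program computes it. Rows are not normalized, so no square roots
  occur, and a dependent row becomes zero on the coordinates below \<open>D\<close>.\<close>

fun gs :: "nat \<Rightarrow> (nat \<Rightarrow> nat \<Rightarrow> real) \<Rightarrow> nat \<Rightarrow> nat \<Rightarrow> real" where
  "gs D R i = fold (\<lambda>l. reduce D (gs D R l)) [0..<i] (R i)"

declare gs.simps [simp del]

text \<open>The state of row \<open>i\<close> after reduction by the rows before \<open>k\<close>:
  the induction variable for orthogonality and measurability, and the loop invariant of the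
  program.\<close>

definition gs_part :: "nat \<Rightarrow> (nat \<Rightarrow> nat \<Rightarrow> real) \<Rightarrow> nat \<Rightarrow> nat \<Rightarrow> nat \<Rightarrow> real" where
  "gs_part D R i k = fold (\<lambda>l. reduce D (gs D R l)) [0..<k] (R i)"

lemma gs_part_0: "gs_part D R i 0 = R i"
  by (simp add: gs_part_def)

lemma gs_part_Suc: "gs_part D R i (Suc k) = reduce D (gs D R k) (gs_part D R i k)"
  by (simp add: gs_part_def)

lemma gs_part_self: "gs_part D R i i = gs D R i"
  unfolding gs_part_def by (subst gs.simps) (rule refl)

lemma dotp_reduce: "dotp D (reduce D q u) v = dotp D u v - dotp D u q / dotp D q q * dotp D q v"
  unfolding reduce_def dotp_diff_left dotp_scale_left ..

lemma dotp_reduce_self: "dotp D (reduce D q u) q = 0"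
  using dotp_self_0[of D q u] by (cases "dotp D q q = 0") (simp_all add: dotp_reduce)

lemma gs_part_orth:
  assumes "\<And>l m. l < k \<Longrightarrow> m < l \<Longrightarrow> dotp D (gs D R l) (gs D R m) = 0" and "l < k"
  shows "dotp D (gs_part D R i k) (gs D R l) = 0"
  using assms
proof (induction k arbitrary: l)
  case (Suc k)
  show ?case
  proof (cases "l = k")
    case True
    then show ?thesis by (simp add: gs_part_Suc dotp_reduce_self)
  next
    case False
    then have "l < k" using Suc.prems by simp
    then have "dotp D (gs_part D R i k) (gs D R l) = 0" "dotp D (gs D R k) (gs D R l) = 0"
      using Suc by auto
    then show ?thesis by (simp add: gs_part_Suc dotp_reduce)
  qed
qed simp

lemma gs_orth_less: "l < i \<Longrightarrow> dotp D (gs D R i) (gs D R l) = 0"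
proof (induction i arbitrary: l rule: less_induct)
  case (less i)
  then show ?case using gs_part_orth[of i D R l i] by (simp add: gs_part_self)
qed

lemma gs_orth: "l \<noteq> i \<Longrightarrow> dotp D (gs D R i) (gs D R l) = 0"
  using gs_orth_less[of l i D R] gs_orth_less[of i l D R] by (cases "l < i") (auto simp: dotp_commute)

lemma gs_part_expand: "\<exists>a. \<forall>j. gs_part D R i k j = R i j - (\<Sum>l<k. a l * gs D R l j)"
proof (induction k)
  case (Suc k)
  then obtain a where a: "\<And>j. gs_part D R i k j = R i j - (\<Sum>l<k. a l * gs D R l j)" by blast
  define c where "c = dotp D (gs_part D R i k) (gs D R k) / dotp D (gs D R k) (gs D R k)"
  have "gs_part D R i (Suc k) j = R i j - (\<Sum>l<Suc k. (a(k := c)) l * gs D R l j)" for j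
    by (simp add: gs_part_Suc reduce_def c_def[symmetric] a)
  then show ?case by blast
qed (auto simp: gs_part_0)

lemma gs_expand: "\<exists>a. \<forall>j. gs D R i j = R i j - (\<Sum>l<i. a l * gs D R l j)"
  using gs_part_expand[of D R i i] by (simp add: gs_part_self)

text \<open>The change of basis is unitriangular: row \<open>i\<close> keeps the coefficient 1. This
  coefficient later prevents the reduced unit vector from vanishing.\<close>

lemma gs_expand_rows: "\<exists>a. \<forall>j. gs D R i j = R i j + (\<Sum>l<i. a l * R l j)"
proof (induction i rule: less_induct)
  case (less i)
  then obtain b where b: "\<And>l j. l < i \<Longrightarrow> gs D R l j = R l j + (\<Sum>m<l. b l m * R m j)"
    by metis
  obtain a where a: "\<And>j. gs D R i j = R i j - (\<Sum>l<i. a l * gs D R l j)"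
    using gs_expand[of D R i] by blast
  define b' where "b' l m = (if m = l then 1 else if m < l then b l m else 0)" for l m
  have b': "gs D R l j = (\<Sum>m<i. b' l m * R m j)" if "l < i" for l j
  proof -
    have "(\<Sum>m<i. b' l m * R m j) = (\<Sum>m<Suc l. b' l m * R m j)"
      using that by (intro sum.mono_neutral_right) (auto simp: b'_def)
    also have "\<dots> = gs D R l j"
      by (simp add: b[OF that] b'_def)
    finally show ?thesis by simp
  qed
  have "gs D R i j = R i j + (\<Sum>m<i. (- (\<Sum>l<i. a l * b' l m)) * R m j)" for j
  proof -
    have "(\<Sum>l<i. a l * gs D R l j) = (\<Sum>l<i. \<Sum>m<i. a l * b' l m * R m j)"
      by (simp add: b' sum_distrib_left mult.assoc)
    also have "\<dots> = (\<Sum>m<i. (\<Sum>l<i. a l * b' l m) * R m j)"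
      by (subst sum.swap) (simp add: sum_distrib_right)
    finally show ?thesis by (simp add: a sum_negf)
  qed
  then show ?case by (intro exI[of _ "\<lambda>m. - (\<Sum>l<i. a l * b' l m)"]) simp
qed

lemma orth_gs_imp_orth_rows:
  assumes "\<And>l. l < k \<Longrightarrow> dotp D u (gs D R l) = 0" and "i < k"
  shows "dotp D u (R i) = 0"
proof -
  obtain a where a: "\<And>j. gs D R i j = R i j - (\<Sum>l<i. a l * gs D R l j)"
    using gs_expand[of D R i] by blast
  have "R i = (\<lambda>j. gs D R i j + (\<Sum>l<i. a l * gs D R l j))"
    using a by auto
  then have "dotp D u (R i) = dotp D u (gs D R i) + (\<Sum>l<i. a l * dotp D u (gs D R l))"
    by (subst (1 2) dotp_commute, subst (3) dotp_commute)
      (simp add: dotp_add_left dotp_sum_left dotp_scale_left)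
  then show ?thesis using assms by simp
qed

section \<open>The pseudoinverse\<close>

text \<open>\<open>M * X\<close> and \<open>M * Y\<close> are symmetric idempotents with the same
  range, so transposing their product identifies them; likewise \<open>X * M\<close> and
  \<open>Y * M\<close>. This gives \<open>X = X M X = Y M Y = Y\<close>.\<close>

lemma is_pinv_unique:
  assumes X: "is_pinv M X" and Y: "is_pinv M Y"
  shows "X = Y"
proof -
  define r c where "r = dim_row M" and "c = dim_col M"
  have M: "M \<in> carrier_mat r c" and XC: "X \<in> carrier_mat c r" and YC: "Y \<in> carrier_mat c r"
    using X Y by (auto simp: r_def c_def is_pinv_def)
  note x = X[unfolded is_pinv_def] and y = Y[unfolded is_pinv_def]
  have MX: "M * X = M * Y"
  proof -
    have "M * X = transpose_mat (M * X)" using x by simp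
    also have "\<dots> = transpose_mat ((M * Y * M) * X)" using y by simp
    also have "\<dots> = transpose_mat ((M * Y) * (M * X))" using M XC YC by (simp add: assoc_mult_mat[of _ r r _ c _ r] assoc_mult_mat[of _ r c _ r _ c] assoc_mult_mat[of _ r c _ r _ r] assoc_mult_mat[of _ r c _ c _ r] assoc_mult_mat[of _ c r _ c _ r])
    also have "\<dots> = transpose_mat (M * X) * transpose_mat (M * Y)"
      using M XC YC by (intro transpose_mult[of _ r r _ r]) auto
    also have "\<dots> = (M * X) * (M * Y)" using x y by simp
    also have "\<dots> = (M * X * M) * Y" using M XC YC by (simp add: assoc_mult_mat[of _ r r _ c _ r] assoc_mult_mat[of _ r c _ r _ c] assoc_mult_mat[of _ r c _ r _ r] assoc_mult_mat[of _ r c _ c _ r] assoc_mult_mat[of _ c r _ c _ r])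
    also have "\<dots> = M * Y" using x by simp
    finally show ?thesis .
  qed
  have XM: "X * M = Y * M"
  proof -
    have "X * M = transpose_mat (X * M)" using x by simp
    also have "\<dots> = transpose_mat (X * (M * Y * M))" using y by simp
    also have "\<dots> = transpose_mat ((X * M) * (Y * M))"
      using M XC YC by (simp add: assoc_mult_mat[of _ c r _ c _ c] assoc_mult_mat[of _ r c _ r _ c])
    also have "\<dots> = transpose_mat (Y * M) * transpose_mat (X * M)"
      using M XC YC by (intro transpose_mult[of _ c c _ c]) auto
    also have "\<dots> = (Y * M) * (X * M)" using x y by simp
    also have "\<dots> = Y * (M * X * M)"
      using M XC YC by (simp add: assoc_mult_mat[of _ c r _ c _ c] assoc_mult_mat[of _ r c _ r _ c])
    also have "\<dots> = Y * M" using x by simp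
    finally show ?thesis .
  qed
  have "X = X * M * X" using x by simp
  also have "\<dots> = Y * M * X" using XM by simp
  also have "\<dots> = Y * (M * X)" using M XC YC by (simp add: assoc_mult_mat[of _ c r _ c _ r])
  also have "\<dots> = Y * (M * Y)" using MX by simp
  also have "\<dots> = Y * M * Y" using M XC YC by (simp add: assoc_mult_mat[of _ c r _ c _ r])
  also have "\<dots> = Y" using y by simp
  finally show ?thesis .
qed

text \<open>A route to the Penrose equations without a rank factorization. The normal equations turn
  the transpose of \<open>M * X\<close> into a product of a matrix with its transpose, hence
  \<open>M * X\<close> is symmetric; the left factor \<open>M^T M\<close> of \<open>X\<close> does
  the same for \<open>X * M\<close>. The other two equations follow by transposition.\<close>

lemma is_pinv_of_normal_eq:
  fixes M :: "real mat"
  assumes M: "M \<in> carrier_mat m n" and X: "X \<in> carrier_mat n m" and Y: "Y \<in> carrier_mat n m"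
    and NX: "transpose_mat M * M * X = transpose_mat M" and XY: "X = transpose_mat M * M * Y"
  shows "is_pinv M X"
proof -
  let ?T = "transpose_mat M"
  define N where "N = ?T * M"
  have T: "?T \<in> carrier_mat n m" and N: "N \<in> carrier_mat n n" using M by (auto simp: N_def)
  have NT: "transpose_mat N = N" unfolding N_def using M by (simp add: transpose_mult[of _ n m _ n])
  have NX': "N * X = ?T" and XY': "X = N * Y" using NX XY by (auto simp: N_def)
  have MX: "M * X \<in> carrier_mat m m" and XM: "X * M \<in> carrier_mat n n" using M X by auto
  have TMX: "?T * (M * X) = ?T" using NX' M X unfolding N_def by (simp add: assoc_mult_mat[of _ n m _ n _ m])
  have symMX: "transpose_mat (M * X) = M * X"
  proof -
    have "transpose_mat (M * X) = transpose_mat X * ?T" using M X by (intro transpose_mult)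
    also have "\<dots> = transpose_mat X * (?T * (M * X))" using TMX by simp
    also have "\<dots> = (transpose_mat X * ?T) * (M * X)" using M X by (simp add: assoc_mult_mat[of _ m n _ m _ m])
    also have "\<dots> = transpose_mat (M * X) * (M * X)" using transpose_mult[OF M X] by simp
    finally have e: "transpose_mat (M * X) = transpose_mat (M * X) * (M * X)" .
    then have "M * X = transpose_mat (transpose_mat (M * X) * (M * X))" by (metis transpose_transpose)
    also have "\<dots> = transpose_mat (M * X) * (M * X)" using MX by (simp add: transpose_mult[of _ m m _ m])
    finally show ?thesis using e by simp
  qed
  have MXM: "M * X * M = M"
  proof -
    have "transpose_mat (?T * (M * X)) = M * X * M"
      using M X symMX by (simp add: transpose_mult[of _ n m _ m])
    then show ?thesis using TMX by simp
  qed
  define P where "P = X * M"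
  define Z where "Z = Y * M"
  have P: "P \<in> carrier_mat n n" and Z: "Z \<in> carrier_mat n n" using X Y M by (auto simp: P_def Z_def)
  have PZ: "P = N * Z" unfolding P_def Z_def XY' using N Y M by (simp add: assoc_mult_mat[of _ n n _ m _ n])
  have NP: "N * P = N"
  proof -
    have "N * P = N * X * M" unfolding P_def using N X M by (simp add: assoc_mult_mat[of _ n n _ m _ n])
    then show ?thesis using NX' by (simp add: N_def)
  qed
  have symP: "transpose_mat P = P"
  proof -
    have e: "transpose_mat P = transpose_mat Z * N" unfolding PZ using N Z NT by (simp add: transpose_mult[of _ n n _ n])
    have "transpose_mat P * P = transpose_mat Z * (N * P)" unfolding e using N Z P by (simp add: assoc_mult_mat[of _ n n _ n _ n])
    then have e2: "transpose_mat P * P = transpose_mat P" using NP e by simp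
    then have "P = transpose_mat (transpose_mat P * P)" by simp
    also have "\<dots> = transpose_mat P * P" using P by (simp add: transpose_mult[of _ n n _ n])
    finally show ?thesis using e2 by simp
  qed
  have XMX: "X * M * X = X"
  proof -
    have "P * N = N"
      using arg_cong[OF NP, of transpose_mat] N P NT symP by (simp add: transpose_mult[of _ n n _ n])
    then have "P * X = X" unfolding XY' using P N Y by (metis assoc_mult_mat)
    then show ?thesis by (simp add: P_def)
  qed
  show ?thesis unfolding is_pinv_def using M X MXM XMX symMX symP by (auto simp: P_def)
qed

text \<open>Index \<open>n\<close>, one past the coefficient columns, stands for the right-hand side
  from here on: the data matrix carries it as an extra column.\<close>

definition gram :: "nat \<Rightarrow> (nat \<Rightarrow> nat \<Rightarrow> real) \<Rightarrow> nat \<Rightarrow> nat \<Rightarrow> real" where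
  "gram m M i j = (\<Sum>k<m. M k i * M k j)"

definition bordered_gram :: "nat \<Rightarrow> nat \<Rightarrow> (nat \<Rightarrow> nat \<Rightarrow> real) \<Rightarrow> nat \<Rightarrow> nat \<Rightarrow> real" where
  "bordered_gram m n M i j = (if i < n then gram m M i j else if i = n \<and> j = n then 1 else 0)"

text \<open>With \<open>N\<close> the Gram matrix of the first \<open>n\<close> columns and \<open>z\<close> their products with column \<open>n\<close>,
  Gram--Schmidt turns the last unit vector into a multiple of \<open>(-x, 1)\<close> orthogonal to the rows of
  \<open>[N | z]\<close>, so \<open>N x = z\<close>; moreover \<open>x\<close> lies in the range of \<open>N\<close>, which singles out the
  least-squares solution of minimal norm.  No pivoting or case distinction is needed.\<close>

definition lsq_solution :: "nat \<Rightarrow> nat \<Rightarrow> (nat \<Rightarrow> nat \<Rightarrow> real) \<Rightarrow> nat \<Rightarrow> real" where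
  "lsq_solution m n M j =
     - gs (Suc n) (bordered_gram m n M) n j / gs (Suc n) (bordered_gram m n M) n n"

lemma gram_commute: "gram m M i j = gram m M j i"
  by (simp add: gram_def mult.commute)

lemma lsq_solution:
  shows "\<And>i. i < n \<Longrightarrow> (\<Sum>j<n. gram m M i j * lsq_solution m n M j) = gram m M i n"
    and "\<exists>y. \<forall>j<n. lsq_solution m n M j = (\<Sum>i<n. gram m M j i * y i)"
proof -
  define R where "R = bordered_gram m n M"
  define u where "u = gs (Suc n) R n"
  have Rlt: "R i j = gram m M i j" if "i < n" for i j using that by (simp add: R_def bordered_gram_def)
  have Rn: "R n j = (if j = n then 1 else 0)" for j by (simp add: R_def bordered_gram_def)
  have orth: "dotp (Suc n) u (R i) = 0" if "i < n" for i
    by (rule orth_gs_imp_orth_rows[of n _ _ R]) (use that gs_orth_less in \<open>auto simp: u_def\<close>)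
  obtain a where a: "\<And>j. u j = R n j + (\<Sum>l<n. a l * R l j)"
    using gs_expand_rows[of "Suc n" R n] u_def by blast
  have u_eq: "u = (\<lambda>j. R n j + (\<Sum>l<n. a l * R l j))" using a by auto
  \<comment> \<open>Only the term \<open>R n\<close>, with coefficient 1, survives, since
    \<open>u\<close> is orthogonal to all other rows.\<close>
  have uu: "dotp (Suc n) u u = u n"
  proof -
    have "dotp (Suc n) u u = dotp (Suc n) (R n) u + (\<Sum>l<n. a l * dotp (Suc n) (R l) u)"
      by (subst (1) u_eq) (simp add: dotp_add_left dotp_sum_left dotp_scale_left)
    also have "\<dots> = dotp (Suc n) (R n) u" using orth by (simp add: dotp_commute)
    also have "\<dots> = u n" by (simp add: dotp_def Rn)
    finally show ?thesis .
  qed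
  \<comment> \<open>If \<open>u n\<close> vanished, so would \<open>u\<close>. The coefficients
    \<open>a\<close> would then lie in the kernel of the Gram matrix, hence in that of the first
    \<open>n\<close> columns; their pairing with column \<open>n\<close> would be zero as well,
    leaving \<open>u n = 1\<close>.\<close>
  have un: "u n \<noteq> 0"
  proof
    assume "u n = 0"
    then have u0: "u j = 0" if "j \<le> n" for j
      using dotp_self_eq_0[of "Suc n" u j] uu that by simp
    have s0: "(\<Sum>l<n. a l * gram m M l j) = 0" if "j < n" for j
      using u0[of j] that by (simp add: a Rn Rlt)
    have "(\<Sum>k<m. (\<Sum>l<n. a l * M k l)\<^sup>2) = (\<Sum>k<m. \<Sum>j<n. \<Sum>l<n. a j * M k j * (a l * M k l))"
      by (simp only: power2_eq_square sum_product)
    also have "\<dots> = (\<Sum>j<n. \<Sum>l<n. \<Sum>k<m. a j * M k j * (a l * M k l))"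
      by (rule trans[OF sum.swap]) (rule sum.cong[OF refl], rule sum.swap)
    also have "\<dots> = (\<Sum>j<n. a j * (\<Sum>l<n. a l * gram m M l j))"
      by (simp add: gram_def sum_distrib_left mult_ac)
    also have "\<dots> = 0" using s0 by simp
    finally have "(\<Sum>k<m. (\<Sum>l<n. a l * M k l)\<^sup>2) = 0" .
    then have k0: "(\<Sum>l<n. a l * M k l) = 0" if "k < m" for k
      using that by (subst (asm) sum_nonneg_eq_0_iff) auto
    have "(\<Sum>l<n. a l * gram m M l n) = (\<Sum>k<m. (\<Sum>l<n. a l * M k l) * M k n)"
      unfolding gram_def sum_distrib_left sum_distrib_right by (subst sum.swap) (simp add: mult_ac)
    also have "\<dots> = 0" using k0 by simp
    finally have "u n = 1" by (simp add: a Rn Rlt)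
    with \<open>u n = 0\<close> show False by simp
  qed
  have x: "lsq_solution m n M j = - u j / u n" for j by (simp add: lsq_solution_def u_def R_def)
  show "(\<Sum>j<n. gram m M i j * lsq_solution m n M j) = gram m M i n" if "i < n" for i
  proof -
    have "(\<Sum>j<n. gram m M i j * u j) + gram m M i n * u n = 0"
      using orth[OF that] that by (simp add: dotp_def Rlt mult.commute)
    then have "(\<Sum>j<n. gram m M i j * u j) = - gram m M i n * u n" by simp
    moreover have "(\<Sum>j<n. gram m M i j * lsq_solution m n M j) = - (\<Sum>j<n. gram m M i j * u j) / u n"
      by (simp add: x sum_negf sum_divide_distrib)
    ultimately show ?thesis using un by simp
  qed
  \<comment> \<open>Below index \<open>n\<close> the unit vector contributes nothing, so
    \<open>u\<close> is there a combination of rows of the symmetric Gram matrix, and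
    \<open>x\<close> lies in its range.\<close>
  have "lsq_solution m n M j = (\<Sum>i<n. gram m M j i * (- a i / u n))" if "j < n" for j
  proof -
    have "- u j / u n = - (\<Sum>l<n. a l * gram m M l j) / u n" using that by (simp add: a[of j] Rn Rlt)
    also have "\<dots> = (\<Sum>i<n. gram m M j i * (- a i / u n))"
      unfolding sum_divide_distrib sum_negf[symmetric]
      by (intro sum.cong refl) (subst gram_commute, simp)
    finally show ?thesis by (simp only: x)
  qed
  then show "\<exists>y. \<forall>j<n. lsq_solution m n M j = (\<Sum>i<n. gram m M j i * y i)"
    by (intro exI[of _ "\<lambda>i. - a i / u n"]) simp
qed

text \<open>The kernel of a symmetric matrix is orthogonal to its range. Hence the normal equations
  have at most one solution in the range of the Gram matrix.\<close>

lemma range_inter_kernel_trivial: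
  fixes N :: "nat \<Rightarrow> nat \<Rightarrow> real"
  assumes sym: "\<And>i j. N i j = N j i" and ker: "\<And>i. i < n \<Longrightarrow> (\<Sum>j<n. N i j * w j) = 0"
    and ran: "\<And>j. j < n \<Longrightarrow> w j = (\<Sum>i<n. N j i * y i)" and "j < n"
  shows "w j = 0"
proof -
  have "dotp n w w = (\<Sum>j<n. w j * (\<Sum>i<n. N j i * y i))"
    using ran by (simp add: dotp_def)
  also have "\<dots> = (\<Sum>i<n. y i * (\<Sum>j<n. N i j * w j))"
    unfolding sum_distrib_left by (subst sum.swap) (simp add: mult_ac sym)
  also have "\<dots> = 0" using ker by simp
  finally show ?thesis using dotp_self_eq_0 \<open>j < n\<close> by blast
qed

lemma gram_mat_index:
  fixes M :: "real mat"
  assumes "M \<in> carrier_mat m n" "i < n" "j < n" "\<And>k j. k < m \<Longrightarrow> j < n \<Longrightarrow> F k j = M $$ (k, j)"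
  shows "(transpose_mat M * M) $$ (i, j) = gram m F i j"
  using assms by (simp add: scalar_prod_def gram_def lessThan_atLeast0)

lemma mult_mat_index_sum:
  "P \<in> carrier_mat a n \<Longrightarrow> Q \<in> carrier_mat n c \<Longrightarrow> i < a \<Longrightarrow> j < c \<Longrightarrow>
    (P * Q) $$ (i, j) = (\<Sum>k<n. P $$ (i, k) * Q $$ (k, j))"
  by (simp add: scalar_prod_def lessThan_atLeast0)

lemma mult_mat_vec_index_sum:
  "P \<in> carrier_mat a n \<Longrightarrow> v \<in> carrier_vec n \<Longrightarrow> i < a \<Longrightarrow>
    (P *\<^sub>v v) $ i = (\<Sum>k<n. P $$ (i, k) * v $ k)"
  by (simp add: scalar_prod_def lessThan_atLeast0)

text \<open>Column \<open>c\<close> of the pseudoinverse is the least-squares solution for the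
  \<open>c\<close>-th unit vector, which \<open>F c\<close> places in column \<open>n\<close>;
  \<open>Y\<close> collects the witnesses for the range condition.\<close>

lemma ex_is_pinv:
  fixes M :: "real mat"
  shows "\<exists>X Y. is_pinv M X \<and> Y \<in> carrier_mat (dim_col M) (dim_row M) \<and>
    transpose_mat M * M * X = transpose_mat M \<and> X = transpose_mat M * M * Y"
proof -
  define m n where "m = dim_row M" and "n = dim_col M"
  have M: "M \<in> carrier_mat m n" by (simp add: m_def n_def)
  define F where "F c = (\<lambda>k j. if j < n then M $$ (k, j) else if k = c then 1 else 0)" for c :: nat
  have "\<forall>c. \<exists>y. \<forall>j<n. lsq_solution m n (F c) j = (\<Sum>i<n. gram m (F c) j i * y i)"
    by (intro allI lsq_solution(2))
  from choice[OF this] obtain y where y: "\<And>c j. j < n \<Longrightarrow> lsq_solution m n (F c) j = (\<Sum>i<n. gram m (F c) j i * y c i)" by blast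
  define X where "X = Matrix.mat n m (\<lambda>(j, c). lsq_solution m n (F c) j)"
  define Y where "Y = Matrix.mat n m (\<lambda>(j, c). y c j)"
  have X: "X \<in> carrier_mat n m" and Y: "Y \<in> carrier_mat n m" by (auto simp: X_def Y_def)
  have N: "(transpose_mat M * M) $$ (i, j) = gram m (F c) i j" if "i < n" "j < n" for i j c
    by (rule gram_mat_index[OF M that]) (simp add: F_def)
  have Nc: "transpose_mat M * M \<in> carrier_mat n n" using M by auto
  have NX: "transpose_mat M * M * X = transpose_mat M"
  proof (rule eq_matI)
    fix i c assume "i < dim_row (transpose_mat M)" "c < dim_col (transpose_mat M)"
    then have i: "i < n" and c: "c < m" using M by auto
    have "(transpose_mat M * M * X) $$ (i, c) = (\<Sum>j<n. (transpose_mat M * M) $$ (i, j) * X $$ (j, c))"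
      by (rule mult_mat_index_sum[OF Nc X i c])
    also have "\<dots> = (\<Sum>j<n. gram m (F c) i j * lsq_solution m n (F c) j)"
      using N[where c=c] i c by (intro sum.cong) (auto simp: X_def)
    also have "\<dots> = gram m (F c) i n" by (rule lsq_solution(1)[OF i])
    also have "\<dots> = (\<Sum>k<m. if k = c then M $$ (k, i) else 0)"
      unfolding gram_def using i by (intro sum.cong) (auto simp: F_def)
    also have "\<dots> = M $$ (c, i)" using c by simp
    finally show "(transpose_mat M * M * X) $$ (i, c) = transpose_mat M $$ (i, c)" using i c M by simp
  qed (use M X in auto)
  have XY: "X = transpose_mat M * M * Y"
  proof (rule eq_matI)
    fix i c assume "i < dim_row (transpose_mat M * M * Y)" "c < dim_col (transpose_mat M * M * Y)"
    then have i: "i < n" and c: "c < m" using M Y by auto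
    have "(transpose_mat M * M * Y) $$ (i, c) = (\<Sum>j<n. (transpose_mat M * M) $$ (i, j) * Y $$ (j, c))"
      by (rule mult_mat_index_sum[OF Nc Y i c])
    also have "\<dots> = (\<Sum>j<n. gram m (F c) i j * y c j)"
      using N[where c=c] i c by (intro sum.cong) (auto simp: Y_def)
    finally show "X $$ (i, c) = (transpose_mat M * M * Y) $$ (i, c)" using i c y by (simp add: X_def)
  qed (use M X Y in auto)
  show ?thesis
    using is_pinv_of_normal_eq[OF M X Y NX XY] NX XY Y by (auto simp: m_def n_def)
qed

text \<open>Both sides solve the normal equations and lie in the range of the Gram matrix, so their
  difference belongs to kernel and range at once.\<close>

lemma pinv_mult_vec:
  fixes M :: "real mat"
  assumes M: "M \<in> carrier_mat m n" and v: "v \<in> carrier_vec m"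
    and F: "\<And>k j. k < m \<Longrightarrow> j < n \<Longrightarrow> F k j = M $$ (k, j)" "\<And>k. k < m \<Longrightarrow> F k n = v $ k"
  shows "pinv M *\<^sub>v v = Matrix.vec n (lsq_solution m n F)"
proof -
  obtain X Y where X: "is_pinv M X" and Yc: "Y \<in> carrier_mat n m"
    and NX: "transpose_mat M * M * X = transpose_mat M" and XY: "X = transpose_mat M * M * Y"
    using ex_is_pinv[of M] M by auto
  have pX: "pinv M = X"
    unfolding pinv_def using X is_pinv_unique by (intro the_equality) auto
  have Xc: "X \<in> carrier_mat n m" using X M by (auto simp: is_pinv_def)
  let ?N = "transpose_mat M * M"
  have Nc: "?N \<in> carrier_mat n n" using M by auto
  have N: "?N $$ (i, j) = gram m F i j" if "i < n" "j < n" for i j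
    by (rule gram_mat_index[OF M that]) (simp add: F)
  have Nv: "(?N *\<^sub>v z) $ i = (\<Sum>j<n. gram m F i j * z $ j)" if "z \<in> carrier_vec n" "i < n" for z i
  proof -
    have "(?N *\<^sub>v z) $ i = (\<Sum>j<n. ?N $$ (i, j) * z $ j)"
      by (rule mult_mat_vec_index_sum[OF Nc that])
    then show ?thesis using N that by simp
  qed
  define x' where "x' = X *\<^sub>v v"
  define y' where "y' = Y *\<^sub>v v"
  have x': "x' \<in> carrier_vec n" and y': "y' \<in> carrier_vec n" using Xc Yc v by (auto simp: x'_def y'_def)
  have "?N *\<^sub>v x' = transpose_mat M *\<^sub>v v"
    unfolding x'_def using assoc_mult_mat_vec[OF Nc Xc v] NX by simp
  then have 1: "(\<Sum>j<n. gram m F i j * x' $ j) = gram m F i n" if "i < n" for i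
    using Nv[OF x' that] that M v F by (simp add: scalar_prod_def gram_def lessThan_atLeast0)
  have "x' = ?N *\<^sub>v y'"
    unfolding x'_def y'_def using assoc_mult_mat_vec[OF Nc Yc v] XY by simp
  then have 2: "x' $ i = (\<Sum>j<n. gram m F i j * y' $ j)" if "i < n" for i
    using Nv[OF y' that] by simp
  obtain y where y: "\<And>j. j < n \<Longrightarrow> lsq_solution m n F j = (\<Sum>i<n. gram m F j i * y i)"
    using lsq_solution(2) by blast
  have 3: "(\<Sum>j<n. gram m F i j * (x' $ j - lsq_solution m n F j)) = 0" if "i < n" for i
    using 1[OF that] lsq_solution(1)[OF that, of m F] by (simp add: right_diff_distrib sum_subtractf)
  have 4: "x' $ j - lsq_solution m n F j = (\<Sum>i<n. gram m F j i * (y' $ i - y i))" if "j < n" for j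
    unfolding 2[OF that] y[OF that] by (simp add: right_diff_distrib sum_subtractf)
  have 5: "x' $ j - lsq_solution m n F j = 0" if "j < n" for j
    by (rule range_inter_kernel_trivial[of "gram m F" n "\<lambda>j. x' $ j - lsq_solution m n F j" "\<lambda>i. y' $ i - y i", OF gram_commute 3 4 that])
  then show ?thesis
    using x' 5 by (intro eq_vecI) (auto simp: pX x'_def[symmetric])
qed

section \<open>Entries of the sketched data and optimality of the solution\<close>

definition hashed :: "nat \<Rightarrow> (nat \<Rightarrow> real) \<Rightarrow> (nat \<Rightarrow> real) \<Rightarrow> (nat \<Rightarrow> nat) \<Rightarrow> (nat \<Rightarrow> nat \<Rightarrow> real) \<Rightarrow> nat \<Rightarrow> nat \<Rightarrow> real" where
  "hashed n w \<sigma> h B r j = (\<Sum>i<n. if h i = r then \<sigma> i * B i j / w i else 0)"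

definition gaussed :: "nat \<Rightarrow> nat \<Rightarrow> (nat \<times> nat \<Rightarrow> real) \<Rightarrow> (nat \<Rightarrow> nat \<Rightarrow> real) \<Rightarrow> nat \<Rightarrow> nat \<Rightarrow> real" where
  "gaussed t1 t2 g P k j = (\<Sum>r<t1. g (k, r) / sqrt (real t2) * P r j)"

definition augmented :: "nat \<Rightarrow> real mat \<Rightarrow> real vec \<Rightarrow> nat \<Rightarrow> nat \<Rightarrow> real" where
  "augmented d A b i j = (if j < d then A $$ (i, j) else b $ i)"

lemma sketch_carrier: "sketch n t1 t2 \<omega> \<in> carrier_mat t2 n"
proof (cases \<omega>)
  case (fields w \<sigma> h g)
  have "sparse_embedding t1 n \<sigma> h \<in> carrier_mat t1 n"
    unfolding sparse_embedding_def by (rule mult_carrier_mat[OF _ mat_diag_dim]) simp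
  then have "gaussian_matrix t2 t1 g * sparse_embedding t1 n \<sigma> h \<in> carrier_mat t2 n"
    by (intro mult_carrier_mat[of _ _ t1]) (simp_all add: gaussian_matrix_def)
  then show ?thesis
    unfolding fields sketch.simps by (rule mult_carrier_mat[OF _ mat_diag_dim])
qed

lemma sketch_index:
  assumes "k < t2" "i < n"
  shows "sketch n t1 t2 (w, \<sigma>, h, g) $$ (k, i) =
    (\<Sum>r<t1. g (k, r) / sqrt (real t2) * (if h i = r then \<sigma> i / w i else 0))"
proof -
  let ?G = "gaussian_matrix t2 t1 g" and ?E = "sparse_embedding t1 n \<sigma> h"
  have G: "?G \<in> carrier_mat t2 t1" by (simp add: gaussian_matrix_def)
  have P: "Matrix.mat t1 n (\<lambda>(r, i). if h i = r then 1 else 0 :: real) \<in> carrier_mat t1 n" by simp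
  have E: "?E \<in> carrier_mat t1 n"
    unfolding sparse_embedding_def by (rule mult_carrier_mat[OF P mat_diag_dim])
  have Ei: "?E $$ (r, i) = (if h i = r then 1 else 0) * \<sigma> i" if "r < t1" for r
    unfolding sparse_embedding_def mat_diag_mult_right[OF P] using that assms by simp
  have "sketch n t1 t2 (w, \<sigma>, h, g) $$ (k, i) = (?G * ?E) $$ (k, i) * inverse (w i)"
    unfolding sketch.simps mat_diag_mult_right[OF mult_carrier_mat[OF G E]] using assms by simp
  also have "\<dots> = (\<Sum>r<t1. ?G $$ (k, r) * ?E $$ (r, i)) * inverse (w i)"
    using mult_mat_index_sum[OF G E assms] by simp
  also have "\<dots> = (\<Sum>r<t1. g (k, r) / sqrt (real t2) * ((if h i = r then 1 else 0) * \<sigma> i)) * inverse (w i)"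
    using assms by (simp add: Ei gaussian_matrix_def)
  also have "\<dots> = (\<Sum>r<t1. g (k, r) / sqrt (real t2) * (if h i = r then \<sigma> i / w i else 0))"
    unfolding sum_distrib_right by (intro sum.cong) (auto simp: field_simps)
  finally show ?thesis .
qed

lemma sum_sketch_mult:
  assumes "k < t2"
  shows "(\<Sum>i<n. sketch n t1 t2 (w, \<sigma>, h, g) $$ (k, i) * B i j) = gaussed t1 t2 g (hashed n w \<sigma> h B) k j"
proof -
  have "(\<Sum>i<n. sketch n t1 t2 (w, \<sigma>, h, g) $$ (k, i) * B i j) =
      (\<Sum>i<n. \<Sum>r<t1. g (k, r) / sqrt (real t2) * (if h i = r then \<sigma> i / w i else 0) * B i j)"
    using assms by (simp add: sketch_index sum_distrib_right del: sketch.simps)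
  also have "\<dots> = (\<Sum>r<t1. \<Sum>i<n. g (k, r) / sqrt (real t2) * (if h i = r then \<sigma> i / w i else 0) * B i j)"
    by (rule sum.swap)
  also have "\<dots> = gaussed t1 t2 g (hashed n w \<sigma> h B) k j"
    unfolding gaussed_def hashed_def sum_distrib_left by (intro sum.cong) auto
  finally show ?thesis .
qed

text \<open>Division by a zero weight gives 0, in agreement with \<open>inverse 0 = 0\<close> in the
  sketch, so the identity holds for every draw. It serves both the program, which has to be right
  pointwise, and the measurability of the output.\<close>

lemma x_hat_eq:
  assumes A: "A \<in> carrier_mat n d" and b: "b \<in> carrier_vec n"
  shows "x_hat A b t1 t2 (w, \<sigma>, h, g) =
    Matrix.vec d (lsq_solution t2 d (gaussed t1 t2 g (hashed n w \<sigma> h (augmented d A b))))"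
proof -
  define S where "S = sketch n t1 t2 (w, \<sigma>, h, g)"
  have S: "S \<in> carrier_mat t2 n" unfolding S_def by (rule sketch_carrier)
  have *: "gaussed t1 t2 g (hashed n w \<sigma> h (augmented d A b)) k j = (\<Sum>i<n. S $$ (k, i) * augmented d A b i j)"
    if "k < t2" for k j unfolding S_def using sum_sketch_mult[OF that] by simp
  have "x_hat A b t1 t2 (w, \<sigma>, h, g) = pinv (S * A) *\<^sub>v (S *\<^sub>v b)"
    using A by (simp add: x_hat_def Let_def S_def del: sketch.simps)
  also have "\<dots> = Matrix.vec d (lsq_solution t2 d (gaussed t1 t2 g (hashed n w \<sigma> h (augmented d A b))))"
    by (rule pinv_mult_vec[of _ t2])
      (use S A b in \<open>auto simp: * augmented_def scalar_prod_def lessThan_atLeast0\<close>)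
  finally show ?thesis .
qed

text \<open>Pythagoras: the residual \<open>q\<close> at the solution is orthogonal to every
  combination \<open>p\<close> of the columns. The first bound controls the distance to a competitor
  without the factor 2 of a triangle inequality; the second is plain optimality.\<close>

lemma lsq_solution_minimizes:
  shows "(\<Sum>k<m. (\<Sum>j<n. M k j * (lsq_solution m n M j - x j))\<^sup>2) \<le> (\<Sum>k<m. ((\<Sum>j<n. M k j * x j) - M k n)\<^sup>2)"
    and "(\<Sum>k<m. ((\<Sum>j<n. M k j * lsq_solution m n M j) - M k n)\<^sup>2) \<le> (\<Sum>k<m. ((\<Sum>j<n. M k j * x j) - M k n)\<^sup>2)"
proof -
  define s where "s = lsq_solution m n M"
  define p where "p k = (\<Sum>j<n. M k j * (s j - x j))" for k
  define q where "q k = (\<Sum>j<n. M k j * s j) - M k n" for k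
  have orth: "(\<Sum>k<m. p k * q k) = 0"
  proof -
    have c: "(\<Sum>k<m. M k j * q k) = 0" if "j < n" for j
    proof -
      have "(\<Sum>k<m. M k j * q k) = (\<Sum>i<n. gram m M j i * s i) - gram m M j n"
        unfolding q_def right_diff_distrib sum_subtractf gram_def sum_distrib_left sum_distrib_right
        by (subst sum.swap) (simp add: mult_ac)
      then show ?thesis using lsq_solution(1)[OF that, of m M] by (simp add: s_def)
    qed
    have "(\<Sum>k<m. p k * q k) = (\<Sum>j<n. (s j - x j) * (\<Sum>k<m. M k j * q k))"
      unfolding p_def sum_distrib_left sum_distrib_right by (subst sum.swap) (simp add: mult_ac)
    then show ?thesis using c by simp
  qed
  have "(\<Sum>j<n. M k j * x j) - M k n = q k - p k" for k
    by (simp add: p_def q_def right_diff_distrib sum_subtractf)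
  then have "((\<Sum>j<n. M k j * x j) - M k n)\<^sup>2 = (q k)\<^sup>2 + (p k)\<^sup>2 - 2 * (p k * q k)" for k
    by (simp only: power2_eq_square) (simp add: algebra_simps)
  then have "(\<Sum>k<m. ((\<Sum>j<n. M k j * x j) - M k n)\<^sup>2) = (\<Sum>k<m. (q k)\<^sup>2 + (p k)\<^sup>2 - 2 * (p k * q k))"
    by simp
  also have "\<dots> = (\<Sum>k<m. (q k)\<^sup>2) + (\<Sum>k<m. (p k)\<^sup>2)"
    using orth by (simp add: sum.distrib sum_subtractf sum_distrib_left[symmetric])
  finally have pythagoras: "(\<Sum>k<m. ((\<Sum>j<n. M k j * x j) - M k n)\<^sup>2) = (\<Sum>k<m. (q k)\<^sup>2) + (\<Sum>k<m. (p k)\<^sup>2)" .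
  show "(\<Sum>k<m. (\<Sum>j<n. M k j * (lsq_solution m n M j - x j))\<^sup>2) \<le> (\<Sum>k<m. ((\<Sum>j<n. M k j * x j) - M k n)\<^sup>2)"
    unfolding pythagoras by (simp add: p_def s_def sum_nonneg)
  show "(\<Sum>k<m. ((\<Sum>j<n. M k j * lsq_solution m n M j) - M k n)\<^sup>2) \<le> (\<Sum>k<m. ((\<Sum>j<n. M k j * x j) - M k n)\<^sup>2)"
    unfolding pythagoras by (simp add: q_def s_def sum_nonneg)
qed

section \<open>The regression program\<close>

text \<open>A Hoare triple with a time budget. Termination needs no argument, because
  \<open>exec\<close> is a total function.\<close>

definition run :: "com \<Rightarrow> store \<Rightarrow> nat \<Rightarrow> (store \<Rightarrow> bool) \<Rightarrow> bool" where
  "run c s B Q \<longleftrightarrow> fst (exec c s) \<le> B \<and> Q (snd (exec c s))"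

lemma run_mono: "run c s B Q \<Longrightarrow> B \<le> B' \<Longrightarrow> (\<And>s'. Q s' \<Longrightarrow> Q' s') \<Longrightarrow> run c s B' Q'"
  by (auto simp: run_def)

lemma run_Seq:
  assumes "run c1 s B1 R" "\<And>s'. R s' \<Longrightarrow> run c2 s' B2 Q"
  shows "run (Seq c1 c2) s (B1 + B2) Q"
  using assms by (fastforce simp: run_def split: prod.splits)

text \<open>The bound of the loop is read in the store on entry, so the body may change index memory
  freely. The summand 1 in \<open>1 + B\<close> is the overhead of an iteration.\<close>

lemma run_For:
  assumes step: "\<And>k s'. k < ival s e \<Longrightarrow> Inv k s' \<Longrightarrow> run c (iupd v 0 k s') B (Inv (Suc k))"
    and init: "Inv 0 s"
  shows "run (For v e c) s (1 + icost e + ival s e * (1 + B)) (Inv (ival s e))"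
proof -
  define F where "F = (\<lambda>i (k, s1). let (k', s2) = exec c (iupd v 0 i s1) in (1 + k + k', s2))"
  have "fst (fold F [0..<N] (1 + icost e, s)) \<le> 1 + icost e + N * (1 + B) \<and> Inv N (snd (fold F [0..<N] (1 + icost e, s)))"
    if "N \<le> ival s e" for N
    using that
  proof (induction N)
    case (Suc N)
    obtain T s' where f: "fold F [0..<N] (1 + icost e, s) = (T, s')" by fastforce
    with Suc have T: "T \<le> 1 + icost e + N * (1 + B)" and I: "Inv N s'" by auto
    obtain T' s'' where x: "exec c (iupd v 0 N s') = (T', s'')" by fastforce
    have "T' \<le> B" "Inv (Suc N) s''"
      using step[OF _ I] Suc.prems x by (auto simp: run_def)
    moreover have "fold F [0..<Suc N] (1 + icost e, s) = F N (T, s')"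
      using f by simp
    moreover have "F N (T, s') = (1 + T + T', s'')" by (simp add: F_def x)
    ultimately show ?case using T by (simp del: upt_Suc)
  qed (use init in simp)
  then show ?thesis by (simp add: run_def F_def)
qed

section \<open>Loops that accumulate sums into one array\<close>

definition increment :: "string \<Rightarrow> iexp \<Rightarrow> iexp \<Rightarrow> rexp \<Rightarrow> com" where
  "increment X a b t = RSet X a b (RAdd (RGet X a b) t)"

text \<open>\<open>W\<close> collects the loop variables that \<open>c\<close> overwrites.\<close>

definition adds :: "string set \<Rightarrow> string \<Rightarrow> com \<Rightarrow> store \<Rightarrow> nat \<Rightarrow> (nat \<Rightarrow> nat \<Rightarrow> real) \<Rightarrow> bool" where
  "adds W X c s B \<Delta> \<longleftrightarrow> run c s B (\<lambda>s'. rmem s' = (rmem s)(X := (\<lambda>p q. rmem s X p q + \<Delta> p q)) \<and>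
     (\<forall>a. a \<notin> W \<longrightarrow> imem s' a = imem s a))"

lemma adds_increment:
  "adds {} X (increment X a b t) s (3 + 2 * icost a + 2 * icost b + rcost t)
     (\<lambda>p q. if ival s a = p \<and> ival s b = q then rval s t else 0)"
  by (auto simp: adds_def increment_def run_def rupd_def fun_eq_iff)

lemma adds_mono: "adds W X c s B \<Delta> \<Longrightarrow> B \<le> B' \<Longrightarrow> W \<subseteq> W' \<Longrightarrow> adds W' X c s B' \<Delta>"
  unfolding adds_def by (erule run_mono) auto

lemma imem_iupd: "imem (iupd v i k s) = (imem s)(v := (imem s v)(i := k))"
  and rmem_iupd: "rmem (iupd v i k s) = rmem s"
  by (simp_all add: iupd_def)

lemma imem_rupd: "imem (rupd a i j v s) = imem s"
  and rmem_rupd: "rmem (rupd a i j v s) = (rmem s)(a := (rmem s a)(i := (rmem s a i)(j := v)))"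
  by (simp_all add: rupd_def)

text \<open>A loop adds the sum of what its iterations add, so nested loops yield nested sums
  without new invariants. The step also sees the partial sum stored in \<open>X\<close>, which
  matters when the body reads the array that it updates.\<close>

lemma adds_For:
  assumes step: "\<And>k (s' :: store). k < ival s e \<Longrightarrow> imem s' v 0 = k \<Longrightarrow>
      (\<And>a. a \<notin> insert v W \<Longrightarrow> imem s' a = imem s a) \<Longrightarrow>
      (\<And>Y. Y \<noteq> X \<Longrightarrow> rmem s' Y = rmem s Y) \<Longrightarrow>
      (\<And>p q. rmem s' X p q = rmem s X p q + (\<Sum>k'<k. \<Delta> k' p q)) \<Longrightarrow> adds W X c s' B (\<Delta> k)"
  shows "adds (insert v W) X (For v e c) s (1 + icost e + ival s e * (1 + B)) (\<lambda>p q. \<Sum>k<ival s e. \<Delta> k p q)"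
  unfolding adds_def
proof (rule run_For[where Inv = "\<lambda>k s'. rmem s' = (rmem s)(X := \<lambda>p q. rmem s X p q + (\<Sum>k'<k. \<Delta> k' p q)) \<and>
          (\<forall>a. a \<notin> insert v W \<longrightarrow> imem s' a = imem s a)"])
  fix k and s' :: store
  assume k: "k < ival s e" and I: "rmem s' = (rmem s)(X := \<lambda>p q. rmem s X p q + (\<Sum>k'<k. \<Delta> k' p q)) \<and>
          (\<forall>a. a \<notin> insert v W \<longrightarrow> imem s' a = imem s a)"
  have "adds W X c (iupd v 0 k s') B (\<Delta> k)"
    by (rule step[OF k]) (use I in \<open>auto simp: imem_iupd rmem_iupd\<close>)
  then show "run c (iupd v 0 k s') B (\<lambda>s'. rmem s' = (rmem s)(X := \<lambda>p q. rmem s X p q + (\<Sum>k'<Suc k. \<Delta> k' p q)) \<and>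
          (\<forall>a. a \<notin> insert v W \<longrightarrow> imem s' a = imem s a))"
    unfolding adds_def by (rule run_mono) (use I in \<open>auto simp: imem_iupd rmem_iupd fun_eq_iff algebra_simps\<close>)
qed auto

section \<open>The stages of the program and their specifications\<close>

abbreviation ivar :: "string \<Rightarrow> iexp" where "ivar v \<equiv> IGet v (Num 0)"

abbreviation width :: iexp where "width \<equiv> IAdd (ivar ''d'') (Num 1)"

definition hash_A :: com where
  "hash_A = For ''k'' (ivar ''nnzA'')
     (increment ''P'' (IGet ''hash'' (IGet ''rowA'' (ivar ''k''))) (IGet ''colA'' (ivar ''k''))
        (RDiv (RMul (RGet ''Y'' (IGet ''rowA'' (ivar ''k'')) (Num 0)) (RGet ''valA'' (ivar ''k'') (Num 0)))
          (RGet ''D'' (IGet ''rowA'' (ivar ''k'')) (Num 0))))"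

definition hash_b :: com where
  "hash_b = For ''k'' (ivar ''nnzb'')
     (increment ''P'' (IGet ''hash'' (IGet ''rowb'' (ivar ''k''))) (ivar ''d'')
        (RDiv (RMul (RGet ''Y'' (IGet ''rowb'' (ivar ''k'')) (Num 0)) (RGet ''valb'' (ivar ''k'') (Num 0)))
          (RGet ''D'' (IGet ''rowb'' (ivar ''k'')) (Num 0))))"

definition mult_gauss :: com where
  "mult_gauss = For ''i'' (ivar ''t2'') (For ''j'' width (For ''k'' (ivar ''t1'')
     (increment ''Q'' (ivar ''i'') (ivar ''j'')
       (RMul (RGet ''Gauss'' (ivar ''i'') (ivar ''k'')) (RGet ''P'' (ivar ''k'') (ivar ''j''))))))"

definition form_gram :: com where
  "form_gram = For ''i'' (ivar ''d'') (For ''j'' width (For ''k'' (ivar ''t2'')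
     (increment ''N'' (ivar ''i'') (ivar ''j'')
       (RMul (RGet ''Q'' (ivar ''k'') (ivar ''i'')) (RGet ''Q'' (ivar ''k'') (ivar ''j''))))))"

definition inner_product :: "string \<Rightarrow> string \<Rightarrow> string \<Rightarrow> com" where
  "inner_product X a b = For ''j'' width (increment X (Num 0) (Num 0)
      (RMul (RGet ''N'' (ivar a) (ivar ''j'')) (RGet ''N'' (ivar b) (ivar ''j''))))"

definition reduce_row :: com where
  "reduce_row = Seq (RSet ''c'' (Num 0) (Num 0) RZero) (Seq (RSet ''q'' (Num 0) (Num 0) RZero)
     (Seq (inner_product ''c'' ''i'' ''l'') (Seq (inner_product ''q'' ''l'' ''l'')
     (For ''j'' width (increment ''N'' (ivar ''i'') (ivar ''j'')
        (RSub RZero (RMul (RDiv (RGet ''c'' (Num 0) (Num 0)) (RGet ''q'' (Num 0) (Num 0)))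
           (RGet ''N'' (ivar ''l'') (ivar ''j'')))))))))"

definition gram_schmidt :: com where
  "gram_schmidt = For ''i'' width (For ''l'' (ivar ''i'') reduce_row)"

definition read_off :: com where
  "read_off = For ''j'' (ivar ''d'') (RSet ''x'' (ivar ''j'') (Num 0)
     (RDiv (RSub RZero (RGet ''N'' (ivar ''d'') (ivar ''j''))) (RGet ''N'' (ivar ''d'') (ivar ''d''))))"

definition regression :: com where
  "regression = Seq hash_A (Seq hash_b (Seq mult_gauss (Seq form_gram
     (Seq (RSet ''N'' (ivar ''d'') (ivar ''d'') ROne) (Seq gram_schmidt read_off)))))"

lemma ival_ivar: "ival s (ivar v) = imem s v 0"
  by simp

lemma adds_hash_A:
  "adds {''k''} ''P'' hash_A s (3 + imem s ''nnzA'' 0 * 40)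
    (\<lambda>p q. \<Sum>k<imem s ''nnzA'' 0. if imem s ''hash'' (imem s ''rowA'' k) = p \<and> imem s ''colA'' k = q
       then rmem s ''Y'' (imem s ''rowA'' k) 0 * rmem s ''valA'' k 0 / rmem s ''D'' (imem s ''rowA'' k) 0 else 0)"
proof -
  let ?D = "\<lambda>k p q. if imem s ''hash'' (imem s ''rowA'' k) = p \<and> imem s ''colA'' k = q
       then rmem s ''Y'' (imem s ''rowA'' k) 0 * rmem s ''valA'' k 0 / rmem s ''D'' (imem s ''rowA'' k) 0 else 0"
  have "adds (insert ''k'' {}) ''P'' hash_A s (1 + icost (ivar ''nnzA'') + ival s (ivar ''nnzA'') * (1 + 39))
     (\<lambda>p q. \<Sum>k<ival s (ivar ''nnzA''). ?D k p q)"
    unfolding hash_A_def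
  proof (rule adds_For)
    fix k and s' :: store
    assume k: "imem s' ''k'' 0 = k" and a: "\<And>a. a \<notin> {''k''} \<Longrightarrow> imem s' a = imem s a"
      and r: "\<And>Y. Y \<noteq> ''P'' \<Longrightarrow> rmem s' Y = rmem s Y"
    let ?t = "RDiv (RMul (RGet ''Y'' (IGet ''rowA'' (ivar ''k'')) (Num 0)) (RGet ''valA'' (ivar ''k'') (Num 0)))
          (RGet ''D'' (IGet ''rowA'' (ivar ''k'')) (Num 0))"
    let ?a = "IGet ''hash'' (IGet ''rowA'' (ivar ''k''))" and ?b = "IGet ''colA'' (ivar ''k'')"
    have e: "rval s' ?t = rmem s ''Y'' (imem s ''rowA'' k) 0 * rmem s ''valA'' k 0 / rmem s ''D'' (imem s ''rowA'' k) 0"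
      and v: "ival s' ?a = imem s ''hash'' (imem s ''rowA'' k)" "ival s' ?b = imem s ''colA'' k"
      by (simp_all add: k a r)
    have "adds {} ''P'' (increment ''P'' ?a ?b ?t) s' (3 + 2 * icost ?a + 2 * icost ?b + rcost ?t) (?D k)"
      using adds_increment[of "''P''" ?a ?b ?t s'] unfolding e v .
    then show "adds {} ''P'' (increment ''P'' ?a ?b ?t) s' 39 (?D k)"
      by (rule adds_mono) simp_all
  qed
  then show ?thesis unfolding ival_ivar by (rule adds_mono) simp_all
qed

lemma adds_hash_b:
  "adds {''k''} ''P'' hash_b s (3 + imem s ''nnzb'' 0 * 40)
    (\<lambda>p q. \<Sum>k<imem s ''nnzb'' 0. if imem s ''hash'' (imem s ''rowb'' k) = p \<and> imem s ''d'' 0 = q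
       then rmem s ''Y'' (imem s ''rowb'' k) 0 * rmem s ''valb'' k 0 / rmem s ''D'' (imem s ''rowb'' k) 0 else 0)"
proof -
  let ?D = "\<lambda>k p q. if imem s ''hash'' (imem s ''rowb'' k) = p \<and> imem s ''d'' 0 = q
       then rmem s ''Y'' (imem s ''rowb'' k) 0 * rmem s ''valb'' k 0 / rmem s ''D'' (imem s ''rowb'' k) 0 else 0"
  have "adds (insert ''k'' {}) ''P'' hash_b s (1 + icost (ivar ''nnzb'') + ival s (ivar ''nnzb'') * (1 + 39))
     (\<lambda>p q. \<Sum>k<ival s (ivar ''nnzb''). ?D k p q)"
    unfolding hash_b_def
  proof (rule adds_For)
    fix k and s' :: store
    assume k: "imem s' ''k'' 0 = k" and a: "\<And>a. a \<notin> {''k''} \<Longrightarrow> imem s' a = imem s a"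
      and r: "\<And>Y. Y \<noteq> ''P'' \<Longrightarrow> rmem s' Y = rmem s Y"
    let ?t = "RDiv (RMul (RGet ''Y'' (IGet ''rowb'' (ivar ''k'')) (Num 0)) (RGet ''valb'' (ivar ''k'') (Num 0)))
          (RGet ''D'' (IGet ''rowb'' (ivar ''k'')) (Num 0))"
    let ?a = "IGet ''hash'' (IGet ''rowb'' (ivar ''k''))" and ?b = "ivar ''d''"
    have e: "rval s' ?t = rmem s ''Y'' (imem s ''rowb'' k) 0 * rmem s ''valb'' k 0 / rmem s ''D'' (imem s ''rowb'' k) 0"
      and v: "ival s' ?a = imem s ''hash'' (imem s ''rowb'' k)" "ival s' ?b = imem s ''d'' 0"
      by (simp_all add: k a r)
    have "adds {} ''P'' (increment ''P'' ?a ?b ?t) s' (3 + 2 * icost ?a + 2 * icost ?b + rcost ?t) (?D k)"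
      using adds_increment[of "''P''" ?a ?b ?t s'] unfolding e v .
    then show "adds {} ''P'' (increment ''P'' ?a ?b ?t) s' 39 (?D k)"
      by (rule adds_mono) simp_all
  qed
  then show ?thesis unfolding ival_ivar by (rule adds_mono) simp_all
qed

lemma sum_sum_delta:
  fixes f :: "nat \<Rightarrow> nat \<Rightarrow> nat \<Rightarrow> real"
  shows "(\<Sum>i<a. \<Sum>j<b. \<Sum>k<c. if i = p \<and> j = q then f i j k else 0) =
    (if p < a \<and> q < b then \<Sum>k<c. f p q k else 0)"
proof -
  have "(\<Sum>i<a. \<Sum>j<b. \<Sum>k<c. if i = p \<and> j = q then f i j k else 0) =
     (\<Sum>i<a. if i = p then (\<Sum>j<b. if j = q then \<Sum>k<c. f p q k else 0) else 0)"
  proof (rule sum.cong[OF refl])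
    fix i
    have "(\<Sum>k<c. if i = p \<and> j = q then f i j k else 0) =
        (if i = p then if j = q then \<Sum>k<c. f p q k else 0 else 0)" for j
      by (cases "i = p"; cases "j = q") simp_all
    then show "(\<Sum>j<b. \<Sum>k<c. if i = p \<and> j = q then f i j k else 0) =
        (if i = p then (\<Sum>j<b. if j = q then \<Sum>k<c. f p q k else 0) else 0)"
      by simp
  qed
  then show ?thesis by simp
qed

text \<open>Both matrix products share this loop nest. The value of \<open>t\<close> must not depend
  on \<open>X\<close>, so that accumulating into \<open>X\<close> does not disturb later
  summands.\<close>

lemma adds_triple:
  assumes names: "a1 \<notin> {''i'', ''j'', ''k''}" "a2 \<notin> {''i'', ''j'', ''k''}"
    and t: "\<And>(s' :: store) i j k. imem s' ''i'' 0 = i \<Longrightarrow> imem s' ''j'' 0 = j \<Longrightarrow> imem s' ''k'' 0 = k \<Longrightarrow>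
      (\<And>Y. Y \<noteq> X \<Longrightarrow> rmem s' Y = rmem s Y) \<Longrightarrow> rval s' t = f i j k"
  shows "adds {''i'', ''j'', ''k''} X
    (For ''i'' (ivar a1) (For ''j'' width (For ''k'' (ivar a2) (increment X (ivar ''i'') (ivar ''j'') t)))) s
    (3 + imem s a1 0 * (6 + Suc (imem s ''d'' 0) * (4 + imem s a2 0 * (12 + rcost t))))
    (\<lambda>p q. if p < imem s a1 0 \<and> q < Suc (imem s ''d'' 0) then \<Sum>k<imem s a2 0. f p q k else 0)"
proof -
  let ?c = "increment X (ivar ''i'') (ivar ''j'') t"
  let ?d = "imem s ''d'' 0"
  let ?C = "11 + rcost t"
  let ?D = "\<lambda>i j k p q. if i = p \<and> j = q then f i j k else 0"
  have 1: "adds {''k''} X (For ''k'' (ivar a2) ?c) s' (3 + imem s a2 0 * (1 + ?C)) (\<lambda>p q. \<Sum>k<imem s a2 0. ?D i j k p q)"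
    if i: "imem s' ''i'' 0 = i" and j: "imem s' ''j'' 0 = j"
      and a: "\<And>a. a \<notin> {''i'', ''j'', ''k''} \<Longrightarrow> imem s' a = imem s a"
      and r: "\<And>Y. Y \<noteq> X \<Longrightarrow> rmem s' Y = rmem s Y" for i j and s' :: store
  proof -
    have v: "ival s' (ivar a2) = imem s a2 0" using a names by simp
    have "adds (insert ''k'' {}) X (For ''k'' (ivar a2) ?c) s'
      (1 + icost (ivar a2) + ival s' (ivar a2) * (1 + ?C)) (\<lambda>p q. \<Sum>k<ival s' (ivar a2). ?D i j k p q)"
    proof (rule adds_For)
      fix k and s'' :: store
      assume k: "imem s'' ''k'' 0 = k" and a': "\<And>a. a \<notin> {''k''} \<Longrightarrow> imem s'' a = imem s' a"
        and r': "\<And>Y. Y \<noteq> X \<Longrightarrow> rmem s'' Y = rmem s' Y"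
      have e: "rval s'' t = f i j k" by (rule t) (use i j k a' r r' in auto)
      have "adds {} X ?c s'' (3 + 2 * icost (ivar ''i'') + 2 * icost (ivar ''j'') + rcost t) (?D i j k)"
        using adds_increment[of X "ivar ''i''" "ivar ''j''" t s''] a' i j unfolding e by simp
      then show "adds {} X ?c s'' ?C (?D i j k)" by (rule adds_mono) simp_all
    qed
    then show ?thesis unfolding v by (rule adds_mono) simp_all
  qed
  let ?B = "3 + imem s a2 0 * (1 + ?C)"
  have 2: "adds {''j'', ''k''} X (For ''j'' width (For ''k'' (ivar a2) ?c)) s' (5 + Suc ?d * (1 + ?B))
      (\<lambda>p q. \<Sum>j<Suc ?d. \<Sum>k<imem s a2 0. ?D i j k p q)"
    if i: "imem s' ''i'' 0 = i"
      and a: "\<And>a. a \<notin> {''i'', ''j'', ''k''} \<Longrightarrow> imem s' a = imem s a"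
      and r: "\<And>Y. Y \<noteq> X \<Longrightarrow> rmem s' Y = rmem s Y" for i and s' :: store
  proof -
    have v: "ival s' width = Suc ?d" using a by simp
    have "adds (insert ''j'' {''k''}) X (For ''j'' width (For ''k'' (ivar a2) ?c)) s'
      (1 + icost width + ival s' width * (1 + ?B)) (\<lambda>p q. \<Sum>j<ival s' width. \<Sum>k<imem s a2 0. ?D i j k p q)"
    proof (rule adds_For)
      fix j and s'' :: store
      assume "imem s'' ''j'' 0 = j" "\<And>a. a \<notin> {''j'', ''k''} \<Longrightarrow> imem s'' a = imem s' a"
        "\<And>Y. Y \<noteq> X \<Longrightarrow> rmem s'' Y = rmem s' Y"
      then show "adds {''k''} X (For ''k'' (ivar a2) ?c) s'' ?B (\<lambda>p q. \<Sum>k<imem s a2 0. ?D i j k p q)"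
        by (intro 1) (auto simp: i a r)
    qed
    then show ?thesis unfolding v by (rule adds_mono) simp_all
  qed
  have "adds (insert ''i'' {''j'', ''k''}) X (For ''i'' (ivar a1) (For ''j'' width (For ''k'' (ivar a2) ?c))) s
      (1 + icost (ivar a1) + ival s (ivar a1) * (1 + (5 + Suc ?d * (1 + ?B))))
      (\<lambda>p q. \<Sum>i<ival s (ivar a1). \<Sum>j<Suc ?d. \<Sum>k<imem s a2 0. ?D i j k p q)"
  proof (rule adds_For)
    fix i and s'' :: store
    assume "imem s'' ''i'' 0 = i" "\<And>a. a \<notin> {''i'', ''j'', ''k''} \<Longrightarrow> imem s'' a = imem s a"
      "\<And>Y. Y \<noteq> X \<Longrightarrow> rmem s'' Y = rmem s Y"
    then show "adds {''j'', ''k''} X (For ''j'' width (For ''k'' (ivar a2) ?c)) s''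
         (5 + Suc ?d * (1 + ?B)) (\<lambda>p q. \<Sum>j<Suc ?d. \<Sum>k<imem s a2 0. ?D i j k p q)"
      by (intro 2) auto
  qed
  then show ?thesis unfolding ival_ivar sum_sum_delta by (rule adds_mono) simp_all
qed

lemma adds_mult_gauss:
  "adds {''i'', ''j'', ''k''} ''Q'' mult_gauss s
    (3 + imem s ''t2'' 0 * (6 + Suc (imem s ''d'' 0) * (4 + imem s ''t1'' 0 * 23)))
    (\<lambda>p q. if p < imem s ''t2'' 0 \<and> q < Suc (imem s ''d'' 0)
       then \<Sum>k<imem s ''t1'' 0. rmem s ''Gauss'' p k * rmem s ''P'' k q else 0)"
proof -
  let ?t = "RMul (RGet ''Gauss'' (ivar ''i'') (ivar ''k'')) (RGet ''P'' (ivar ''k'') (ivar ''j''))"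
  show ?thesis
    unfolding mult_gauss_def
    by (rule adds_mono[OF adds_triple[of "''t2''" "''t1''" "''Q''" s ?t
      "\<lambda>p q k. rmem s ''Gauss'' p k * rmem s ''P'' k q"]]) auto
qed

lemma adds_form_gram:
  "adds {''i'', ''j'', ''k''} ''N'' form_gram s
    (3 + imem s ''d'' 0 * (6 + Suc (imem s ''d'' 0) * (4 + imem s ''t2'' 0 * 23)))
    (\<lambda>p q. if p < imem s ''d'' 0 \<and> q < Suc (imem s ''d'' 0)
       then \<Sum>k<imem s ''t2'' 0. rmem s ''Q'' k p * rmem s ''Q'' k q else 0)"
proof -
  let ?t = "RMul (RGet ''Q'' (ivar ''k'') (ivar ''i'')) (RGet ''Q'' (ivar ''k'') (ivar ''j''))"
  show ?thesis
    unfolding form_gram_def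
    by (rule adds_mono[OF adds_triple[of "''d''" "''t2''" "''N''" s ?t
      "\<lambda>p q k. rmem s ''Q'' k p * rmem s ''Q'' k q"]]) auto
qed

lemma adds_inner_product:
  assumes "X \<noteq> ''N''" "a \<noteq> ''j''" "b \<noteq> ''j''"
  shows "adds {''j''} X (inner_product X a b) s (5 + Suc (imem s ''d'' 0) * 19)
    (\<lambda>p q. if p = 0 \<and> q = 0 then dotp (Suc (imem s ''d'' 0)) (rmem s ''N'' (imem s a 0)) (rmem s ''N'' (imem s b 0)) else 0)"
proof -
  let ?t = "RMul (RGet ''N'' (ivar a) (ivar ''j'')) (RGet ''N'' (ivar b) (ivar ''j''))"
  let ?f = "\<lambda>j. rmem s ''N'' (imem s a 0) j * rmem s ''N'' (imem s b 0) j"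
  have "adds (insert ''j'' {}) X (inner_product X a b) s (1 + icost width + ival s width * (1 + 18))
      (\<lambda>p q. \<Sum>j<ival s width. if 0 = p \<and> 0 = q then ?f j else 0)"
    unfolding inner_product_def
  proof (rule adds_For)
    fix j and s' :: store
    assume j: "imem s' ''j'' 0 = j" and a': "\<And>a. a \<notin> {''j''} \<Longrightarrow> imem s' a = imem s a"
      and r: "\<And>Y. Y \<noteq> X \<Longrightarrow> rmem s' Y = rmem s Y"
    have e: "rval s' ?t = ?f j" using assms by (simp add: j a' r)
    have "adds {} X (increment X (Num 0) (Num 0) ?t) s' (3 + 2 * icost (Num 0) + 2 * icost (Num 0) + rcost ?t)
        (\<lambda>p q. if 0 = p \<and> 0 = q then ?f j else 0)"
      using adds_increment[of X "Num 0" "Num 0" ?t s'] unfolding e ival.simps .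
    then show "adds {} X (increment X (Num 0) (Num 0) ?t) s' 18 (\<lambda>p q. if 0 = p \<and> 0 = q then ?f j else 0)"
      by (rule adds_mono) simp_all
  qed
  note main = this
  have eq: "(\<lambda>p q. \<Sum>j<ival s width. if 0 = p \<and> 0 = q then ?f j else 0) =
     (\<lambda>p q. if p = 0 \<and> q = 0 then dotp (Suc (imem s ''d'' 0)) (rmem s ''N'' (imem s a 0)) (rmem s ''N'' (imem s b 0)) else 0)"
    by (auto simp: fun_eq_iff dotp_def)
  show ?thesis using main unfolding eq by (rule adds_mono) simp_all
qed

definition row_update :: com where
  "row_update = For ''j'' width (increment ''N'' (ivar ''i'') (ivar ''j'')
        (RSub RZero (RMul (RDiv (RGet ''c'' (Num 0) (Num 0)) (RGet ''q'' (Num 0) (Num 0)))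
           (RGet ''N'' (ivar ''l'') (ivar ''j'')))))"

lemma adds_row_update:
  assumes "imem s ''l'' 0 \<noteq> imem s ''i'' 0"
  shows "adds {''j''} ''N'' row_update s (5 + Suc (imem s ''d'' 0) * 27)
    (\<lambda>p q. if p = imem s ''i'' 0 \<and> q < Suc (imem s ''d'' 0)
       then - (rmem s ''c'' 0 0 / rmem s ''q'' 0 0 * rmem s ''N'' (imem s ''l'' 0) q) else 0)"
proof -
  let ?t = "RSub RZero (RMul (RDiv (RGet ''c'' (Num 0) (Num 0)) (RGet ''q'' (Num 0) (Num 0)))
           (RGet ''N'' (ivar ''l'') (ivar ''j'')))"
  let ?f = "\<lambda>j. - (rmem s ''c'' 0 0 / rmem s ''q'' 0 0 * rmem s ''N'' (imem s ''l'' 0) j)"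
  have "adds (insert ''j'' {}) ''N'' row_update s (1 + icost width + ival s width * (1 + 26))
      (\<lambda>p q. \<Sum>j<ival s width. if imem s ''i'' 0 = p \<and> j = q then ?f j else 0)"
    unfolding row_update_def
  proof (rule adds_For)
    fix j and s' :: store
    assume j: "imem s' ''j'' 0 = j" and a': "\<And>a. a \<notin> {''j''} \<Longrightarrow> imem s' a = imem s a"
      and r: "\<And>Y. Y \<noteq> ''N'' \<Longrightarrow> rmem s' Y = rmem s Y"
      and N: "\<And>p q. rmem s' ''N'' p q = rmem s ''N'' p q + (\<Sum>k'<j. if imem s ''i'' 0 = p \<and> k' = q then ?f k' else 0)"
    \<comment> \<open>Row \<open>l\<close> differs from row \<open>i\<close>, so the entries added
      so far leave it intact.\<close>
    have "rmem s' ''N'' (imem s ''l'' 0) j = rmem s ''N'' (imem s ''l'' 0) j"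
      using assms unfolding N by simp
    then have e: "rval s' ?t = ?f j" by (simp add: j a' r)
    have "adds {} ''N'' (increment ''N'' (ivar ''i'') (ivar ''j'') ?t) s' (3 + 2 * icost (ivar ''i'') + 2 * icost (ivar ''j'') + rcost ?t)
        (\<lambda>p q. if imem s ''i'' 0 = p \<and> j = q then ?f j else 0)"
      using adds_increment[of "''N''" "ivar ''i''" "ivar ''j''" ?t s'] unfolding e by (simp add: j a')
    then show "adds {} ''N'' (increment ''N'' (ivar ''i'') (ivar ''j'') ?t) s' 26 (\<lambda>p q. if imem s ''i'' 0 = p \<and> j = q then ?f j else 0)"
      by (rule adds_mono) simp_all
  qed
  note main = this
  have eq: "(\<Sum>j<ival s width. if imem s ''i'' 0 = p \<and> j = q then ?f j else 0) =
     (if p = imem s ''i'' 0 \<and> q < Suc (imem s ''d'' 0) then ?f q else 0)" for p q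
    by (cases "imem s ''i'' 0 = p") auto
  show ?thesis using main unfolding eq by (rule adds_mono) simp_all
qed

text \<open>Both inner products are stored before row \<open>i\<close> is touched, so the
  coefficient remains that of the old row, as \<open>reduce\<close> demands. Their cells are cleared
  beforehand because \<open>inner_product\<close> accumulates.\<close>

lemma run_reduce_row:
  assumes li: "imem s ''l'' 0 \<noteq> imem s ''i'' 0" and d: "imem s ''d'' 0 = d"
  shows "run reduce_row s (100 + Suc d * 100) (\<lambda>s'. (\<forall>a. a \<noteq> ''j'' \<longrightarrow> imem s' a = imem s a) \<and>
    (\<forall>p q. rmem s' ''N'' p q = (if p = imem s ''i'' 0 \<and> q < Suc d
       then reduce (Suc d) (rmem s ''N'' (imem s ''l'' 0)) (rmem s ''N'' p) q else rmem s ''N'' p q)))"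
proof -
  let ?i = "imem s ''i'' 0" and ?l = "imem s ''l'' 0" and ?N = "rmem s ''N''"
  let ?I = "\<lambda>s' :: store. (\<forall>a. a \<noteq> ''j'' \<longrightarrow> imem s' a = imem s a) \<and> rmem s' ''N'' = ?N"
  have ne: "''c'' \<noteq> ''N''" "''q'' \<noteq> ''N''" "''i'' \<noteq> ''j''" "''l'' \<noteq> ''j''" by simp_all
  have "run reduce_row s (5 + (5 + ((5 + Suc d * 19) + ((5 + Suc d * 19) + (5 + Suc d * 27)))))
    (\<lambda>s'. (\<forall>a. a \<noteq> ''j'' \<longrightarrow> imem s' a = imem s a) \<and>
    (\<forall>p q. rmem s' ''N'' p q = (if p = imem s ''i'' 0 \<and> q < Suc d
       then reduce (Suc d) (rmem s ''N'' (imem s ''l'' 0)) (rmem s ''N'' p) q else rmem s ''N'' p q)))"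
    unfolding reduce_row_def row_update_def[symmetric]
  proof (intro run_Seq)
    show "run (RSet ''c'' (Num 0) (Num 0) RZero) s 5 (\<lambda>s'. ?I s' \<and> rmem s' ''c'' 0 0 = 0)"
      by (simp add: run_def imem_rupd rmem_rupd)
    show "run (RSet ''q'' (Num 0) (Num 0) RZero) s' 5 (\<lambda>s'. ?I s' \<and> rmem s' ''c'' 0 0 = 0 \<and> rmem s' ''q'' 0 0 = 0)"
      if "?I s' \<and> rmem s' ''c'' 0 0 = 0" for s'
      using that by (simp add: run_def imem_rupd rmem_rupd)
    show "run (inner_product ''c'' ''i'' ''l'') s' (5 + Suc d * 19)
       (\<lambda>s'. ?I s' \<and> rmem s' ''c'' 0 0 = dotp (Suc d) (?N ?i) (?N ?l) \<and> rmem s' ''q'' 0 0 = 0)"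
      if I: "?I s' \<and> rmem s' ''c'' 0 0 = 0 \<and> rmem s' ''q'' 0 0 = 0" for s'
    proof -
      have "imem s' ''d'' 0 = d" using I d by simp
      then show ?thesis
        by (intro run_mono[OF adds_inner_product[OF ne(1,3,4), of s', unfolded adds_def]]) (use I d in auto)
    qed
    show "run (inner_product ''q'' ''l'' ''l'') s' (5 + Suc d * 19)
       (\<lambda>s'. ?I s' \<and> rmem s' ''c'' 0 0 = dotp (Suc d) (?N ?i) (?N ?l) \<and> rmem s' ''q'' 0 0 = dotp (Suc d) (?N ?l) (?N ?l))"
      if I: "?I s' \<and> rmem s' ''c'' 0 0 = dotp (Suc d) (?N ?i) (?N ?l) \<and> rmem s' ''q'' 0 0 = 0" for s'
    proof -
      have "imem s' ''d'' 0 = d" using I d by simp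
      then show ?thesis
        by (intro run_mono[OF adds_inner_product[OF ne(2,4,4), of s', unfolded adds_def]]) (use I d in auto)
    qed
    show "run row_update s' (5 + Suc d * 27) (\<lambda>s'. (\<forall>a. a \<noteq> ''j'' \<longrightarrow> imem s' a = imem s a) \<and>
      (\<forall>p q. rmem s' ''N'' p q = (if p = ?i \<and> q < Suc d then reduce (Suc d) (?N ?l) (?N p) q else ?N p q)))"
      if I: "?I s' \<and> rmem s' ''c'' 0 0 = dotp (Suc d) (?N ?i) (?N ?l) \<and> rmem s' ''q'' 0 0 = dotp (Suc d) (?N ?l) (?N ?l)" for s'
    proof -
      have "imem s' ''d'' 0 = d" "imem s' ''l'' 0 \<noteq> imem s' ''i'' 0" using I d li by simp_all
      then show ?thesis
        by (intro run_mono[OF adds_row_update[of s', unfolded adds_def]]) (use I d in \<open>auto simp: reduce_def\<close>)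
    qed
  qed
  then show ?thesis by (rule run_mono) simp_all
qed

lemma run_gram_schmidt:
  assumes d: "imem s ''d'' 0 = d" and N: "\<And>p q. q < Suc d \<Longrightarrow> rmem s ''N'' p q = R p q"
  shows "run gram_schmidt s (5 + Suc d * (4 + Suc d * (101 + Suc d * 100)))
    (\<lambda>s'. imem s' ''d'' 0 = d \<and> (\<forall>q<Suc d. rmem s' ''N'' d q = gs (Suc d) R d q))"
proof -
  let ?agree = "\<lambda>s' :: store. (\<forall>a. a \<notin> {''i'', ''l'', ''j''} \<longrightarrow> imem s' a = imem s a)"
  \<comment> \<open>Rows before \<open>i\<close> are final, row \<open>i\<close> has been reduced by
    \<open>l\<close> rows, and later rows are untouched. The state with \<open>l = i\<close>
    coincides with the start of row \<open>Suc i\<close>; this is \<open>next_row\<close>.\<close>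
  let ?val = "\<lambda>i l p q. if p < i then gs (Suc d) R p q else if p = i then gs_part (Suc d) R i l q else R p q"
  let ?mem = "\<lambda>i l (s' :: store). \<forall>p q. q < Suc d \<longrightarrow> rmem s' ''N'' p q = ?val i l p q"
  have next_row: "?val i i p q = ?val (Suc i) 0 p q" for i p q
    by (auto simp: gs_part_self gs_part_0 less_Suc_eq)
  have inner: "run (For ''l'' (ivar ''i'') reduce_row) s' (3 + Suc d * (101 + Suc d * 100)) (\<lambda>s'. ?agree s' \<and> ?mem (Suc i) 0 s')"
    if i: "i < Suc d" "imem s' ''i'' 0 = i" and a: "?agree s'" and m: "?mem i 0 s'" for i and s' :: store
  proof -
    let ?J = "\<lambda>l (s' :: store). ?agree s' \<and> imem s' ''i'' 0 = i \<and> ?mem i l s'"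
    have "run (For ''l'' (ivar ''i'') reduce_row) s' (1 + icost (ivar ''i'') + ival s' (ivar ''i'') * (1 + (100 + Suc d * 100)))
        (?J (ival s' (ivar ''i'')))"
    proof (rule run_For)
      fix l and s2 :: store
      assume l: "l < ival s' (ivar ''i'')" and J: "?J l s2"
      have l': "l < i" using l i by simp
      have s2d: "imem (iupd ''l'' 0 l s2) ''d'' 0 = d" using J d by (simp add: imem_iupd)
      have red: "reduce (Suc d) (rmem s2 ''N'' l) (rmem s2 ''N'' i) q = gs_part (Suc d) R i (Suc l) q" if "q < Suc d" for q
      proof -
        have Jm: "rmem s2 ''N'' p q = ?val i l p q" if "q < Suc d" for p q
          using J that by blast
        have Ni: "rmem s2 ''N'' i q = gs_part (Suc d) R i l q" and Nl: "rmem s2 ''N'' l q = gs (Suc d) R l q"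
          if "q < Suc d" for q
          using Jm[OF that, of i] Jm[OF that, of l] l' by simp_all
        have "dotp (Suc d) (rmem s2 ''N'' i) (rmem s2 ''N'' l) = dotp (Suc d) (gs_part (Suc d) R i l) (gs (Suc d) R l)"
          "dotp (Suc d) (rmem s2 ''N'' l) (rmem s2 ''N'' l) = dotp (Suc d) (gs (Suc d) R l) (gs (Suc d) R l)"
          by (intro dotp_cong; simp add: Ni Nl)+
        then show ?thesis using Ni[OF that] Nl[OF that] by (simp add: gs_part_Suc reduce_def)
      qed
      show "run reduce_row (iupd ''l'' 0 l s2) (100 + Suc d * 100) (?J (Suc l))"
      proof (rule run_mono[OF run_reduce_row[OF _ s2d]])
        fix s3 :: store
        assume "(\<forall>a. a \<noteq> ''j'' \<longrightarrow> imem s3 a = imem (iupd ''l'' 0 l s2) a) \<and>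
          (\<forall>p q. rmem s3 ''N'' p q = (if p = imem (iupd ''l'' 0 l s2) ''i'' 0 \<and> q < Suc d
            then reduce (Suc d) (rmem (iupd ''l'' 0 l s2) ''N'' (imem (iupd ''l'' 0 l s2) ''l'' 0)) (rmem (iupd ''l'' 0 l s2) ''N'' p) q
            else rmem (iupd ''l'' 0 l s2) ''N'' p q))"
        then have M1: "\<And>a. a \<noteq> ''j'' \<Longrightarrow> imem s3 a = imem (iupd ''l'' 0 l s2) a"
          and M2: "\<And>p q. rmem s3 ''N'' p q = (if p = imem (iupd ''l'' 0 l s2) ''i'' 0 \<and> q < Suc d
            then reduce (Suc d) (rmem (iupd ''l'' 0 l s2) ''N'' (imem (iupd ''l'' 0 l s2) ''l'' 0)) (rmem (iupd ''l'' 0 l s2) ''N'' p) q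
            else rmem (iupd ''l'' 0 l s2) ''N'' p q)"
          by blast+
        have N2: "rmem s3 ''N'' p q = (if p = i then gs_part (Suc d) R i (Suc l) q else rmem s2 ''N'' p q)" if "q < Suc d" for p q
          using M2[of p q] that J red[OF that] by (simp add: imem_iupd rmem_iupd)
        have "?agree s3" "imem s3 ''i'' 0 = i" using M1 J by (simp_all add: imem_iupd)
        moreover have "?mem i (Suc l) s3"
        proof (intro allI impI)
          fix p q assume q: "q < Suc d"
          then have "rmem s2 ''N'' p q = ?val i l p q" using J by blast
          then show "rmem s3 ''N'' p q = ?val i (Suc l) p q" using N2[OF q, of p] by simp
        qed
        ultimately show "?J (Suc l) s3" by blast
      qed (use J l' in \<open>simp_all add: imem_iupd\<close>)
    qed (use a i m in auto)
    then show ?thesis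
    proof (rule run_mono)
      fix s3 :: store
      assume J: "?J (ival s' (ivar ''i'')) s3"
      have "rmem s3 ''N'' p q = ?val (Suc i) 0 p q" if "q < Suc d" for p q
      proof -
        have "ival s' (ivar ''i'') = i" using i by simp
        then have "rmem s3 ''N'' p q = ?val i i p q" using J that by blast
        then show ?thesis by (rule trans[OF _ next_row])
      qed
      then show "?agree s3 \<and> ?mem (Suc i) 0 s3" using J by blast
    next
      have "ival s' (ivar ''i'') * (1 + (100 + Suc d * 100)) \<le> Suc d * (1 + (100 + Suc d * 100))"
        using i by (intro mult_le_mono1) simp
      then show "1 + icost (ivar ''i'') + ival s' (ivar ''i'') * (1 + (100 + Suc d * 100)) \<le> 3 + Suc d * (101 + Suc d * 100)"
        by simp
    qed
  qed
  have "run gram_schmidt s (1 + icost width + ival s width * (1 + (3 + Suc d * (101 + Suc d * 100))))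
     ((\<lambda>i s'. ?agree s' \<and> ?mem i 0 s') (ival s width))"
    unfolding gram_schmidt_def
  proof (rule run_For)
    fix i and s' :: store
    assume i: "i < ival s width" and I: "?agree s' \<and> ?mem i 0 s'"
    show "run (For ''l'' (ivar ''i'') reduce_row) (iupd ''i'' 0 i s') (3 + Suc d * (101 + Suc d * 100))
       (\<lambda>s'. ?agree s' \<and> ?mem (Suc i) 0 s')"
      by (rule inner) (use i I d in \<open>auto simp: imem_iupd rmem_iupd\<close>)
  qed (use N in \<open>auto simp: gs_part_0\<close>)
  then show ?thesis
    by (rule run_mono) (use d in auto)
qed

lemma run_read_off:
  assumes d: "imem s ''d'' 0 = d"
  shows "run read_off s (3 + d * 25) (\<lambda>s'. \<forall>j<d. rmem s' ''x'' j 0 = - rmem s ''N'' d j / rmem s ''N'' d d)"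
proof -
  let ?J = "\<lambda>j (s' :: store). imem s' ''d'' 0 = d \<and> rmem s' ''N'' = rmem s ''N'' \<and>
     (\<forall>j'<j. rmem s' ''x'' j' 0 = - rmem s ''N'' d j' / rmem s ''N'' d d)"
  have "run read_off s (1 + icost (ivar ''d'') + ival s (ivar ''d'') * (1 + 24)) (?J (ival s (ivar ''d'')))"
    unfolding read_off_def
  proof (rule run_For)
    fix j and s' :: store
    assume J: "?J j s'"
    show "run (RSet ''x'' (ivar ''j'') (Num 0)
       (RDiv (RSub RZero (RGet ''N'' (ivar ''d'') (ivar ''j''))) (RGet ''N'' (ivar ''d'') (ivar ''d''))))
       (iupd ''j'' 0 j s') 24 (?J (Suc j))"
      using J by (auto simp: run_def imem_rupd rmem_rupd imem_iupd rmem_iupd less_Suc_eq)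
  qed (use d in auto)
  then show ?thesis by (rule run_mono) (use d in auto)
qed

section \<open>Sparse input lists and the total cost\<close>

lemma sum_nth_eq_sum_set: "distinct xs \<Longrightarrow> (\<Sum>k<length xs. f (xs ! k)) = (\<Sum>x\<in>set xs. f x)"
  for f :: "'a \<Rightarrow> real"
  by (simp add: sum_list_distinct_conv_sum_set[symmetric] sum_list_sum_nth lessThan_atLeast0)

text \<open>Entries missing from the list are zero, where \<open>f\<close> vanishes. The loop over
  the list therefore computes the dense double sum in time proportional to the number of nonzero
  entries.\<close>

lemma coords_mat_sum:
  fixes f :: "nat \<times> nat \<times> real \<Rightarrow> real"
  assumes "coords_mat A as" "A \<in> carrier_mat n d" "\<And>i j. f (i, j, 0) = 0"
  shows "(\<Sum>k<length as. f (as ! k)) = (\<Sum>i<n. \<Sum>j<d. f (i, j, A $$ (i, j)))"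
proof -
  define S where "S = {(i, j). i < n \<and> j < d \<and> A $$ (i, j) \<noteq> 0}"
  have set: "set as = (\<lambda>(i, j). (i, j, A $$ (i, j))) ` S"
    using assms(1,2) by (auto simp: coords_mat_def S_def)
  have "(\<Sum>k<length as. f (as ! k)) = (\<Sum>x\<in>set as. f x)"
    using assms(1) by (intro sum_nth_eq_sum_set) (simp add: coords_mat_def)
  also have "\<dots> = (\<Sum>(i, j)\<in>S. f (i, j, A $$ (i, j)))"
    unfolding set by (subst sum.reindex) (auto simp: inj_on_def case_prod_beta)
  also have "\<dots> = (\<Sum>(i, j)\<in>{..<n} \<times> {..<d}. f (i, j, A $$ (i, j)))"
    by (rule sum.mono_neutral_left) (auto simp: S_def assms(3))
  finally show ?thesis by (simp add: sum.cartesian_product)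
qed

lemma coords_vec_sum:
  fixes f :: "nat \<times> real \<Rightarrow> real"
  assumes "coords_vec b bs" "b \<in> carrier_vec n" "\<And>i. f (i, 0) = 0"
  shows "(\<Sum>k<length bs. f (bs ! k)) = (\<Sum>i<n. f (i, b $ i))"
proof -
  define S where "S = {i. i < n \<and> b $ i \<noteq> 0}"
  have set: "set bs = (\<lambda>i. (i, b $ i)) ` S"
    using assms(1,2) by (auto simp: coords_vec_def S_def)
  have "(\<Sum>k<length bs. f (bs ! k)) = (\<Sum>x\<in>set bs. f x)"
    using assms(1) by (intro sum_nth_eq_sum_set) (simp add: coords_vec_def)
  also have "\<dots> = (\<Sum>i\<in>S. f (i, b $ i))"
    unfolding set by (subst sum.reindex) (auto simp: inj_on_def)
  also have "\<dots> = (\<Sum>i<n. f (i, b $ i))"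
    by (rule sum.mono_neutral_left) (auto simp: S_def assms(3))
  finally show ?thesis .
qed

lemma length_coords_mat: "coords_mat A as \<Longrightarrow> length as = nnz_mat A"
proof -
  assume a: "coords_mat A as"
  have "set as = (\<lambda>(i, j). (i, j, A $$ (i, j))) ` {(i, j). i < dim_row A \<and> j < dim_col A \<and> A $$ (i, j) \<noteq> 0}"
    using a by (auto simp: coords_mat_def)
  then have "card (set as) = nnz_mat A"
    unfolding nnz_mat_def by (simp add: card_image inj_on_def)
  then show ?thesis using a distinct_card[of as] by (simp add: coords_mat_def)
qed

lemma length_coords_vec: "coords_vec b bs \<Longrightarrow> length bs = nnz_vec b"
proof -
  assume a: "coords_vec b bs"
  have "set bs = (\<lambda>i. (i, b $ i)) ` {i. i < dim_vec b \<and> b $ i \<noteq> 0}"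
    using a by (auto simp: coords_vec_def)
  then have "card (set bs) = nnz_vec b"
    unfolding nnz_vec_def by (simp add: card_image inj_on_def)
  then show ?thesis using a distinct_card[of bs] by (simp add: coords_vec_def)
qed

text \<open>The part of the budget that depends on the sizes alone; 26 collects the overheads
  \<open>3 + 3 + 3 + 3 + 6 + 5 + 3\<close> of the seven stages.\<close>

definition regression_cost :: "nat \<Rightarrow> nat \<Rightarrow> nat \<Rightarrow> nat" where
  "regression_cost d t1 t2 = 26 + t2 * (6 + Suc d * (4 + t1 * 23)) + d * (6 + Suc d * (4 + t2 * 23)) +
     Suc d * (4 + Suc d * (101 + Suc d * 100)) + d * 25"

lemma run_regression:
  assumes A: "A \<in> carrier_mat n d" and b: "b \<in> carrier_vec n"
    and as: "coords_mat A as" and bs: "coords_vec b bs"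
    and M_def: "M = gaussed t1 t2 g (hashed n w \<sigma> h (augmented d A b))"
  shows "run regression (init_store n d t1 t2 as bs (w, \<sigma>, h, g))
    (40 * length as + 40 * length bs + regression_cost d t1 t2)
    (\<lambda>s'. \<forall>j<d. rmem s' ''x'' j 0 = lsq_solution t2 d M j)"
proof -
  define s0 where "s0 = init_store n d t1 t2 as bs (w, \<sigma>, h, g)"
  have im: "imem s0 ''d'' 0 = d" "imem s0 ''t1'' 0 = t1" "imem s0 ''t2'' 0 = t2"
    "imem s0 ''nnzA'' 0 = length as" "imem s0 ''nnzb'' 0 = length bs"
    "imem s0 ''rowA'' = nth0 (map (\<lambda>(i, j, a). i) as)" "imem s0 ''colA'' = nth0 (map (\<lambda>(i, j, a). j) as)"
    "imem s0 ''rowb'' = nth0 (map fst bs)" "imem s0 ''hash'' = (\<lambda>i. if i < n then h i else 0)"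
    by (simp_all add: s0_def)
  have rm: "rmem s0 ''P'' = (\<lambda>_ _. 0)" "rmem s0 ''Q'' = (\<lambda>_ _. 0)" "rmem s0 ''N'' = (\<lambda>_ _. 0)"
    "rmem s0 ''valA'' = (\<lambda>k j. if j = 0 then nth0 (map (\<lambda>(i, j, a). a) as) k else 0)"
    "rmem s0 ''valb'' = (\<lambda>k j. if j = 0 then nth0 (map snd bs) k else 0)"
    "rmem s0 ''D'' = (\<lambda>i j. if i < n \<and> j = 0 then w i else 0)"
    "rmem s0 ''Y'' = (\<lambda>i j. if i < n \<and> j = 0 then \<sigma> i else 0)"
    "rmem s0 ''Gauss'' = (\<lambda>k r. if k < t2 \<and> r < t1 then gaussian_matrix t2 t1 g $$ (k, r) else 0)"
    by (simp_all add: s0_def)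
  let ?fr = "\<lambda>s :: store. (\<forall>a. a \<notin> {''i'', ''j'', ''k''} \<longrightarrow> imem s a = imem s0 a)"
  let ?PA = "\<lambda>p q. if q < d then hashed n w \<sigma> h (augmented d A b) p q else 0"
  let ?H = "hashed n w \<sigma> h (augmented d A b)"
  have sumA: "(\<Sum>k<length as. if imem s0 ''hash'' (imem s0 ''rowA'' k) = p \<and> imem s0 ''colA'' k = q
       then rmem s0 ''Y'' (imem s0 ''rowA'' k) 0 * rmem s0 ''valA'' k 0 / rmem s0 ''D'' (imem s0 ''rowA'' k) 0 else 0) = ?PA p q" for p q
  proof -
    define f where "f = (\<lambda>(i, j, a). if (if i < n then h i else 0) = p \<and> j = q
       then (if i < n then \<sigma> i else 0) * a / (if i < n then w i else 0) else 0)"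
    have "(\<Sum>k<length as. if imem s0 ''hash'' (imem s0 ''rowA'' k) = p \<and> imem s0 ''colA'' k = q
       then rmem s0 ''Y'' (imem s0 ''rowA'' k) 0 * rmem s0 ''valA'' k 0 / rmem s0 ''D'' (imem s0 ''rowA'' k) 0 else 0) =
       (\<Sum>k<length as. f (as ! k))"
      by (intro sum.cong refl) (simp add: im rm f_def nth0_def case_prod_beta)
    also have "\<dots> = (\<Sum>i<n. \<Sum>j<d. f (i, j, A $$ (i, j)))"
      by (rule coords_mat_sum[OF as A]) (simp add: f_def)
    also have "\<dots> = (\<Sum>i<n. \<Sum>j<d. if j = q then (if h i = p then \<sigma> i * A $$ (i, q) / w i else 0) else 0)"
      by (intro sum.cong refl) (auto simp: f_def)
    also have "\<dots> = ?PA p q"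
      by (auto simp: hashed_def augmented_def intro!: sum.cong)
    finally show ?thesis .
  qed
  have sumb: "(\<Sum>k<length bs. if imem s0 ''hash'' (imem s0 ''rowb'' k) = p \<and> d = q
       then rmem s0 ''Y'' (imem s0 ''rowb'' k) 0 * rmem s0 ''valb'' k 0 / rmem s0 ''D'' (imem s0 ''rowb'' k) 0 else 0) =
       (if q = d then ?H p d else 0)" for p q
  proof -
    define f where "f = (\<lambda>(i, a). if (if i < n then h i else 0) = p \<and> d = q
       then (if i < n then \<sigma> i else 0) * a / (if i < n then w i else 0) else 0)"
    have "(\<Sum>k<length bs. if imem s0 ''hash'' (imem s0 ''rowb'' k) = p \<and> d = q
       then rmem s0 ''Y'' (imem s0 ''rowb'' k) 0 * rmem s0 ''valb'' k 0 / rmem s0 ''D'' (imem s0 ''rowb'' k) 0 else 0) =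
       (\<Sum>k<length bs. f (bs ! k))"
      by (intro sum.cong refl) (simp add: im rm f_def nth0_def case_prod_beta)
    also have "\<dots> = (\<Sum>i<n. f (i, b $ i))"
      by (rule coords_vec_sum[OF bs b]) (simp add: f_def)
    also have "\<dots> = (if q = d then ?H p d else 0)"
      by (auto simp: f_def hashed_def augmented_def intro!: sum.cong)
    finally show ?thesis .
  qed
  have G: "gaussian_matrix t2 t1 g $$ (k, r) = g (k, r) / sqrt (real t2)" if "k < t2" "r < t1" for k r
    using that by (simp add: gaussian_matrix_def)
  \<comment> \<open>After hashing \<open>A\<close>, column \<open>d\<close> of \<open>P\<close> is
    still zero, so that hashing \<open>b\<close> can accumulate there. In the same way row
    \<open>d\<close> of \<open>N\<close> stays zero until the single entry 1 completes the bordered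
    Gram matrix.\<close>
  let ?S1 = "\<lambda>s. ?fr s \<and> rmem s = (rmem s0)(''P'' := ?PA)"
  let ?S2 = "\<lambda>s. ?fr s \<and> (\<forall>Y. Y \<noteq> ''P'' \<longrightarrow> rmem s Y = rmem s0 Y) \<and> (\<forall>p. \<forall>q<Suc d. rmem s ''P'' p q = ?H p q)"
  let ?S3 = "\<lambda>s. ?fr s \<and> rmem s ''N'' = (\<lambda>_ _. 0) \<and> (\<forall>p<t2. \<forall>q<Suc d. rmem s ''Q'' p q = M p q)"
  let ?S4 = "\<lambda>s. ?fr s \<and> rmem s ''N'' = (\<lambda>p q. if p < d \<and> q < Suc d then gram t2 M p q else 0)"
  let ?S5 = "\<lambda>s. imem s ''d'' 0 = d \<and> (\<forall>p. \<forall>q<Suc d. rmem s ''N'' p q = bordered_gram t2 d M p q)"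
  let ?S6 = "\<lambda>s. imem s ''d'' 0 = d \<and> (\<forall>q<Suc d. rmem s ''N'' d q = gs (Suc d) (bordered_gram t2 d M) d q)"
  have "run regression s0 ((3 + length as * 40) + ((3 + length bs * 40) +
     ((3 + t2 * (6 + Suc d * (4 + t1 * 23))) + ((3 + d * (6 + Suc d * (4 + t2 * 23))) + (6 +
      ((5 + Suc d * (4 + Suc d * (101 + Suc d * 100))) + (3 + d * 25)))))))
     (\<lambda>s'. \<forall>j<d. rmem s' ''x'' j 0 = lsq_solution t2 d M j)"
    unfolding regression_def
  proof (intro run_Seq)
    show "run hash_A s0 (3 + length as * 40) ?S1"
      by (rule run_mono[OF adds_hash_A[unfolded adds_def]]) (simp_all add: im(4) sumA rm(1))
    show "run hash_b s (3 + length bs * 40) ?S2" if S: "?S1 s" for s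
    proof (rule run_mono[OF adds_hash_b[unfolded adds_def]])
      have i: "imem s ''nnzb'' 0 = length bs" "imem s ''d'' 0 = d" "imem s ''hash'' = imem s0 ''hash''" "imem s ''rowb'' = imem s0 ''rowb''"
        and r: "rmem s ''Y'' = rmem s0 ''Y''" "rmem s ''valb'' = rmem s0 ''valb''" "rmem s ''D'' = rmem s0 ''D''" "rmem s ''P'' = ?PA"
        using S im by simp_all
      show "3 + imem s ''nnzb'' 0 * 40 \<le> 3 + length bs * 40" by (simp add: i)
      fix s' :: store
      assume "rmem s' = (rmem s)(''P'' := \<lambda>p q. rmem s ''P'' p q + (\<Sum>k<imem s ''nnzb'' 0. if imem s ''hash'' (imem s ''rowb'' k) = p \<and> imem s ''d'' 0 = q
         then rmem s ''Y'' (imem s ''rowb'' k) 0 * rmem s ''valb'' k 0 / rmem s ''D'' (imem s ''rowb'' k) 0 else 0)) \<and>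
         (\<forall>a. a \<notin> {''k''} \<longrightarrow> imem s' a = imem s a)"
      then have a: "rmem s' = (rmem s)(''P'' := \<lambda>p q. ?PA p q + (if q = d then ?H p d else 0))" "\<forall>a. a \<notin> {''k''} \<longrightarrow> imem s' a = imem s a"
        unfolding i r sumb by blast+
      then show "?S2 s'" using S by (auto simp: less_Suc_eq)
    qed
    show "run mult_gauss s (3 + t2 * (6 + Suc d * (4 + t1 * 23))) ?S3" if S: "?S2 s" for s
    proof (rule run_mono[OF adds_mult_gauss[unfolded adds_def]])
      have i: "imem s ''t2'' 0 = t2" "imem s ''d'' 0 = d" "imem s ''t1'' 0 = t1"
        and r: "rmem s ''Q'' = (\<lambda>_ _. 0)" "rmem s ''N'' = (\<lambda>_ _. 0)" "rmem s ''Gauss'' = rmem s0 ''Gauss''"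
        using S im rm by simp_all
      show "3 + imem s ''t2'' 0 * (6 + Suc (imem s ''d'' 0) * (4 + imem s ''t1'' 0 * 23)) \<le> 3 + t2 * (6 + Suc d * (4 + t1 * 23))"
        by (simp add: i)
      fix s' :: store
      assume "rmem s' = (rmem s)(''Q'' := \<lambda>p q. rmem s ''Q'' p q + (if p < imem s ''t2'' 0 \<and> q < Suc (imem s ''d'' 0)
         then \<Sum>k<imem s ''t1'' 0. rmem s ''Gauss'' p k * rmem s ''P'' k q else 0)) \<and>
         (\<forall>a. a \<notin> {''i'', ''j'', ''k''} \<longrightarrow> imem s' a = imem s a)"
      then have a: "rmem s' = (rmem s)(''Q'' := \<lambda>p q. 0 + (if p < t2 \<and> q < Suc d
         then \<Sum>k<t1. rmem s0 ''Gauss'' p k * rmem s ''P'' k q else 0))" "\<forall>a. a \<notin> {''i'', ''j'', ''k''} \<longrightarrow> imem s' a = imem s a"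
        unfolding i r by blast+
      have "(\<Sum>k<t1. rmem s0 ''Gauss'' p k * rmem s ''P'' k q) = M p q" if "p < t2" "q < Suc d" for p q
        unfolding M_def gaussed_def rm using that S G by (intro sum.cong) auto
      then show "?S3 s'" using S a r by simp
    qed
    show "run form_gram s (3 + d * (6 + Suc d * (4 + t2 * 23))) ?S4" if S: "?S3 s" for s
    proof (rule run_mono[OF adds_form_gram[unfolded adds_def]])
      have i: "imem s ''t2'' 0 = t2" "imem s ''d'' 0 = d"
        and r: "rmem s ''N'' = (\<lambda>_ _. 0)"
        using S im rm by simp_all
      show "3 + imem s ''d'' 0 * (6 + Suc (imem s ''d'' 0) * (4 + imem s ''t2'' 0 * 23)) \<le> 3 + d * (6 + Suc d * (4 + t2 * 23))"
        by (simp add: i)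
      fix s' :: store
      assume "rmem s' = (rmem s)(''N'' := \<lambda>p q. rmem s ''N'' p q + (if p < imem s ''d'' 0 \<and> q < Suc (imem s ''d'' 0)
         then \<Sum>k<imem s ''t2'' 0. rmem s ''Q'' k p * rmem s ''Q'' k q else 0)) \<and>
         (\<forall>a. a \<notin> {''i'', ''j'', ''k''} \<longrightarrow> imem s' a = imem s a)"
      then have a: "rmem s' = (rmem s)(''N'' := \<lambda>p q. 0 + (if p < d \<and> q < Suc d
         then \<Sum>k<t2. rmem s ''Q'' k p * rmem s ''Q'' k q else 0))" "\<forall>a. a \<notin> {''i'', ''j'', ''k''} \<longrightarrow> imem s' a = imem s a"
        unfolding i r by blast+
      have "(\<Sum>k<t2. rmem s ''Q'' k p * rmem s ''Q'' k q) = gram t2 M p q" if "p < d" "q < Suc d" for p q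
        unfolding gram_def using that S by (intro sum.cong) auto
      then show "?S4 s'" using S a by (simp add: fun_eq_iff)
    qed
    show "run (RSet ''N'' (ivar ''d'') (ivar ''d'') ROne) s 6 ?S5" if S: "?S4 s" for s
    proof -
      have i: "imem s ''d'' 0 = d" using S im by simp
      have "rmem s ''N'' = (\<lambda>p q. if p < d \<and> q < Suc d then gram t2 M p q else 0)" using S by blast
      then show ?thesis
        by (auto simp: run_def imem_rupd rmem_rupd i bordered_gram_def)
    qed
    show "run gram_schmidt s (5 + Suc d * (4 + Suc d * (101 + Suc d * 100))) ?S6" if S: "?S5 s" for s
      by (rule run_gram_schmidt) (use S in auto)
    show "run read_off s (3 + d * 25) (\<lambda>s'. \<forall>j<d. rmem s' ''x'' j 0 = lsq_solution t2 d M j)" if S: "?S6 s" for s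
      by (rule run_mono[OF run_read_off[of s d]]) (use S in \<open>auto simp: lsq_solution_def\<close>)
  qed
  then show ?thesis
    unfolding s0_def by (rule run_mono) (simp_all add: regression_cost_def)
qed

text \<open>An eventual bound becomes a global one by adding the finitely many exceptional values to
  the constant; the summand 1 keeps the right-hand side useful where \<open>g\<close>
  vanishes.\<close>

lemma bigo_nat_bound:
  fixes f :: "nat \<Rightarrow> nat" and g :: "nat \<Rightarrow> nat"
  assumes "(\<lambda>d. real (f d)) \<in> O(\<lambda>d. real (g d))"
  shows "\<exists>K. \<forall>d. f d \<le> K * (1 + g d)"
proof -
  obtain c where c: "eventually (\<lambda>d. norm (real (f d)) \<le> c * norm (real (g d))) sequentially"
    using landau_o.bigE[OF assms] by blast
  then obtain N where N: "\<And>d. d \<ge> N \<Longrightarrow> real (f d) \<le> c * real (g d)"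
    unfolding eventually_sequentially by auto
  define K where "K = nat \<lceil>c\<rceil> + (\<Sum>d<N. f d)"
  have "f d \<le> K * (1 + g d)" for d
  proof (cases "d < N")
    case True
    then have "f d \<le> (\<Sum>d<N. f d)" by (intro member_le_sum) auto
    then have "f d \<le> K" by (simp add: K_def)
    then show ?thesis by (simp add: trans_le_add1)
  next
    case False
    then have "real (f d) \<le> c * real (g d)" using N by simp
    also have "\<dots> \<le> real (nat \<lceil>c\<rceil>) * real (g d)" by (intro mult_right_mono real_nat_ceiling_ge) simp
    finally have "f d \<le> nat \<lceil>c\<rceil> * g d" by (metis of_nat_le_iff of_nat_mult)
    also have "\<dots> \<le> K * (1 + g d)" by (intro mult_mono) (auto simp: K_def)
    finally show ?thesis .
  qed
  then show ?thesis by blast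
qed

lemma regression_cost_poly:
  assumes "sketch_sizes c1 c2 t1 t2"
  shows "\<exists>p :: nat poly. \<forall>d. regression_cost d (t1 d) (t2 d) \<le> poly p d"
proof -
  obtain K where K: "\<And>d. t1 d \<le> K * (1 + d ^ 2)"
    using bigo_nat_bound[of t1 "\<lambda>d. d ^ 2"] assms by (auto simp: sketch_sizes_def bigtheta_def)
  obtain L where L: "\<And>d. t2 d \<le> L * (1 + d)"
    using bigo_nat_bound[of t2 "\<lambda>d. d"] assms by (auto simp: sketch_sizes_def bigtheta_def)
  define T1 T2 where "T1 = [:K, 0, K:]" and "T2 = [:L, L:]"
  define D where "D = [:0, 1 :: nat:]"
  define p where "p = 26 + T2 * (6 + (1 + D) * (4 + T1 * 23)) + D * (6 + (1 + D) * (4 + T2 * 23)) +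
     (1 + D) * (4 + (1 + D) * (101 + (1 + D) * 100)) + D * 25"
  have "regression_cost d (t1 d) (t2 d) \<le> poly p d" for d
  proof -
    have "poly T1 d = K * (1 + d ^ 2)" "poly T2 d = L * (1 + d)" "poly D d = d"
      by (simp_all add: T1_def T2_def D_def power2_eq_square algebra_simps)
    then have "poly p d = regression_cost d (K * (1 + d ^ 2)) (L * (1 + d))"
      by (simp add: p_def regression_cost_def)
    moreover have "regression_cost d (t1 d) (t2 d) \<le> regression_cost d (K * (1 + d ^ 2)) (L * (1 + d))"
      unfolding regression_cost_def by (intro add_mono mult_mono le_refl K L) simp_all
    ultimately show ?thesis by simp
  qed
  then show ?thesis by blast
qed

text \<open>A stored entry of \<open>A\<close> or \<open>b\<close> costs at most 40 units. The
  constant 80 also covers the case where the entries of \<open>b\<close> are charged to those of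
  \<open>A\<close>.\<close>

theorem running_time:
  "\<exists>prog C. \<forall>t1 t2. sketch_sizes c1 c2 t1 t2 \<longrightarrow>
      (\<exists>p :: nat poly. \<forall>G n d as bs. \<forall>A\<in>carrier_mat n d. \<forall>b\<in>carrier_vec n.
        property_P G \<and> coords_mat A as \<and> coords_vec b bs \<longrightarrow>
        (\<forall>\<omega>\<in>space (draws G n (t1 d) (t2 d)).
          \<exists>T s. exec prog (init_store n d (t1 d) (t2 d) as bs \<omega>) = (T, s) \<and>
            output_vec d s = x_hat A b (t1 d) (t2 d) \<omega> \<and>
            T \<le> C * (nnz_mat A + nnz_vec b) + poly p d \<and>
            (nnz_vec b \<le> nnz_mat A \<longrightarrow> T \<le> C * nnz_mat A + poly p d)))"
proof (rule exI[of _ regression], rule exI[of _ 80], intro allI impI)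
  fix t1 t2 :: "nat \<Rightarrow> nat"
  assume "sketch_sizes c1 c2 t1 t2"
  then obtain p :: "nat poly" where p: "\<And>d. regression_cost d (t1 d) (t2 d) \<le> poly p d"
    using regression_cost_poly by blast
  show "\<exists>p :: nat poly. \<forall>G n d as bs. \<forall>A\<in>carrier_mat n d. \<forall>b\<in>carrier_vec n.
        property_P G \<and> coords_mat A as \<and> coords_vec b bs \<longrightarrow>
        (\<forall>\<omega>\<in>space (draws G n (t1 d) (t2 d)).
          \<exists>T s. exec regression (init_store n d (t1 d) (t2 d) as bs \<omega>) = (T, s) \<and>
            output_vec d s = x_hat A b (t1 d) (t2 d) \<omega> \<and>
            T \<le> 80 * (nnz_mat A + nnz_vec b) + poly p d \<and>
            (nnz_vec b \<le> nnz_mat A \<longrightarrow> T \<le> 80 * nnz_mat A + poly p d))"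
  proof (intro exI[of _ p] allI ballI impI)
    fix G n d as bs A b and \<omega> :: draw
    assume A: "A \<in> carrier_mat n d" and b: "b \<in> carrier_vec n"
      and c: "property_P G \<and> coords_mat A as \<and> coords_vec b bs"
    obtain w \<sigma> h g where \<omega>: "\<omega> = (w, \<sigma>, h, g)" by (cases \<omega>)
    obtain T s where ex: "exec regression (init_store n d (t1 d) (t2 d) as bs \<omega>) = (T, s)" by fastforce
    have "run regression (init_store n d (t1 d) (t2 d) as bs \<omega>)
      (40 * length as + 40 * length bs + regression_cost d (t1 d) (t2 d))
      (\<lambda>s'. \<forall>j<d. rmem s' ''x'' j 0 = lsq_solution (t2 d) d (gaussed (t1 d) (t2 d) g (hashed n w \<sigma> h (augmented d A b))) j)"
      unfolding \<omega> using run_regression[OF A b _ _ refl] c by blast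
    then have T: "T \<le> 40 * length as + 40 * length bs + regression_cost d (t1 d) (t2 d)"
      and x: "\<And>j. j < d \<Longrightarrow> rmem s ''x'' j 0 = lsq_solution (t2 d) d (gaussed (t1 d) (t2 d) g (hashed n w \<sigma> h (augmented d A b))) j"
      unfolding run_def ex by auto
    have out: "output_vec d s = x_hat A b (t1 d) (t2 d) \<omega>"
      unfolding \<omega> x_hat_eq[OF A b] output_vec_def by (intro eq_vecI) (simp_all add: x)
    have "length as = nnz_mat A" "length bs = nnz_vec b"
      using c length_coords_mat length_coords_vec by blast+
    then show "\<exists>T s. exec regression (init_store n d (t1 d) (t2 d) as bs \<omega>) = (T, s) \<and>
            output_vec d s = x_hat A b (t1 d) (t2 d) \<omega> \<and>
            T \<le> 80 * (nnz_mat A + nnz_vec b) + poly p d \<and>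
            (nnz_vec b \<le> nnz_mat A \<longrightarrow> T \<le> 80 * nnz_mat A + poly p d)"
      using ex out T p[of d] by (intro exI[of _ T] exI[of _ s]) auto
  qed
qed

section \<open>Orlicz functions\<close>

locale orlicz_function =
  fixes G :: "real \<Rightarrow> real"
  assumes property_P: "property_P G"
begin

lemma G_nonneg: "0 \<le> G x" and G_0: "G 0 = 0" and G_1: "G 1 = 1" and G_minus: "G (- x) = G x"
  and G_mono: "0 \<le> u \<Longrightarrow> u \<le> v \<Longrightarrow> G u \<le> G v" and G_convex: "convex_on {0..} G"
  using property_P by (auto simp: property_P_def mono_on_def)

lemma G_abs: "G \<bar>x\<bar> = G x"
  by (simp add: abs_real_def G_minus)

lemma G_scale_le: "0 \<le> t \<Longrightarrow> t \<le> 1 \<Longrightarrow> 0 \<le> x \<Longrightarrow> G (t * x) \<le> t * G x"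
  using convex_onD[OF G_convex, of t 0 x] by (simp add: G_0)

lemma G_le_self: "0 \<le> x \<Longrightarrow> x \<le> 1 \<Longrightarrow> G x \<le> x"
  using G_scale_le[of x 1] by (simp add: G_1)

text \<open>Strictness comes from the positive slope \<open>s\<close>; it is what makes the norm
  dominate each coordinate.\<close>

lemma G_gt_1: "1 < x \<Longrightarrow> 1 < G x"
proof -
  assume x: "1 < x"
  obtain s where s: "s > 0" "\<And>x. x > 1 \<Longrightarrow> G x = s * x + (1 - s)"
    using property_P by (auto simp: property_P_def)
  have "s * 1 < s * x" using s x by (intro mult_strict_left_mono) auto
  then show ?thesis using s(2)[OF x] by simp
qed

lemma filterlim_G: "filterlim G at_top at_top"
proof -
  obtain s where s: "s > 0" "\<And>x. x > 1 \<Longrightarrow> G x = s * x + (1 - s)"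
    using property_P by (auto simp: property_P_def)
  have "filterlim (\<lambda>x. (1 - s) + s * x) at_top at_top"
    by (rule filterlim_tendsto_add_at_top[OF tendsto_const],
        rule filterlim_tendsto_pos_mult_at_top[OF tendsto_const s(1) filterlim_ident])
  then show ?thesis
    by (rule filterlim_mono_eventually) (auto simp: s intro: eventually_mono[OF eventually_gt_at_top[of 1]])
qed

text \<open>A zero at some \<open>x > 0\<close> would by monotonicity make \<open>G\<close> vanish
  on all of the interval up to \<open>x\<close>. Both \<open>g1\<close> and \<open>g2\<close> would
  then be zero, against the derivative condition.\<close>

lemma G_pos: "0 < x \<Longrightarrow> 0 < G x"
proof (rule ccontr)
  assume x: "0 < x" and "\<not> 0 < G x"
  then have "G x = 0" using G_nonneg[of x] by simp
  then have zero: "G y = 0" if "0 \<le> y" "y \<le> x" for y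
    using G_mono[of y x] G_nonneg[of y] that by simp
  obtain g1 g2 where g: "(G has_real_derivative g1) (at_right 0)"
     "((\<lambda>h. (deriv G h - g1) / h) \<longlongrightarrow> g2) (at_right 0)" "g1 > 0 \<or> g2 > 0"
    using property_P by (auto simp: property_P_def)
  have ev: "\<forall>\<^sub>F y in at_right 0. 0 < y \<and> y < x"
    using x by (auto simp: eventually_at_right_field)
  have "((\<lambda>y. (G y - G 0) / (y - 0)) \<longlongrightarrow> g1) (at_right 0)"
    using g(1) by (simp add: has_field_derivative_iff)
  moreover have "((\<lambda>y. (G y - G 0) / (y - 0)) \<longlongrightarrow> 0) (at_right 0)"
    by (rule tendsto_eventually, rule eventually_mono[OF ev]) (simp add: zero)
  ultimately have g1: "g1 = 0" by (rule tendsto_unique[OF trivial_limit_at_right_real])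
  have der: "deriv G h = 0" if "0 < h" "h < x" for h
  proof (rule DERIV_imp_deriv)
    have "((\<lambda>_. 0) has_field_derivative 0) (at h)" by simp
    then show "(G has_field_derivative 0) (at h)"
      by (rule has_field_derivative_transform_within_open[where S = "{0<..<x}"]) (use that zero in auto)
  qed
  have "((\<lambda>h. (deriv G h - g1) / h) \<longlongrightarrow> 0) (at_right 0)"
    by (rule tendsto_eventually, rule eventually_mono[OF ev]) (simp add: der g1)
  then have "g2 = 0" using g(2) by (metis tendsto_unique trivial_limit_at_right_real)
  then show False using g(3) g1 by simp
qed

lemma G_growth: "\<exists>C\<ge>1. \<forall>x\<ge>0. \<forall>k\<ge>1. G (k * x) \<le> C * k\<^sup>2 * G x"
proof -
  obtain C where C: "C > 0" "\<And>x y. 0 < x \<Longrightarrow> x < y \<Longrightarrow> G y / G x \<le> C * (y / x)\<^sup>2"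
    using property_P by (auto simp: property_P_def)
  have "G (k * x) \<le> max 1 C * k\<^sup>2 * G x" if "x \<ge> 0" "k \<ge> 1" for x k
  proof -
    have one: "1 * G x \<le> max 1 C * G x" by (intro mult_right_mono G_nonneg) simp
    show ?thesis
    proof (cases "x = 0 \<or> k = 1")
      case True
      then show ?thesis using one by (auto simp: G_0)
    next
      case False
      then have "x > 0" "k > 1" using that by simp_all
      then have "G (k * x) / G x \<le> C * k\<^sup>2" using C(2)[of x "k * x"] by simp
      also have "\<dots> \<le> max 1 C * k\<^sup>2" by (intro mult_right_mono) auto
      finally show ?thesis using G_pos[of x] \<open>x > 0\<close> by (simp add: divide_le_eq)
    qed
  qed
  then show ?thesis by (intro exI[of _ "max 1 C"]) auto
qed

text \<open>Convexity gives continuity in the open half-line only. At 0 it follows from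
  \<open>0 <= G y <= y\<close>, and evenness extends it to the whole line.\<close>

lemma continuous_on_G: "continuous_on UNIV G"
proof -
  have c0: "continuous_on {0<..} G"
    by (rule convex_on_continuous) (auto intro: convex_on_subset[OF G_convex])
  have "continuous (at x within {0..}) G" if "x \<ge> 0" for x
  proof (cases "x = 0")
    case True
    have "(G \<longlongrightarrow> 0) (at 0 within {0..})"
    proof (rule tendsto_sandwich)
      show "\<forall>\<^sub>F y in at 0 within {0..}. 0 \<le> G y" using G_nonneg by simp
      show "\<forall>\<^sub>F y in at 0 within {0..}. G y \<le> y"
        unfolding eventually_at by (intro exI[of _ 1]) (auto intro: G_le_self)
    qed (auto intro: tendsto_ident_at)
    then show ?thesis using True by (simp add: continuous_within G_0)
  next
    case False
    then have "isCont G x" using c0 that by (simp add: continuous_on_eq_continuous_at)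
    then show ?thesis by (rule continuous_at_imp_continuous_within)
  qed
  then have "continuous_on {0..} G" by (simp add: continuous_on_eq_continuous_within)
  then have "continuous_on UNIV (\<lambda>x. G \<bar>x\<bar>)"
    by (rule continuous_on_compose2) (auto intro: continuous_intros)
  then show ?thesis by (simp add: G_abs)
qed

lemma measurable_G [measurable]: "G \<in> borel_measurable borel"
  by (rule borel_measurable_continuous_onI[OF continuous_on_G])

lemma isCont_G: "isCont G x"
  using continuous_on_G by (simp add: continuous_on_eq_continuous_at)

subsection \<open>The Orlicz norm\<close>

definition G_norm :: "nat \<Rightarrow> (nat \<Rightarrow> real) \<Rightarrow> real" where
  "G_norm n f = Inf {\<alpha>. 0 < \<alpha> \<and> (\<Sum>i<n. G (\<bar>f i\<bar> / \<alpha>)) \<le> 1}"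

lemma orlicz_norm_eq_G_norm: "orlicz_norm G v = G_norm (dim_vec v) (\<lambda>i. v $ i)"
  by (simp add: orlicz_norm_def G_norm_def)

lemma G_norm_cong: "(\<And>i. i < n \<Longrightarrow> f i = g i) \<Longrightarrow> G_norm n f = G_norm n g"
  by (simp add: G_norm_def)

lemma sum_G_antimono:
  fixes n :: nat
  assumes "0 < a" "a \<le> c"
  shows "(\<Sum>i<n. G (\<bar>f i\<bar> / c)) \<le> (\<Sum>i<n. G (\<bar>f i\<bar> / a))"
  using assms by (intro sum_mono G_mono) (auto intro: divide_left_mono)

lemma sum_abs_admissible:
  fixes n :: nat
  assumes "0 < a" "(\<Sum>i<n. \<bar>f i\<bar>) \<le> a"
  shows "(\<Sum>i<n. G (\<bar>f i\<bar> / a)) \<le> 1"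
proof -
  have "(\<Sum>i<n. G (\<bar>f i\<bar> / a)) \<le> (\<Sum>i<n. \<bar>f i\<bar> / a)"
  proof (intro sum_mono G_le_self)
    fix i assume "i \<in> {..<n}"
    then have "\<bar>f i\<bar> \<le> (\<Sum>i<n. \<bar>f i\<bar>)" by (intro member_le_sum) auto
    then show "\<bar>f i\<bar> / a \<le> 1" using assms by simp
  qed (use assms in simp)
  also have "\<dots> = (\<Sum>i<n. \<bar>f i\<bar>) / a" by (simp add: sum_divide_distrib)
  also have "\<dots> \<le> 1" using assms by simp
  finally show ?thesis .
qed

text \<open>The sum is continuous in the scale, so the defining inequality persists at the infimum
  and a norm bound translates into a bound on the sum without slack.\<close>

lemma G_norm_le_iff:
  assumes c: "0 < c"
  shows "G_norm n f \<le> c \<longleftrightarrow> (\<Sum>i<n. G (\<bar>f i\<bar> / c)) \<le> 1"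
proof
  assume le: "G_norm n f \<le> c"
  have ne: "{\<alpha>. 0 < \<alpha> \<and> (\<Sum>i<n. G (\<bar>f i\<bar> / \<alpha>)) \<le> 1} \<noteq> {}"
    using sum_abs_admissible[of "1 + (\<Sum>i<n. \<bar>f i\<bar>)" f n]
    by (auto simp: add_pos_nonneg sum_nonneg intro!: exI[of _ "1 + (\<Sum>i<n. \<bar>f i\<bar>)"])
  have "(\<Sum>i<n. G (\<bar>f i\<bar> / c')) \<le> 1" if "c' > c" for c'
  proof -
    have "G_norm n f < c'" using le that by simp
    then obtain a where "0 < a" "(\<Sum>i<n. G (\<bar>f i\<bar> / a)) \<le> 1" "a < c'"
      unfolding G_norm_def using cInf_lessD[OF ne] by auto
    then show ?thesis using sum_G_antimono[of a c' f n] by simp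
  qed
  then have ev: "\<forall>\<^sub>F c' in at_right c. (\<Sum>i<n. G (\<bar>f i\<bar> / c')) \<le> 1"
    by (auto simp: eventually_at_right_field intro!: exI[of _ "c + 1"])
  have "((\<lambda>c'. \<Sum>i<n. G (\<bar>f i\<bar> / c')) \<longlongrightarrow> (\<Sum>i<n. G (\<bar>f i\<bar> / c))) (at_right c)"
    using c by (intro tendsto_sum isCont_tendsto_compose[OF isCont_G] tendsto_divide tendsto_const tendsto_ident_at) auto
  then show "(\<Sum>i<n. G (\<bar>f i\<bar> / c)) \<le> 1"
    by (rule tendsto_upperbound[OF _ ev trivial_limit_at_right_real])
next
  assume "(\<Sum>i<n. G (\<bar>f i\<bar> / c)) \<le> 1"
  then show "G_norm n f \<le> c"
    unfolding G_norm_def using c by (intro cInf_lower bdd_belowI[of _ 0]) auto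
qed

lemma G_norm_nonneg: "0 \<le> G_norm n f"
proof (rule ccontr)
  assume "\<not> 0 \<le> G_norm n f"
  then have le: "G_norm n f \<le> c" if "c > 0" for c using that by simp
  have "{\<alpha>. 0 < \<alpha> \<and> (\<Sum>i<n. G (\<bar>f i\<bar> / \<alpha>)) \<le> 1} = {0<..}"
    using G_norm_le_iff le by auto
  then have "G_norm n f = 0" by (simp add: G_norm_def)
  with \<open>\<not> 0 \<le> G_norm n f\<close> show False by simp
qed

lemma G_norm_le_sum_abs: "G_norm n f \<le> (\<Sum>i<n. \<bar>f i\<bar>)"
proof (rule field_le_epsilon)
  fix e :: real assume "e > 0"
  then show "G_norm n f \<le> (\<Sum>i<n. \<bar>f i\<bar>) + e"
    using sum_abs_admissible[of "(\<Sum>i<n. \<bar>f i\<bar>) + e" f n] sum_nonneg[of "{..<n}" "\<lambda>i. \<bar>f i\<bar>"]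
    by (subst G_norm_le_iff) (auto simp: add_nonneg_pos)
qed

lemma abs_le_G_norm:
  assumes "i < n"
  shows "\<bar>f i\<bar> \<le> G_norm n f"
proof (rule field_le_epsilon)
  fix e :: real assume "e > 0"
  define c where "c = G_norm n f + e"
  have c: "c > 0" "G_norm n f \<le> c" using \<open>e > 0\<close> G_norm_nonneg[of n f] by (auto simp: c_def)
  have "G (\<bar>f i\<bar> / c) \<le> (\<Sum>i<n. G (\<bar>f i\<bar> / c))"
    using assms by (intro member_le_sum) (auto simp: G_nonneg)
  also have "\<dots> \<le> 1" using G_norm_le_iff[OF c(1), of n f] c(2) by simp
  finally have "\<bar>f i\<bar> / c \<le> 1" using G_gt_1[of "\<bar>f i\<bar> / c"] by linarith
  then show "\<bar>f i\<bar> \<le> G_norm n f + e" using c(1) by (simp add: c_def)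
qed

text \<open>Convexity with the weights \<open>a / (a + b)\<close> and \<open>b / (a + b)\<close>;
  the added \<open>e / 2\<close> keeps \<open>a\<close> and \<open>b\<close> positive when a norm is
  zero.\<close>

lemma G_norm_triangle: "G_norm n (\<lambda>i. f i + g i) \<le> G_norm n f + G_norm n g"
proof (rule field_le_epsilon)
  fix e :: real assume "e > 0"
  define a b where "a = G_norm n f + e / 2" and "b = G_norm n g + e / 2"
  have a: "a > 0" "G_norm n f \<le> a" and b: "b > 0" "G_norm n g \<le> b"
    using \<open>e > 0\<close> G_norm_nonneg[of n f] G_norm_nonneg[of n g] by (auto simp: a_def b_def)
  have "G (\<bar>f i + g i\<bar> / (a + b)) \<le> a / (a + b) * G (\<bar>f i\<bar> / a) + b / (a + b) * G (\<bar>g i\<bar> / b)" for i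
  proof -
    have "\<bar>f i + g i\<bar> / (a + b) \<le> (\<bar>f i\<bar> + \<bar>g i\<bar>) / (a + b)"
      using a b by (intro divide_right_mono abs_triangle_ineq) auto
    also have "\<dots> = a / (a + b) * (\<bar>f i\<bar> / a) + b / (a + b) * (\<bar>g i\<bar> / b)"
      using a b by (simp add: add_divide_distrib)
    finally have "G (\<bar>f i + g i\<bar> / (a + b)) \<le> G (a / (a + b) * (\<bar>f i\<bar> / a) + b / (a + b) * (\<bar>g i\<bar> / b))"
      using a b by (intro G_mono) auto
    also have "\<dots> \<le> a / (a + b) * G (\<bar>f i\<bar> / a) + b / (a + b) * G (\<bar>g i\<bar> / b)"
    proof -
      have "a / (a + b) = 1 - b / (a + b)" using a b by (simp add: field_simps)
      then show ?thesis
        using convex_onD[OF G_convex, of "b / (a + b)" "\<bar>f i\<bar> / a" "\<bar>g i\<bar> / b"] a b by simp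
    qed
    finally show ?thesis .
  qed
  then have "(\<Sum>i<n. G (\<bar>f i + g i\<bar> / (a + b))) \<le> (\<Sum>i<n. a / (a + b) * G (\<bar>f i\<bar> / a) + b / (a + b) * G (\<bar>g i\<bar> / b))"
    by (rule sum_mono)
  also have "\<dots> = a / (a + b) * (\<Sum>i<n. G (\<bar>f i\<bar> / a)) + b / (a + b) * (\<Sum>i<n. G (\<bar>g i\<bar> / b))"
    by (simp add: sum.distrib sum_distrib_left)
  also have "\<dots> \<le> a / (a + b) * 1 + b / (a + b) * 1"
    using a b G_norm_le_iff by (intro add_mono mult_left_mono) auto
  also have "\<dots> = 1" using a b by (simp add: add_divide_distrib[symmetric])
  finally have "G_norm n (\<lambda>i. f i + g i) \<le> a + b" using a b by (subst G_norm_le_iff) auto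
  then show "G_norm n (\<lambda>i. f i + g i) \<le> G_norm n f + G_norm n g + e" by (simp add: a_def b_def)
qed

subsection \<open>The random weights\<close>

lemma real_distribution_weight: "real_distribution (weight_distr G)"
  and cdf_weight: "cdf (weight_distr G) = (\<lambda>t. if t < 0 then 0 else 1 - exp (- G t))"
proof -
  define F where "F = (\<lambda>t. if t < 0 then 0 else 1 - exp (- G t))"
  \<comment> \<open>Since \<open>G 0 = 0\<close>, the two branches agree at 0; written with
    \<open>max 0 t\<close>, the function is visibly continuous and monotone.\<close>
  have F: "F = (\<lambda>t. 1 - exp (- G (max 0 t)))" by (auto simp: F_def fun_eq_iff G_0 max_def)
  have mono: "F x \<le> F y" if "x \<le> y" for x y
    using G_mono[of "max 0 x" "max 0 y"] that by (simp add: F)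
  have "continuous_on UNIV F"
    unfolding F by (intro continuous_intros continuous_on_compose2[OF continuous_on_G]) auto
  then have cont: "continuous (at_right a) F" for a
    by (simp add: continuous_on_eq_continuous_at continuous_at_imp_continuous_within)
  have bot: "(F \<longlongrightarrow> 0) at_bot"
    by (rule tendsto_eventually) (auto simp: F_def eventually_at_bot_linorder intro!: exI[of _ "-1"])
  have "((\<lambda>t. 1 - exp (- G t)) \<longlongrightarrow> 1 - 0) at_top"
    by (intro tendsto_diff tendsto_const filterlim_compose[OF exp_at_bot]
        filterlim_compose[OF filterlim_uminus_at_bot_at_top] filterlim_G)
  then have top: "(F \<longlongrightarrow> 1) at_top"
    by (simp, elim Lim_transform_eventually) (auto simp: F_def eventually_at_top_linorder intro!: exI[of _ 0])
  show "real_distribution (weight_distr G)"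
    unfolding weight_distr_def F_def[symmetric] by (rule real_distribution_interval_measure[OF mono cont bot top])
  show "cdf (weight_distr G) = (\<lambda>t. if t < 0 then 0 else 1 - exp (- G t))"
    unfolding weight_distr_def F_def[symmetric] by (rule cdf_interval_measure[OF mono cont bot])
qed

lemma prob_space_weight: "prob_space (weight_distr G)"
  using real_distribution_weight by (simp add: real_distribution_def)

lemma sets_weight [measurable_cong, simp]: "sets (weight_distr G) = sets borel"
  and space_weight [simp]: "space (weight_distr G) = UNIV"
  by (simp_all add: weight_distr_def)

lemma weight_le: "0 \<le> t \<Longrightarrow> measure (weight_distr G) {..t} = 1 - exp (- G t)"
  using cdf_weight by (auto simp: cdf_def fun_eq_iff dest: spec[of _ t])

lemma weight_le_bound: "0 \<le> t \<Longrightarrow> measure (weight_distr G) {..t} \<le> G t"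
  using exp_ge_add_one_self[of "- G t"] by (simp add: weight_le)

text \<open>The closed tail lies in the open tail beyond \<open>t / 2\<close>, whose probability the
  distribution function gives directly. This avoids a discussion of point masses at the cost of a
  factor 2.\<close>

lemma weight_ge_bound:
  assumes "0 \<le> t"
  shows "measure (weight_distr G) {t..} \<le> exp (- G (t / 2))"
proof (cases "t = 0")
  case True
  interpret prob_space "weight_distr G" by (rule prob_space_weight)
  show ?thesis using True by (simp add: G_0)
next
  case False
  interpret prob_space "weight_distr G" by (rule prob_space_weight)
  have "prob {t..} \<le> prob (space (weight_distr G) - {..t / 2})"
    using assms False by (intro finite_measure_mono) auto
  also have "\<dots> = exp (- G (t / 2))"
    using assms by (subst prob_compl) (auto simp: weight_le)
  finally show ?thesis .
qed

end

lemma finite_sum_UN_bound: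
  assumes M: "prob_space M" and I: "finite I" and sets: "\<And>i. i \<in> I \<Longrightarrow> B i \<in> sets M"
    and b: "\<And>i. i \<in> I \<Longrightarrow> measure M (B i) \<le> b i"
  shows "measure M (\<Union>i\<in>I. B i) \<le> (\<Sum>i\<in>I. b i)"
proof -
  interpret prob_space M by fact
  have "measure M (\<Union>i\<in>I. B i) \<le> (\<Sum>i\<in>I. measure M (B i))"
    using I sets by (intro finite_measure_subadditive_finite) auto
  also have "\<dots> \<le> (\<Sum>i\<in>I. b i)" by (rule sum_mono[OF b])
  finally show ?thesis .
qed

lemma prob_Un_le:
  assumes "prob_space M" "A \<in> sets M" "B \<in> sets M" "measure M A \<le> a" "measure M B \<le> b"
  shows "measure M (A \<union> B) \<le> a + b"
  using measure_Un_le[of A M B] assms by linarith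

section \<open>Orthonormal families\<close>

definition orthonormal :: "nat \<Rightarrow> nat set \<Rightarrow> (nat \<Rightarrow> nat \<Rightarrow> real) \<Rightarrow> bool" where
  "orthonormal n J e \<longleftrightarrow> finite J \<and> (\<forall>j\<in>J. \<forall>k\<in>J. dotp n (e j) (e k) = (if j = k then 1 else 0))"

lemma orthonormal_coeff:
  assumes "orthonormal n J e" "j \<in> J"
  shows "dotp n (\<lambda>i. \<Sum>j\<in>J. c j * e j i) (e j) = c j"
proof -
  have "dotp n (\<lambda>i. \<Sum>j\<in>J. c j * e j i) (e j) = (\<Sum>k\<in>J. c k * dotp n (e k) (e j))"
    by (simp add: dotp_sum_left dotp_scale_left)
  also have "\<dots> = (\<Sum>k\<in>J. if k = j then c k else 0)"
    using assms by (intro sum.cong) (auto simp: orthonormal_def)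
  also have "\<dots> = c j" using assms by (simp add: orthonormal_def)
  finally show ?thesis .
qed

lemma orthonormal_norm:
  assumes "orthonormal n J e"
  shows "dotp n (\<lambda>i. \<Sum>j\<in>J. c j * e j i) (\<lambda>i. \<Sum>j\<in>J. c j * e j i) = (\<Sum>j\<in>J. (c j)\<^sup>2)"
proof -
  have "dotp n (\<lambda>i. \<Sum>j\<in>J. c j * e j i) (\<lambda>i. \<Sum>j\<in>J. c j * e j i) =
      (\<Sum>j\<in>J. c j * dotp n (\<lambda>i. \<Sum>j\<in>J. c j * e j i) (e j))"
    by (simp add: dotp_sum_right[of n _ "\<lambda>j i. c j * e j i"] dotp_scale_right)
  then show ?thesis using orthonormal_coeff[OF assms] by (simp add: power2_eq_square)
qed

lemma orthonormal_coordinate_le_1: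
  assumes "orthonormal n J e" "j \<in> J" "i < n"
  shows "\<bar>e j i\<bar> \<le> 1"
proof -
  have "(e j i)\<^sup>2 \<le> dotp n (e j) (e j)"
    unfolding dotp_def power2_eq_square[symmetric] using assms(3)
    by (intro member_le_sum) auto
  then show ?thesis using assms by (simp add: orthonormal_def abs_square_le_1)
qed

text \<open>Bessel's inequality for the coordinate vectors, summed over all coordinates.\<close>

lemma orthonormal_card_le:
  assumes "orthonormal n J e"
  shows "card J \<le> n"
proof -
  have bessel: "(\<Sum>j\<in>J. (e j i)\<^sup>2) \<le> 1" if "i < n" for i
  proof -
    define u where "u = (\<lambda>k. \<Sum>j\<in>J. e j i * e j k)"
    define \<delta> where "\<delta> k = (if k = i then 1 else 0 :: real)" for k
    have "0 \<le> dotp n (\<lambda>k. \<delta> k - u k) (\<lambda>k. \<delta> k - u k)" by (rule dotp_nonneg)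
    also have "\<dots> = dotp n \<delta> \<delta> - 2 * dotp n \<delta> u + dotp n u u"
      unfolding dotp_diff_left dotp_commute[of n _ "\<lambda>k. \<delta> k - u k"]
      by (simp add: dotp_commute[of n u \<delta>])
    also have "dotp n \<delta> \<delta> = 1" using that by (simp add: dotp_def \<delta>_def if_distrib cong: if_cong)
    also have "dotp n \<delta> u = u i" using that by (simp add: dotp_def \<delta>_def if_distrib[where f = "\<lambda>x. x * _"] cong: if_cong)
    also have "u i = (\<Sum>j\<in>J. (e j i)\<^sup>2)" by (simp add: u_def power2_eq_square)
    also have "dotp n u u = (\<Sum>j\<in>J. (e j i)\<^sup>2)"
      unfolding u_def by (rule orthonormal_norm[OF assms])
    finally show ?thesis by simp
  qed
  have "real (card J) = (\<Sum>j\<in>J. dotp n (e j) (e j))"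
    using assms by (simp add: orthonormal_def)
  also have "\<dots> = (\<Sum>i<n. \<Sum>j\<in>J. (e j i)\<^sup>2)"
    unfolding dotp_def by (subst sum.swap) (simp add: power2_eq_square)
  also have "\<dots> \<le> (\<Sum>i<n. 1)" using bessel by (intro sum_mono) auto
  finally show ?thesis by simp
qed

text \<open>The nonzero Gram--Schmidt vectors, normalized. \<open>J\<close> omits the dependent
  ones, so it may have gaps or be empty.\<close>

lemma ex_orthonormal_spanning:
  fixes R :: "nat \<Rightarrow> nat \<Rightarrow> real"
  shows "\<exists>J e. orthonormal n J e \<and> card J \<le> d \<and>
    (\<forall>x. \<exists>c. \<forall>i<n. (\<Sum>j<d. R j i * x j) = (\<Sum>j\<in>J. c j * e j i))"
proof -
  define q where "q j = dotp n (gs n R j) (gs n R j)" for j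
  define J where "J = {j. j < d \<and> q j \<noteq> 0}"
  define e where "e j i = gs n R j i / sqrt (q j)" for j i
  have J: "finite J" "J \<subseteq> {..<d}" by (auto simp: J_def)
  have qpos: "q j > 0" if "j \<in> J" for j
    using that dotp_nonneg[of n "gs n R j"] by (auto simp: J_def q_def)
  have "dotp n (e j) (e k) = (if j = k then 1 else 0)" if "j \<in> J" "k \<in> J" for j k
  proof -
    have "dotp n (e j) (e k) = dotp n (gs n R j) (gs n R k) / (sqrt (q j) * sqrt (q k))"
      by (simp add: dotp_def e_def sum_divide_distrib)
    then show ?thesis using gs_orth[of k j n R] qpos[OF that(1)] by (auto simp: q_def[symmetric])
  qed
  then have on: "orthonormal n J e" using J by (simp add: orthonormal_def)
  have "\<exists>b. \<forall>i<n. R j i = (\<Sum>l\<in>J. b l * e l i)" if "j < d" for j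
  proof -
    obtain a where a: "\<And>i. gs n R j i = R j i - (\<Sum>l<j. a l * gs n R l i)"
      using gs_expand[of n R j] by blast
    define a' where "a' l = (if l = j then 1 else if l < j then a l else 0)" for l
    have "R j i = (\<Sum>l\<in>J. (a' l * sqrt (q l)) * e l i)" if "i < n" for i
    proof -
      have "(\<Sum>l\<in>J. (a' l * sqrt (q l)) * e l i) = (\<Sum>l\<in>J. a' l * gs n R l i)"
        using qpos by (intro sum.cong) (auto simp: e_def dest!: qpos)
      also have "\<dots> = (\<Sum>l<d. a' l * gs n R l i)"
        using J dotp_self_eq_0[OF _ that] by (intro sum.mono_neutral_left) (auto simp: J_def q_def)
      also have "\<dots> = (\<Sum>l<Suc j. a' l * gs n R l i)"
        using \<open>j < d\<close> by (intro sum.mono_neutral_right) (auto simp: a'_def)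
      also have "\<dots> = R j i" using a[of i] by (simp add: a'_def)
      finally show ?thesis by simp
    qed
    then show ?thesis by (intro exI[of _ "\<lambda>l. a' l * sqrt (q l)"]) simp
  qed
  then have "\<forall>j. \<exists>b. j < d \<longrightarrow> (\<forall>i<n. R j i = (\<Sum>l\<in>J. b l * e l i))" by blast
  from choice[OF this] obtain b where b: "\<And>j i. j < d \<Longrightarrow> i < n \<Longrightarrow> R j i = (\<Sum>l\<in>J. b j l * e l i)" by blast
  have "(\<Sum>j<d. R j i * x j) = (\<Sum>l\<in>J. (\<Sum>j<d. x j * b j l) * e l i)" if "i < n" for x i
  proof -
    have "(\<Sum>j<d. R j i * x j) = (\<Sum>j<d. \<Sum>l\<in>J. x j * b j l * e l i)"
      using b[OF _ that] by (simp add: sum_distrib_left mult_ac)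
    then show ?thesis by (subst (asm) sum.swap) (simp add: sum_distrib_right)
  qed
  then have "\<exists>c. \<forall>i<n. (\<Sum>j<d. R j i * x j) = (\<Sum>l\<in>J. c l * e l i)" for x
    by (intro exI[of _ "\<lambda>l. \<Sum>j<d. x j * b j l"]) simp
  moreover have "card J \<le> d" using card_mono[OF _ J(2)] by simp
  ultimately show ?thesis using on by blast
qed

section \<open>Reweighting by the random diagonal matrix\<close>

text \<open>Layer decomposition of the square: if \<open>z\<close> lies between
  \<open>(1/2) ^ Suc k\<close> and \<open>(1/2) ^ k\<close>, the \<open>k\<close>-th summand alone
  is \<open>(1/4) ^ k\<close>. It is meant for random \<open>z\<close>, where the means of the
  indicators can be bounded.\<close>

lemma dyadic_square_bound:
  fixes z :: real
  assumes "0 \<le> z" "z \<le> 1"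
  shows "z\<^sup>2 \<le> (1/4) ^ m + (\<Sum>k<m. (1/4) ^ k * (if (1/2) ^ Suc k \<le> z then 1 else 0))"
proof (induction m)
  case 0
  then show ?case using assms by (simp add: power_le_one)
next
  case (Suc m)
  show ?case
  proof (cases "(1/2) ^ Suc m \<le> z")
    case True
    then have "(\<Sum>k<Suc m. (1/4) ^ k * (if (1/2) ^ Suc k \<le> z then 1 else 0 :: real)) =
        (\<Sum>k<m. (1/4) ^ k * (if (1/2) ^ Suc k \<le> z then 1 else 0)) + (1/4) ^ m"
      by simp
    moreover have "0 \<le> (1/4 :: real) ^ Suc m" by simp
    ultimately show ?thesis using Suc.IH by linarith
  next
    case False
    then have "z\<^sup>2 \<le> ((1/2) ^ Suc m)\<^sup>2" using assms by (intro power_mono) auto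
    also have "\<dots> = ((1/2)\<^sup>2) ^ Suc m" by (rule power_commutes[symmetric, THEN trans] | simp only: power_mult[symmetric] mult.commute)
    also have "\<dots> = (1/4 :: real) ^ Suc m" by (simp add: power2_eq_square)
    finally have "z\<^sup>2 \<le> (1/4) ^ Suc m" .
    moreover have "0 \<le> (\<Sum>k<Suc m. (1/4) ^ k * (if (1/2) ^ Suc k \<le> z then 1 else 0 :: real))"
      by (intro sum_nonneg) simp
    ultimately show ?thesis by linarith
  qed
qed

lemma half_le_ln: "2 \<le> n \<Longrightarrow> 1/2 \<le> ln (real n)"
proof -
  assume n: "2 \<le> n"
  have "(1 :: real) / 2 \<le> ln 2" using ln_le_minus_one[of "1/2"] by (simp add: ln_div)
  also have "\<dots> \<le> ln (real n)" using n by simp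
  finally show ?thesis .
qed

text \<open>The number of dyadic scales: with it the cut-off error \<open>n * (1/4) ^ m\<close> is
  at most 1. The factor 4 is 2 for the change of logarithm base times 2 for rounding up.\<close>

lemma ex_log_exponent:
  assumes "2 \<le> (n :: nat)"
  shows "\<exists>m. real n \<le> 2 ^ m \<and> real m \<le> 4 * ln (real n) \<and> 1 \<le> m"
proof -
  define m where "m = nat \<lceil>log 2 (real n)\<rceil>"
  have l1: "1 \<le> log 2 (real n)" using assms by simp
  have "log 2 (real n) \<le> real m" unfolding m_def by (rule real_nat_ceiling_ge)
  then have "real n \<le> 2 powr (real m)" using assms by (simp add: log_le_iff)
  moreover have "real m \<le> log 2 (real n) + 1" unfolding m_def using l1 by linarith
  moreover have "log 2 (real n) \<le> 2 * ln (real n)"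
  proof -
    have "(1 :: real) / 2 \<le> ln 2" using half_le_ln[of 2] by simp
    then show ?thesis using assms by (simp add: log_def divide_le_eq mult_le_cancel_left1)
  qed
  moreover have "1 \<le> m" using l1 \<open>log 2 (real n) \<le> real m\<close> by simp
  ultimately show ?thesis using l1 by (intro exI[of _ m]) (auto simp: powr_realpow)
qed

section \<open>Expansion of one vector and contraction of a subspace under the weights\<close>

context orlicz_function begin

definition weights :: "nat \<Rightarrow> (nat \<Rightarrow> real) measure" where
  "weights n = PiM {..<n} (\<lambda>_. weight_distr G)"

lemma prob_space_weights: "prob_space (weights n)"
  unfolding weights_def by (intro prob_space_PiM prob_space_weight)

lemma product_prob_space_weight: "product_prob_space (\<lambda>_. weight_distr G)"
  by (simp add: product_prob_space_def product_prob_space_axioms_def product_sigma_finite_def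
      prob_space_weight prob_space_imp_sigma_finite)

lemma space_weights: "space (weights n) = PiE {..<n} (\<lambda>_. UNIV)"
  by (simp add: weights_def space_PiM)

lemma measurable_weights_coord [measurable]: "i < n \<Longrightarrow> (\<lambda>w. w i) \<in> borel_measurable (weights n)"
  using measurable_component_singleton[of i "{..<n}" "\<lambda>_. weight_distr G"]
  by (simp add: weights_def cong: measurable_cong_sets)

lemma weights_coord:
  assumes "i < n" "A \<in> sets borel"
  shows "measure (weights n) {w \<in> space (weights n). w i \<in> A} = measure (weight_distr G) A"
proof -
  interpret product_prob_space "\<lambda>_. weight_distr G" "{..<n}" by (rule product_prob_space_weight)
  have "measure (weight_distr G) A = measure (distr (PiM {..<n} (\<lambda>_. weight_distr G)) (weight_distr G) (\<lambda>\<omega>. \<omega> i)) A"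
    using assms by (subst PiM_component) auto
  also have "\<dots> = measure (weights n) {w \<in> space (weights n). w i \<in> A}"
    unfolding weights_def using assms
    by (subst measure_distr) (auto intro!: arg_cong[where f = "measure _"])
  finally show ?thesis by simp
qed

lemma weights_coord_le: "i < n \<Longrightarrow> 0 \<le> t \<Longrightarrow> measure (weights n) {w \<in> space (weights n). w i \<le> t} \<le> G t"
  using weights_coord[of i n "{..t}"] weight_le_bound[of t] by simp

text \<open>Independence multiplies the tails, and the exponential form of the weight law turns the
  product into the exponential of a sum of values of \<open>G\<close>.\<close>

lemma weights_all_ge:
  assumes "\<And>i. i < n \<Longrightarrow> 0 \<le> t i"
  shows "measure (weights n) {w \<in> space (weights n). \<forall>i<n. t i \<le> w i} \<le> exp (- (\<Sum>i<n. G (t i / 2)))"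
proof -
  interpret product_prob_space "\<lambda>_. weight_distr G" "{..<n}" by (rule product_prob_space_weight)
  interpret finite_product_prob_space "\<lambda>_. weight_distr G" "{..<n}" by standard simp
  have "{w \<in> space (weights n). \<forall>i<n. t i \<le> w i} = PiE {..<n} (\<lambda>i. {t i..})"
    by (auto simp: space_weights PiE_iff extensional_def)
  then have "measure (weights n) {w \<in> space (weights n). \<forall>i<n. t i \<le> w i} = (\<Prod>i<n. measure (weight_distr G) {t i..})"
    unfolding weights_def by (simp add: prob_times)
  also have "\<dots> \<le> (\<Prod>i<n. exp (- G (t i / 2)))"
    using assms by (intro prod_mono) (auto intro: weight_ge_bound)
  also have "\<dots> = exp (- (\<Sum>i<n. G (t i / 2)))" by (simp add: exp_sum sum_negf[symmetric])
  finally show ?thesis .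
qed

text \<open>The second moment of \<open>1 / w i\<close> is infinite, so Markov's inequality applies
  only after removing the event that some weight is tiny and truncating at \<open>m\<close> dyadic
  scales. At scale \<open>k\<close> the weight \<open>(1/4) ^ k\<close> meets the probability bound
  \<open>G (2 ^ Suc k * a i)\<close>, and quadratic growth is just what bounds their product by
  \<open>4 * C * G (a i)\<close> for every \<open>k\<close>. The logarithm is the number of
  scales.\<close>

lemma weights_l2_upper:
  "\<exists>K>0. \<forall>n\<ge>2. \<forall>f. (\<Sum>i<n. G \<bar>f i\<bar>) \<le> 1 \<longrightarrow>
    (\<exists>B\<in>sets (weights n). measure (weights n) B \<le> 1/25 \<and>
      (\<forall>w\<in>space (weights n) - B. (\<Sum>i<n. (f i / w i)\<^sup>2) \<le> K * ln (real n)))"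
proof -
  obtain C where C: "C \<ge> 1" "\<And>x k. x \<ge> 0 \<Longrightarrow> k \<ge> 1 \<Longrightarrow> G (k * x) \<le> C * k\<^sup>2 * G x"
    using G_growth by auto
  have "\<exists>B\<in>sets (weights n). measure (weights n) B \<le> 1/25 \<and>
      (\<forall>w\<in>space (weights n) - B. (\<Sum>i<n. (f i / w i)\<^sup>2) \<le> 50000 * C * ln (real n))"
    if n: "n \<ge> 2" and f: "(\<Sum>i<n. G \<bar>f i\<bar>) \<le> 1" for n f
  proof -
    interpret prob_space "weights n" by (rule prob_space_weights)
    obtain m where m: "real n \<le> 2 ^ m" "real m \<le> 4 * ln (real n)" "1 \<le> m"
      using ex_log_exponent[OF n] by blast
    \<comment> \<open>The scaling makes the event that some weight is at most \<open>a i\<close>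
      have probability at most \<open>1/50\<close>; outside it all ratios \<open>a i / w i\<close>
      are below 1.\<close>
    define a where "a i = \<bar>f i\<bar> / 50" for i
    have a0: "a i \<ge> 0" for i by (simp add: a_def)
    have Ga: "(\<Sum>i<n. G (a i)) \<le> 1/50"
    proof -
      have "(\<Sum>i<n. G (a i)) \<le> (\<Sum>i<n. 1/50 * G \<bar>f i\<bar>)"
        unfolding a_def using G_scale_le[of "1/50"] by (intro sum_mono) simp
      also have "\<dots> \<le> 1/50" using f by (simp add: sum_distrib_left[symmetric] del: times_divide_eq_left)
      finally show ?thesis .
    qed
    define B1 where "B1 = (\<Union>i<n. {w \<in> space (weights n). w i \<le> a i})"
    have B1: "B1 \<in> sets (weights n)" unfolding B1_def by measurable
    have pB1: "prob B1 \<le> 1/50"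
    proof -
      have "prob B1 \<le> (\<Sum>i<n. G (a i))"
        unfolding B1_def by (rule finite_sum_UN_bound[OF prob_space_weights]) (auto intro!: weights_coord_le a0)
      then show ?thesis using Ga by linarith
    qed
    define I :: "nat \<Rightarrow> nat \<Rightarrow> (nat \<Rightarrow> real) \<Rightarrow> real"
      where "I i k w = indicator {w \<in> space (weights n). w i \<le> 2 ^ Suc k * a i} w" for i k w
    define \<phi> where "\<phi> w = (\<Sum>i<n. \<Sum>k<m. (1/4) ^ k * I i k w)" for w
    have int: "integrable (weights n) (I i k)" if "i < n" for i k
      unfolding I_def using that by (intro integrable_real_indicator) (auto simp: emeasure_eq_measure)
    have int\<phi>: "integrable (weights n) \<phi>"
      unfolding \<phi>_def by (intro Bochner_Integration.integrable_sum integrable_mult_right int) simp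
    have "expectation \<phi> = (\<Sum>i<n. \<Sum>k<m. (1/4) ^ k * expectation (I i k))"
      unfolding \<phi>_def
      by (simp add: Bochner_Integration.integral_sum Bochner_Integration.integrable_sum int)
    also have "\<dots> \<le> (\<Sum>i<n. \<Sum>k<m. 4 * C * G (a i))"
    proof (intro sum_mono)
      fix i k assume i: "i \<in> {..<n}"
      have "expectation (I i k) = prob {w \<in> space (weights n). w i \<le> 2 ^ Suc k * a i}"
        unfolding I_def by (simp add: Int_absorb2 Collect_subset del: power_Suc)
      also have "\<dots> \<le> G (2 ^ Suc k * a i)" using i a0 by (intro weights_coord_le) auto
      also have "\<dots> \<le> C * (2 ^ Suc k)\<^sup>2 * G (a i)" using a0 by (intro C(2)) (auto simp del: power_Suc intro: one_le_power)
      also have "(2 ^ Suc k)\<^sup>2 = (4 :: real) * 4 ^ k" by (simp add: power2_eq_square power_mult_distrib[symmetric])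
      finally have "(1/4) ^ k * expectation (I i k) \<le> (1/4) ^ k * (C * (4 * 4 ^ k) * G (a i))"
        by (intro mult_left_mono) auto
      also have "\<dots> = 4 * C * G (a i)" by (simp add: power_divide)
      finally show "(1/4) ^ k * expectation (I i k) \<le> 4 * C * G (a i)" .
    qed
    also have "\<dots> = 4 * C * real m * (\<Sum>i<n. G (a i))" by (simp add: sum_distrib_left mult_ac)
    also have "\<dots> \<le> 4 * C * real m * (1/50)" using C Ga by (intro mult_left_mono) auto
    finally have E: "expectation \<phi> \<le> 4 * C * real m * (1/50)" .
    \<comment> \<open>Fifty times the bound on the expectation, so that Markov's inequality leaves
      \<open>1/50\<close>.\<close>
    define T where "T = 4 * C * real m"
    have T: "T > 0" using C m by (simp add: T_def)
    define B2 where "B2 = {w \<in> space (weights n). T \<le> \<phi> w}"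
    have B2: "B2 \<in> sets (weights n)" unfolding B2_def using int\<phi> by measurable
    have "prob B2 \<le> expectation \<phi> / T"
      unfolding B2_def by (rule integral_Markov_inequality_measure[OF int\<phi>, of "{}"])
        (use T in \<open>auto simp: \<phi>_def I_def intro!: sum_nonneg\<close>)
    also have "\<dots> \<le> 1/50" using E T by (simp add: T_def field_simps)
    finally have pB2: "prob B2 \<le> 1/50" .
    have "(\<Sum>i<n. (f i / w i)\<^sup>2) \<le> 50000 * C * ln (real n)" if w: "w \<in> space (weights n) - (B1 \<union> B2)" for w
    proof -
      have wa: "a i < w i" if "i < n" for i using w that unfolding B1_def by force
      have wphi: "\<phi> w < T" using w by (auto simp: B2_def)
      have "(a i / w i)\<^sup>2 \<le> (1/4) ^ m + (\<Sum>k<m. (1/4) ^ k * I i k w)" if i: "i < n" for i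
      proof -
        have wi: "0 < w i" using wa[OF i] a0[of i] by linarith
        have "(a i / w i)\<^sup>2 \<le> (1/4) ^ m + (\<Sum>k<m. (1/4) ^ k * (if (1/2) ^ Suc k \<le> a i / w i then 1 else 0))"
          using wi wa[OF i] a0[of i] by (intro dyadic_square_bound) auto
        also have "(\<Sum>k<m. (1/4) ^ k * (if (1/2) ^ Suc k \<le> a i / w i then 1 else 0)) = (\<Sum>k<m. (1/4) ^ k * I i k w)"
        proof (intro sum.cong refl arg_cong2[where f = "(*)"])
          fix k
          have "(1/2) ^ Suc k \<le> a i / w i \<longleftrightarrow> w i \<le> 2 ^ Suc k * a i"
            using wi by (simp add: power_one_over field_simps)
          then show "(if (1/2) ^ Suc k \<le> a i / w i then 1 else 0) = I i k w"
            using w by (simp add: I_def indicator_def)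
        qed
        finally show ?thesis .
      qed
      then have "(\<Sum>i<n. (a i / w i)\<^sup>2) \<le> (\<Sum>i<n. (1/4) ^ m + (\<Sum>k<m. (1/4) ^ k * I i k w))"
        by (intro sum_mono) simp
      also have "\<dots> = real n * (1/4) ^ m + \<phi> w" by (simp add: sum.distrib \<phi>_def)
      also have "real n * (1/4) ^ m \<le> 1"
      proof -
        have "real n * (1/4) ^ m \<le> 2 ^ m * (1/4) ^ m" using m by (intro mult_right_mono) auto
        also have "\<dots> = (1/2 :: real) ^ m" by (simp add: power_mult_distrib[symmetric])
        also have "\<dots> \<le> 1" by (simp add: power_le_one)
        finally show ?thesis .
      qed
      also have "1 + \<phi> w \<le> 5 * C * real m"
      proof -
        have "1 * 1 \<le> C * real m" using C m by (intro mult_mono) auto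
        then show ?thesis using wphi by (simp add: T_def)
      qed
      also have "5 * C * real m \<le> 5 * C * (4 * ln (real n))" using C m by (intro mult_left_mono) auto
      finally have s: "(\<Sum>i<n. (a i / w i)\<^sup>2) \<le> 20 * C * ln (real n)" by simp
      have "(\<Sum>i<n. (f i / w i)\<^sup>2) = 2500 * (\<Sum>i<n. (a i / w i)\<^sup>2)"
        by (simp add: sum_distrib_left a_def power_divide)
      then show ?thesis using s by simp
    qed
    moreover have "prob (B1 \<union> B2) \<le> 1/50 + 1/50"
      by (rule prob_Un_le[OF prob_space_weights B1 B2 pB1 pB2])
    ultimately show ?thesis using B1 B2 by (intro bexI[of _ "B1 \<union> B2"]) auto
  qed
  then show ?thesis using C by (intro exI[of _ "50000 * C"]) auto
qed

text \<open>The box contains at most \<open>(n ^ 30 / 50) ^ r\<close> grid points, \<open>r = card J\<close>, and by the choice of \<open>s\<close>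
  each of them contributes probability at most \<open>exp (- 1 / (16 * s)) = 1 / n ^ (30 * r)\<close>.\<close>

lemma weights_lattice_bound:
  assumes n: "n \<ge> 2" and J: "card J \<ge> 1" and fin: "finite J"
    and P: "P = 24000 * n ^ 4" and s: "s = 1 / (480 * real (card J) * ln (real n))"
    and L: "L = 2 * int n * int P + 1"
    and N: "N = {k \<in> PiE J (\<lambda>_. {-L..L}). 1/2 \<le> (\<Sum>i<n. G (2 * \<bar>\<Sum>j\<in>J. real_of_int (k j) / real P * e j i\<bar>))}"
  shows "measure (weights n) (\<Union>k\<in>N. {w \<in> space (weights n).
      \<forall>i<n. \<bar>\<Sum>j\<in>J. real_of_int (k j) / real P * e j i\<bar> / (2 * s) \<le> w i}) \<le> 1/50"
proof -
  define r where "r = card J"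
  define y where "y k i = (\<Sum>j\<in>J. real_of_int (k j) / real P * e j i)" for k i
  have lnn: "1/2 \<le> ln (real n)" by (rule half_le_ln[OF n])
  have "1 * (1/2) \<le> real r * ln (real n)" using J lnn by (intro mult_mono) (auto simp: r_def)
  then have s0: "s > 0" and s8: "8 * s \<le> 1"
    unfolding s r_def[symmetric] by (auto simp: field_simps)
  have N_fin: "finite N" unfolding N
    by (rule finite_subset[of _ "PiE J (\<lambda>_. {-L..L})"]) (auto intro: finite_PiE fin)
  have one: "measure (weights n) {w \<in> space (weights n). \<forall>i<n. \<bar>y k i\<bar> / (2 * s) \<le> w i} \<le> (1 / real n ^ 30) ^ r"
    if k: "k \<in> N" for k
  proof -
    have "measure (weights n) {w \<in> space (weights n). \<forall>i<n. \<bar>y k i\<bar> / (2 * s) \<le> w i} \<le>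
        exp (- (\<Sum>i<n. G (\<bar>y k i\<bar> / (2 * s) / 2)))"
      using s0 by (intro weights_all_ge) simp
    also have "\<dots> \<le> exp (- (30 * real r * ln (real n)))"
    proof -
      \<comment> \<open>Convexity gains the factor \<open>8 * s\<close> when the argument shrinks by
        it, so mass \<open>1/2\<close> at \<open>2 * y\<close> becomes mass
        \<open>1 / (16 * s)\<close> at the larger argument.\<close>
      have "1/2 \<le> (\<Sum>i<n. G (2 * \<bar>y k i\<bar>))" using k by (simp add: N y_def)
      also have "\<dots> \<le> (\<Sum>i<n. 8 * s * G (\<bar>y k i\<bar> / (2 * s) / 2))"
      proof (intro sum_mono)
        fix i
        have "G (8 * s * (\<bar>y k i\<bar> / (2 * s) / 2)) \<le> 8 * s * G (\<bar>y k i\<bar> / (2 * s) / 2)"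
          using s0 s8 by (intro G_scale_le) auto
        also have "8 * s * (\<bar>y k i\<bar> / (2 * s) / 2) = 2 * \<bar>y k i\<bar>" using s0 by (simp add: field_simps)
        finally show "G (2 * \<bar>y k i\<bar>) \<le> 8 * s * G (\<bar>y k i\<bar> / (2 * s) / 2)" .
      qed
      also have "\<dots> = 8 * s * (\<Sum>i<n. G (\<bar>y k i\<bar> / (2 * s) / 2))" by (simp add: sum_distrib_left)
      finally have "1 / (16 * s) \<le> (\<Sum>i<n. G (\<bar>y k i\<bar> / (2 * s) / 2))" using s0 by (simp add: field_simps)
      moreover have "1 / (16 * s) = 30 * real r * ln (real n)" by (simp add: s r_def)
      ultimately show ?thesis by simp
    qed
    also have "\<dots> = (1 / real n ^ 30) ^ r"
    proof -
      have "exp (- (30 * real r * ln (real n))) = inverse (exp (real (30 * r) * ln (real n)))"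
        by (simp add: exp_minus)
      also have "exp (real (30 * r) * ln (real n)) = real n ^ (30 * r)"
        using n by (subst exp_of_nat_mult) simp
      finally show ?thesis by (simp add: power_mult inverse_eq_divide power_one_over)
    qed
    finally show ?thesis .
  qed
  have "measure (weights n) (\<Union>k\<in>N. {w \<in> space (weights n). \<forall>i<n. \<bar>y k i\<bar> / (2 * s) \<le> w i}) \<le>
      (\<Sum>k\<in>N. (1 / real n ^ 30) ^ r)"
    by (rule finite_sum_UN_bound[OF prob_space_weights N_fin _ one]) measurable
  also have "\<dots> = real (card N) * (1 / real n ^ 30) ^ r" by simp
  also have "\<dots> \<le> (real (2 * n * P * 2 + 3)) ^ r * (1 / real n ^ 30) ^ r"
  proof (intro mult_right_mono)
    have "card N \<le> card (PiE J (\<lambda>_. {-L..L}))"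
      unfolding N using fin by (intro card_mono finite_PiE) auto
    also have "\<dots> = (2 * n * P * 2 + 3) ^ r"
    proof -
      have "card {-L..L} = 2 * n * P * 2 + 3" by (simp add: L nat_add_distrib nat_mult_distrib)
      then show ?thesis using fin by (simp add: card_PiE r_def)
    qed
    finally show "real (card N) \<le> (real (2 * n * P * 2 + 3)) ^ r" by (metis of_nat_le_iff of_nat_power)
  qed simp
  also have "\<dots> = (real (2 * n * P * 2 + 3) / real n ^ 30) ^ r" by (simp add: power_mult_distrib[symmetric])
  also have "\<dots> \<le> (1/50) ^ r"
  proof (intro power_mono)
    \<comment> \<open>Each coordinate has \<open>4 * n * P + 3\<close> grid values, that is
      \<open>96000 * n ^ 5 + 3\<close>. Times 50 this is at most \<open>4800150 * n ^ 5\<close>, and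
      \<open>2 ^ 25\<close> exceeds that constant; hence the exponent 30.\<close>
    have n25: "33554432 \<le> n ^ 25"
      using power_mono[of 2 n 25] n by simp
    have n5: "1 \<le> n ^ 5" using n by simp
    have "(2 * n * P * 2 + 3) * 50 \<le> 4800150 * n ^ 5"
    proof -
      have "n ^ 5 = n * n ^ 4" using power_Suc[of n 4] by simp
      then have "(2 * n * P * 2 + 3) * 50 = 4800000 * n ^ 5 + 150" by (simp add: P)
      then show ?thesis using n5 by linarith
    qed
    also have "\<dots> \<le> n ^ 25 * n ^ 5" using n25 by (intro mult_right_mono) auto
    also have "\<dots> = n ^ 30" by (simp add: power_add[symmetric])
    finally have "real ((2 * n * P * 2 + 3) * 50) \<le> real (n ^ 30)" by (rule of_nat_mono)
    then show "real (2 * n * P * 2 + 3) / real n ^ 30 \<le> 1/50"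
      using n by (simp add: divide_le_eq)
  qed simp
  also have "\<dots> \<le> 1/50" using J power_decreasing[of 1 r "1/50 :: real"] by (simp add: r_def)
  finally show ?thesis unfolding y_def .
qed

text \<open>If each coordinate of \<open>u\<close> were at most \<open>s * w i\<close>, a nearby
  grid point would satisfy this with \<open>2 * s\<close>: rounding moves a coordinate by at most
  \<open>\<gamma> = s * \<tau>\<close>, and off \<open>B2\<close> all weights exceed
  \<open>\<tau>\<close>. Grid points that retain enough mass do so only on
  \<open>B1\<close>.\<close>

lemma weights_sup_lower:
  assumes n: "n \<ge> 2" and on: "orthonormal n J e" and J: "J \<noteq> {}"
  shows "\<exists>B\<in>sets (weights n). measure (weights n) B \<le> 1/25 \<and>
    (\<forall>w\<in>space (weights n) - B. (\<forall>i<n. 0 < w i) \<and>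
      (\<forall>c. (\<forall>i<n. \<bar>\<Sum>j\<in>J. c j * e j i\<bar> \<le> 2) \<and> 1 < (\<Sum>i<n. G \<bar>\<Sum>j\<in>J. c j * e j i\<bar>) \<longrightarrow>
         (\<exists>i<n. w i / (480 * real (card J) * ln (real n)) < \<bar>\<Sum>j\<in>J. c j * e j i\<bar>)))"
proof -
  have fin: "finite J" using on by (simp add: orthonormal_def)
  define r where "r = card J"
  have r: "1 \<le> r" "r \<le> n" using J fin orthonormal_card_le[OF on] by (auto simp: r_def Suc_le_eq card_gt_0_iff)
  \<comment> \<open>The power \<open>n ^ 4\<close> absorbs \<open>n * r * ln n <= n ^ 3\<close> in
    \<open>\<tau>\<close> and leaves \<open>1 / n\<close> for the union over the coordinates;
    \<open>24000 = 480 * 50\<close>.\<close>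
  define P where "P = 24000 * n ^ 4"
  define s where "s = 1 / (480 * real (card J) * ln (real n))"
  define L where "L = 2 * int n * int P + 1"
  define y where "y k i = (\<Sum>j\<in>J. real_of_int (k j) / real P * e j i)" for k i
  define N where "N = {k \<in> PiE J (\<lambda>_. {-L..L}). 1/2 \<le> (\<Sum>i<n. G (2 * \<bar>y k i\<bar>))}"
  have N: "N = {k \<in> PiE J (\<lambda>_. {-L..L}). 1/2 \<le> (\<Sum>i<n. G (2 * \<bar>\<Sum>j\<in>J. real_of_int (k j) / real P * e j i\<bar>))}"
    by (simp add: N_def y_def)
  have e1: "\<bar>e j i\<bar> \<le> 1" if "j \<in> J" "i < n" for j i
    by (rule orthonormal_coordinate_le_1[OF on that])
  have lnn: "0 < ln (real n)" "ln (real n) \<le> real n" using n ln_bound[of "real n"] by auto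
  have s0: "s > 0" using r lnn by (simp add: s_def r_def)
  have P0: "P > 0" using n by (simp add: P_def)
  have Pn: "real n * (4 * real n) \<le> real P"
  proof -
    have "n ^ 2 \<le> n ^ 4" using n by (intro power_increasing) auto
    then have "4 * (n * n) \<le> P" by (simp add: P_def power2_eq_square)
    then have "real (4 * (n * n)) \<le> real P" by (rule of_nat_mono)
    then show ?thesis by simp
  qed
  define \<gamma> where "\<gamma> = real n / real P"
  define \<tau> where "\<tau> = \<gamma> / s"
  have \<tau>: "0 \<le> \<tau>" "\<tau> \<le> 1 / (50 * real n)"
  proof -
    show "0 \<le> \<tau>" using s0 by (simp add: \<tau>_def \<gamma>_def)
    have "\<tau> = real n * (480 * real r * ln (real n)) / real P" by (simp add: \<tau>_def \<gamma>_def s_def r_def)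
    also have "\<dots> \<le> real n * (480 * real n * real n) / real P"
      using r lnn by (intro divide_right_mono mult_left_mono mult_mono) auto
    also have "\<dots> = 1 / (50 * real n)" using n by (simp add: P_def power4_eq_xxxx field_simps)
    finally show "\<tau> \<le> 1 / (50 * real n)" .
  qed
  define B1 where "B1 = (\<Union>k\<in>N. {w \<in> space (weights n). \<forall>i<n. \<bar>y k i\<bar> / (2 * s) \<le> w i})"
  define B2 where "B2 = (\<Union>i<n. {w \<in> space (weights n). w i \<le> \<tau>})"
  have N_fin: "finite N" unfolding N_def
    by (rule finite_subset[of _ "PiE J (\<lambda>_. {-L..L})"]) (auto intro: finite_PiE fin)
  have sets1: "{w \<in> space (weights n). \<forall>i<n. \<bar>y k i\<bar> / (2 * s) \<le> w i} \<in> sets (weights n)" for k by measurable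
  have B1: "B1 \<in> sets (weights n)" unfolding B1_def using N_fin sets1 by (intro sets.finite_UN) auto
  have B2: "B2 \<in> sets (weights n)" unfolding B2_def by measurable
  have p1: "measure (weights n) B1 \<le> 1/50"
    unfolding B1_def y_def
    by (rule weights_lattice_bound[OF n _ fin P_def s_def L_def N]) (use r in \<open>auto simp: r_def\<close>)
  have p2: "measure (weights n) B2 \<le> 1/50"
  proof -
    have "measure (weights n) B2 \<le> (\<Sum>i<n. G \<tau>)"
      unfolding B2_def by (rule finite_sum_UN_bound[OF prob_space_weights]) (auto intro!: weights_coord_le \<tau>)
    also have "\<dots> \<le> real n * \<tau>"
    proof -
      have "1 / (50 * real n) \<le> 1" using n by simp
      then have "\<tau> \<le> 1" using \<tau>(2) by linarith
      then show ?thesis using G_le_self[of \<tau>] \<tau> by (simp add: mult_left_mono)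
    qed
    also have "\<dots> \<le> real n * (1 / (50 * real n))" using \<tau> by (intro mult_left_mono) auto
    also have "\<dots> = 1/50" using n by simp
    finally show ?thesis .
  qed
  have "(\<forall>i<n. 0 < w i) \<and>
      (\<forall>c. (\<forall>i<n. \<bar>\<Sum>j\<in>J. c j * e j i\<bar> \<le> 2) \<and> 1 < (\<Sum>i<n. G \<bar>\<Sum>j\<in>J. c j * e j i\<bar>) \<longrightarrow>
         (\<exists>i<n. w i / (480 * real (card J) * ln (real n)) < \<bar>\<Sum>j\<in>J. c j * e j i\<bar>))"
    if w: "w \<in> space (weights n) - (B1 \<union> B2)" for w
  proof (intro conjI allI impI)
    have w\<tau>: "\<tau> < w i" if "i < n" for i using w that unfolding B2_def by force
    show "0 < w i" if "i < n" for i using w\<tau>[OF that] \<tau>(1) by linarith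
    fix c :: "nat \<Rightarrow> real"
    define u where "u i = (\<Sum>j\<in>J. c j * e j i)" for i
    assume c: "(\<forall>i<n. \<bar>\<Sum>j\<in>J. c j * e j i\<bar> \<le> 2) \<and> 1 < (\<Sum>i<n. G \<bar>\<Sum>j\<in>J. c j * e j i\<bar>)"
    then have u2: "\<bar>u i\<bar> \<le> 2" if "i < n" for i using that by (simp add: u_def)
    have uG: "1 < (\<Sum>i<n. G \<bar>u i\<bar>)" using c by (simp add: u_def)
    have "\<exists>i<n. s * w i < \<bar>u i\<bar>"
    proof (rule ccontr)
      assume "\<not> (\<exists>i<n. s * w i < \<bar>u i\<bar>)"
      then have us: "\<bar>u i\<bar> \<le> s * w i" if "i < n" for i using that by force
      \<comment> \<open>The coefficients have the same \<open>l2\<close> norm as \<open>u\<close>,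
        whose coordinates are at most 2; this is what confines them to a bounded box.\<close>
      have cj: "\<bar>c j\<bar> \<le> 2 * real n" if "j \<in> J" for j
      proof -
        have "(c j)\<^sup>2 \<le> (\<Sum>j\<in>J. (c j)\<^sup>2)" using fin that by (intro member_le_sum) auto
        also have "\<dots> = dotp n u u" unfolding u_def by (rule orthonormal_norm[OF on, symmetric])
        also have "\<dots> \<le> (\<Sum>i<n. 4)"
          unfolding dotp_def
        proof (rule sum_mono)
          fix i assume "i \<in> {..<n}"
          then have "\<bar>u i\<bar>\<^sup>2 \<le> 2\<^sup>2" using u2 by (intro power_mono) auto
          then show "u i * u i \<le> 4" by (simp add: power2_eq_square)
        qed
        also have "\<dots> \<le> (2 * real n)\<^sup>2" using n by (simp add: power2_eq_square mult_left_mono)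
        finally show ?thesis using abs_le_square_iff[of "c j" "2 * real n"] by simp
      qed
      define k where "k = (\<lambda>j\<in>J. \<lfloor>c j * real P\<rfloor>)"
      have kc: "\<bar>c j - real_of_int (k j) / real P\<bar> \<le> 1 / real P" if "j \<in> J" for j
      proof -
        have "\<bar>c j * real P - real_of_int (k j)\<bar> \<le> 1" unfolding k_def using that by simp linarith
        then have "\<bar>c j * real P - real_of_int (k j)\<bar> / real P \<le> 1 / real P" by (intro divide_right_mono) auto
        moreover have "\<bar>c j * real P - real_of_int (k j)\<bar> / real P = \<bar>(c j * real P - real_of_int (k j)) / real P\<bar>" by simp
        moreover have "(c j * real P - real_of_int (k j)) / real P = c j - real_of_int (k j) / real P"
          using P0 by (simp add: diff_divide_distrib)
        ultimately show ?thesis by simp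
      qed
      have kL: "k \<in> PiE J (\<lambda>_. {-L..L})"
      proof (rule PiE_I)
        fix j assume j: "j \<in> J"
        have "\<bar>c j * real P\<bar> \<le> 2 * real n * real P" using cj[OF j] by (simp add: abs_mult mult_right_mono)
        then have "\<bar>c j * real P\<bar> \<le> real_of_int (2 * int n * int P)" by simp
        then have "\<lfloor>c j * real P\<rfloor> \<le> 2 * int n * int P" "- (2 * int n * int P) - 1 \<le> \<lfloor>c j * real P\<rfloor>"
          by linarith+
        then show "k j \<in> {-L..L}" using j by (simp add: k_def L_def)
      qed (simp add: k_def)
      have uy: "\<bar>u i - y k i\<bar> \<le> \<gamma>" if "i < n" for i
      proof -
        have "u i - y k i = (\<Sum>j\<in>J. (c j - real_of_int (k j) / real P) * e j i)"
          by (simp add: u_def y_def left_diff_distrib sum_subtractf)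
        also have "\<bar>\<dots>\<bar> \<le> (\<Sum>j\<in>J. \<bar>(c j - real_of_int (k j) / real P) * e j i\<bar>)" by (rule sum_abs)
        also have "\<dots> \<le> (\<Sum>j\<in>J. 1 / real P * 1)"
          unfolding abs_mult using kc e1[OF _ that] by (intro sum_mono mult_mono) auto
        also have "\<dots> \<le> \<gamma>" using r by (simp add: \<gamma>_def r_def divide_right_mono)
        finally show ?thesis .
      qed
      have "k \<in> N"
      proof -
        \<comment> \<open>Doubling the argument absorbs the rounding of a coordinate above
          \<open>2 * \<gamma>\<close>, and a smaller one has \<open>G\<close> at most
          \<open>2 * \<gamma>\<close>. The total loss is at most \<open>1/2\<close>, so mass
          \<open>1/2\<close> remains at the grid point.\<close>
        have "G \<bar>u i\<bar> \<le> G (2 * \<bar>y k i\<bar>) + 2 * \<gamma>" if "i < n" for i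
        proof (cases "\<bar>u i\<bar> \<le> 2 * \<gamma>")
          case True
          have "real n * 2 \<le> real n * (4 * real n)" using n by simp
          then have "\<gamma> \<le> 1/2" using Pn P0 by (simp add: \<gamma>_def divide_le_eq)
          then have "G \<bar>u i\<bar> \<le> \<bar>u i\<bar>" using True by (intro G_le_self) auto
          then show ?thesis using True G_nonneg[of "2 * \<bar>y k i\<bar>"] by linarith
        next
          case False
          then have "\<bar>u i\<bar> \<le> 2 * \<bar>y k i\<bar>" using uy[OF that] by linarith
          then have "G \<bar>u i\<bar> \<le> G (2 * \<bar>y k i\<bar>)" by (intro G_mono) auto
          then show ?thesis by (simp add: \<gamma>_def add_increasing2)
        qed
        then have "(\<Sum>i<n. G \<bar>u i\<bar>) \<le> (\<Sum>i<n. G (2 * \<bar>y k i\<bar>) + 2 * \<gamma>)" by (intro sum_mono) auto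
        also have "\<dots> = (\<Sum>i<n. G (2 * \<bar>y k i\<bar>)) + real n * (2 * \<gamma>)" by (simp add: sum.distrib)
        also have "real n * (2 * \<gamma>) \<le> 1/2" using Pn P0 by (simp add: \<gamma>_def divide_le_eq mult_ac)
        finally show ?thesis using uG kL by (simp add: N_def)
      qed
      moreover have "\<bar>y k i\<bar> / (2 * s) \<le> w i" if "i < n" for i
      proof -
        have "\<bar>y k i\<bar> \<le> s * w i + \<gamma>" using uy[OF that] us[OF that] by linarith
        also have "\<gamma> = s * \<tau>" using s0 by (simp add: \<tau>_def)
        also have "s * \<tau> \<le> s * w i" using s0 w\<tau>[OF that] by simp
        finally show ?thesis using s0 by (simp add: divide_le_eq mult_ac)
      qed
      ultimately have "w \<in> B1" using w by (auto simp: B1_def)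
      then show False using w by simp
    qed
    then show "\<exists>i<n. w i / (480 * real (card J) * ln (real n)) < \<bar>\<Sum>j\<in>J. c j * e j i\<bar>"
      by (simp add: s_def u_def mult.commute)
  qed
  moreover have "measure (weights n) (B1 \<union> B2) \<le> 1/50 + 1/50"
    by (rule prob_Un_le[OF prob_space_weights B1 B2 p1 p2])
  ultimately show ?thesis using B1 B2 by (intro bexI[of _ "B1 \<union> B2"]) auto
qed

end

section \<open>The Gaussian matrix\<close>

abbreviation std_gauss :: "real measure" where
  "std_gauss \<equiv> density lborel (\<lambda>x. ennreal (std_normal_density x))"

definition gauss :: "nat \<Rightarrow> nat \<Rightarrow> (nat \<times> nat \<Rightarrow> real) measure" where
  "gauss m t = PiM ({..<m} \<times> {..<t}) (\<lambda>_. std_gauss)"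

lemma prob_space_std_gauss: "prob_space std_gauss"
  by (rule prob_space_normal_density) simp

lemma prob_space_gauss: "prob_space (gauss m t)"
  unfolding gauss_def by (intro prob_space_PiM prob_space_std_gauss)

lemma indep_vars_PiM_coordinates:
  assumes M: "\<And>i. i \<in> I \<Longrightarrow> prob_space (M i)" and I: "I \<noteq> {}"
  shows "prob_space.indep_vars (PiM I M) M (\<lambda>i \<omega>. \<omega> i) I"
proof -
  \<comment> \<open>The locale of product probability spaces asks for a probability space at every
    index; outside \<open>I\<close> a point mass is substituted.\<close>
  define M' where "M' i = (if i \<in> I then M i else return (count_space UNIV) undefined)" for i
  have PP: "PiM I M = PiM I M'" by (rule PiM_cong) (simp_all add: M'_def)
  have pM': "prob_space (M' i)" for i
    using M by (auto simp: M'_def intro!: prob_space_return)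
  interpret product_prob_space M' I
    by (simp add: product_prob_space_def product_prob_space_axioms_def product_sigma_finite_def
      pM' prob_space_imp_sigma_finite)
  have "distr (PiM I M') (PiM I M') (\<lambda>x. \<lambda>i\<in>I. x i) = distr (PiM I M') (PiM I M') (\<lambda>x. x)"
    by (rule distr_cong) (auto simp: space_PiM PiE_restrict)
  then have "P.indep_vars M' (\<lambda>i \<omega>. \<omega> i) I"
    using I by (subst P.indep_vars_iff_distr_eq_PiM') (auto simp: PiM_component intro!: PiM_cong)
  then show ?thesis unfolding PP by (subst P.indep_vars_cong[OF refl refl, of I M M']) (auto simp: M'_def)
qed

lemma measurable_gauss_coord:
  assumes "p \<in> {..<m} \<times> {..<t}"
  shows "(\<lambda>g. g p) \<in> borel_measurable (gauss m t)"
  using measurable_component_singleton[OF assms, of "\<lambda>_. std_gauss"]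
  by (simp add: gauss_def cong: measurable_cong_sets)

lemma indep_vars_gauss:
  assumes "I \<subseteq> {..<m} \<times> {..<t}" "I \<noteq> {}"
  shows "prob_space.indep_vars (gauss m t) (\<lambda>_. borel) (\<lambda>p g. g p) I"
proof -
  interpret prob_space "gauss m t" by (rule prob_space_gauss)
  have "indep_vars (\<lambda>_. std_gauss) (\<lambda>p g. g p) ({..<m} \<times> {..<t})"
    unfolding gauss_def using assms by (intro indep_vars_PiM_coordinates prob_space_std_gauss) auto
  then have "indep_vars (\<lambda>_. std_gauss) (\<lambda>p g. g p) I"
    by (rule indep_vars_subset) (rule assms)
  then show ?thesis
    by (rule indep_vars_compose2[where Y = "\<lambda>_ x. x"]) simp
qed

lemma distributed_gauss_coord:
  assumes "p \<in> {..<m} \<times> {..<t}"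
  shows "distributed (gauss m t) lborel (\<lambda>g. g p) (\<lambda>x. ennreal (std_normal_density x))"
proof -
  interpret product_prob_space "\<lambda>_. std_gauss" "{..<m} \<times> {..<t}"
    by (simp add: product_prob_space_def product_prob_space_axioms_def product_sigma_finite_def
      prob_space_std_gauss prob_space_imp_sigma_finite)
  have "distr (gauss m t) lborel (\<lambda>g. g p) = distr (gauss m t) std_gauss (\<lambda>g. g p)"
    by (rule distr_cong) auto
  also have "\<dots> = std_gauss" unfolding gauss_def using assms by (rule PiM_component)
  finally show ?thesis
    using measurable_gauss_coord[OF assms] by (simp add: distributed_def)
qed

text \<open>Rotation invariance of the Gaussian law: the variance of the combination is the squared
  norm of \<open>z\<close>.\<close>

lemma distributed_gauss_row:
  assumes k: "k < m" and z: "(\<Sum>r<t. (z r)\<^sup>2) = 1"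
  shows "distributed (gauss m t) lborel (\<lambda>g. \<Sum>r<t. g (k, r) * z r) (\<lambda>x. ennreal (std_normal_density x))"
proof -
  interpret prob_space "gauss m t" by (rule prob_space_gauss)
  \<comment> \<open>A summand with coefficient 0 has no normal density, so the sum is taken over the
    support of \<open>z\<close>; it is nonempty because \<open>z\<close> has norm 1.\<close>
  define R where "R = {r. r < t \<and> z r \<noteq> 0}"
  have R: "finite R" "R \<subseteq> {..<t}" by (auto simp: R_def)
  have sumR: "(\<Sum>r\<in>R. f r) = (\<Sum>r<t. f r)" if "\<And>r. r < t \<Longrightarrow> z r = 0 \<Longrightarrow> f r = 0" for f :: "nat \<Rightarrow> real"
    using R that by (intro sum.mono_neutral_left) (auto simp: R_def)
  have "(\<Sum>r\<in>R. (z r)\<^sup>2) = 1" using sumR[of "\<lambda>r. (z r)\<^sup>2"] z by simp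
  then have ne: "R \<noteq> {}" by auto
  define X where "X p = (\<lambda>g. 0 + z (snd p) * g p)" for p :: "nat \<times> nat"
  let ?P = "Pair k ` R"
  have "indep_vars (\<lambda>_. borel) (\<lambda>p g. g p) ?P"
    using ne R k by (intro indep_vars_gauss) auto
  then have ind: "indep_vars (\<lambda>_. borel) X ?P"
    unfolding X_def by (rule indep_vars_compose2) simp
  have dist: "distributed (gauss m t) lborel (X p) (\<lambda>x. ennreal (normal_density 0 \<bar>z (snd p)\<bar> x))" if "p \<in> ?P" for p
  proof -
    from that obtain r where p: "p = (k, r)" "r < t" "z r \<noteq> 0" by (auto simp: R_def)
    have pin: "p \<in> {..<m} \<times> {..<t}" and nz: "z (snd p) \<noteq> 0" using p k by simp_all
    have "distributed (gauss m t) lborel (\<lambda>g. 0 + z (snd p) * g p)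
        (\<lambda>x. ennreal (normal_density (0 + z (snd p) * 0) (\<bar>z (snd p)\<bar> * 1) x))"
    proof (rule normal_density_affine[where X = "\<lambda>g. g p" and \<mu> = 0 and \<sigma> = 1 and \<alpha> = "z (snd p)" and \<beta> = 0])
      show "distributed (gauss m t) lborel (\<lambda>g. g p) (\<lambda>x. ennreal (std_normal_density x))"
        by (rule distributed_gauss_coord[OF pin])
      show "(0 :: real) < 1" by simp
    qed (rule nz)
    then show ?thesis unfolding X_def by (simp only: mult_zero_right add_0_left mult_1_right)
  qed
  have "distributed (gauss m t) lborel (\<lambda>g. \<Sum>p\<in>?P. X p g)
     (\<lambda>x. ennreal (normal_density (\<Sum>p\<in>?P. 0) (sqrt (\<Sum>p\<in>?P. \<bar>z (snd p)\<bar>\<^sup>2)) x))"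
  proof (rule sum_indep_normal[where X = X and \<mu> = "\<lambda>_. 0" and \<sigma> = "\<lambda>p. \<bar>z (snd p)\<bar>" and I = ?P])
    show "finite ?P" "?P \<noteq> {}" using R(1) ne by simp_all
    show "0 < \<bar>z (snd p)\<bar>" if "p \<in> ?P" for p using that by (auto simp: R_def)
  qed (fact ind dist)+
  also have "(\<lambda>g. \<Sum>p\<in>?P. X p g) = (\<lambda>g. \<Sum>r<t. g (k, r) * z r)"
  proof
    fix g
    have "(\<Sum>p\<in>?P. X p g) = (\<Sum>r\<in>R. g (k, r) * z r)"
      by (subst sum.reindex) (auto simp: X_def inj_on_def mult.commute)
    then show "(\<Sum>p\<in>?P. X p g) = (\<Sum>r<t. g (k, r) * z r)" using sumR[of "\<lambda>r. g (k, r) * z r"] by simp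
  qed
  also have "(\<Sum>p\<in>?P. \<bar>z (snd p)\<bar>\<^sup>2) = 1"
    using \<open>(\<Sum>r\<in>R. (z r)\<^sup>2) = 1\<close> by (subst sum.reindex) (auto simp: inj_on_def)
  finally show ?thesis by simp
qed

section \<open>Moment generating function and tails of the Gaussian form\<close>

lemma nn_integral_exp_square_normal:
  assumes a: "a < 1/2"
  shows "(\<integral>\<^sup>+x. ennreal (std_normal_density x) * ennreal (exp (a * x\<^sup>2)) \<partial>lborel) = ennreal (1 / sqrt (1 - 2 * a))"
proof -
  \<comment> \<open>The product of the two exponentials is again a normal density, with standard
    deviation \<open>\<sigma>\<close>, up to the factor \<open>\<sigma>\<close>. Negative
    \<open>a\<close> is allowed and serves the lower tail.\<close>
  define \<sigma> where "\<sigma> = 1 / sqrt (1 - 2 * a)"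
  have \<sigma>: "\<sigma> > 0" using a by (simp add: \<sigma>_def)
  have s2: "\<sigma>\<^sup>2 = 1 / (1 - 2 * a)" using a by (simp add: \<sigma>_def power_divide)
  have eq: "std_normal_density x * exp (a * x\<^sup>2) = \<sigma> * normal_density 0 \<sigma> x" for x
  proof -
    have e: "exp (- x\<^sup>2 / 2) * exp (a * x\<^sup>2) = exp (- x\<^sup>2 / (2 * \<sigma>\<^sup>2))"
      unfolding exp_add[symmetric] s2 using a by (simp add: field_simps)
    have "sqrt (2 * pi * \<sigma>\<^sup>2) = sqrt (2 * pi) * \<sigma>" using \<sigma> by (simp add: real_sqrt_mult)
    then show ?thesis
      using e \<sigma> by (simp add: normal_density_def)
  qed
  interpret N: prob_space "density lborel (\<lambda>x. ennreal (normal_density 0 \<sigma> x))"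
    by (rule prob_space_normal_density[OF \<sigma>])
  have "(\<integral>\<^sup>+x. ennreal (std_normal_density x) * ennreal (exp (a * x\<^sup>2)) \<partial>lborel) =
      (\<integral>\<^sup>+x. ennreal \<sigma> * ennreal (normal_density 0 \<sigma> x) \<partial>lborel)"
    using eq \<sigma> by (intro nn_integral_cong) (simp add: ennreal_mult[symmetric])
  also have "\<dots> = ennreal \<sigma> * (\<integral>\<^sup>+x. ennreal (normal_density 0 \<sigma> x) \<partial>lborel)"
    by (rule nn_integral_cmult) simp
  also have "(\<integral>\<^sup>+x. ennreal (normal_density 0 \<sigma> x) \<partial>lborel) = 1"
    using N.emeasure_space_1 by (simp add: emeasure_density)
  finally show ?thesis by (simp add: \<sigma>_def)
qed

text \<open>The Gaussian entries are unscaled here, so the mean is \<open>m\<close> times the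
  squared norm of \<open>z\<close>; the scaling by \<open>1 / sqrt t2\<close> returns in
  \<open>gauss_form_eq_gaussed\<close>.\<close>

definition gauss_form :: "nat \<Rightarrow> nat \<Rightarrow> (nat \<Rightarrow> real) \<Rightarrow> (nat \<times> nat \<Rightarrow> real) \<Rightarrow> real" where
  "gauss_form m t z g = (\<Sum>k<m. (\<Sum>r<t. g (k, r) * z r)\<^sup>2)"

lemma measurable_gauss_form [measurable]: "gauss_form m t z \<in> borel_measurable (gauss m t)"
  unfolding gauss_form_def
  by (intro borel_measurable_sum borel_measurable_power borel_measurable_times measurable_gauss_coord borel_measurable_const) auto

lemma gauss_form_nonneg: "0 \<le> gauss_form m t z g"
  by (simp add: gauss_form_def sum_nonneg)

lemma gauss_form_mgf:
  assumes z: "(\<Sum>r<t. (z r)\<^sup>2) = 1" and a: "a < 1/2"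
  shows "(\<integral>\<^sup>+g. ennreal (exp (a * gauss_form m t z g)) \<partial>gauss m t) = ennreal ((1 / sqrt (1 - 2 * a)) ^ m)"
proof -
  interpret prob_space "gauss m t" by (rule prob_space_gauss)
  have t: "t > 0" using z by (cases t) auto
  define f where "f k v = ennreal (exp (a * (\<Sum>r<t. v (k, r) * z r)\<^sup>2))" for k and v :: "nat \<times> nat \<Rightarrow> real"
  have one: "(\<integral>\<^sup>+g. f k g \<partial>gauss m t) = ennreal (1 / sqrt (1 - 2 * a))" if "k < m" for k
    using distributed_nn_integral[OF distributed_gauss_row[OF that z], of "\<lambda>x. ennreal (exp (a * x\<^sup>2))"]
      nn_integral_exp_square_normal[OF a] by (simp add: f_def)
  have ind: "indep_vars (\<lambda>_. borel) f {..<m}" if "m > 0"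
  proof -
    have "indep_vars (\<lambda>_. borel) (\<lambda>p g. g p) ({..<m} \<times> {..<t})"
      using t that by (intro indep_vars_gauss) auto
    then have "indep_vars (\<lambda>k. PiM ({k} \<times> {..<t}) (\<lambda>_. borel)) (\<lambda>k g. \<lambda>p\<in>{k} \<times> {..<t}. g p) {..<m}"
      by (rule indep_vars_restrict) (auto simp: disjoint_family_on_def)
    then have "indep_vars (\<lambda>_. borel) (\<lambda>k g. f k (\<lambda>p\<in>{k} \<times> {..<t}. g p)) {..<m}"
    proof (rule indep_vars_compose2)
      fix k assume "k \<in> {..<m}"
      show "f k \<in> borel_measurable (PiM ({k} \<times> {..<t}) (\<lambda>_. borel))"
        unfolding f_def
        by (intro measurable_compose[OF _ measurable_ennreal] borel_measurable_exp[THEN measurable_compose[rotated]]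
            borel_measurable_sum borel_measurable_power borel_measurable_times measurable_component_singleton borel_measurable_const) auto
    qed
    moreover have "f k (\<lambda>p\<in>{k} \<times> {..<t}. g p) = f k g" for k g by (simp add: f_def)
    ultimately show ?thesis by simp
  qed
  have "ennreal (exp (a * gauss_form m t z g)) = (\<Prod>k<m. f k g)" for g
    by (simp add: f_def gauss_form_def sum_distrib_left exp_sum prod_ennreal)
  then have "(\<integral>\<^sup>+g. ennreal (exp (a * gauss_form m t z g)) \<partial>gauss m t) = (\<integral>\<^sup>+g. (\<Prod>k<m. f k g) \<partial>gauss m t)"
    by simp
  also have "\<dots> = (\<Prod>k<m. \<integral>\<^sup>+g. f k g \<partial>gauss m t)"
    using ind by (cases "m > 0") (auto intro: indep_vars_nn_integral simp: prob_space.emeasure_space_1[OF prob_space_gauss])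
  also have "\<dots> = ennreal ((1 / sqrt (1 - 2 * a)) ^ m)"
    using a by (simp add: one ennreal_power[symmetric])
  finally show ?thesis .
qed

text \<open>Markov's inequality for the exponential. The sign of \<open>a\<close> selects the tail,
  and condition \<open>b\<close> asks each of the \<open>m\<close> rows for a factor
  \<open>1/2\<close>, so the failure probability can be set against the size of a net.\<close>

lemma gauss_form_chernoff:
  assumes z: "(\<Sum>r<t. (z r)\<^sup>2) = 1" and a: "a < 1/2"
    and b: "exp (- \<theta>) * (1 / sqrt (1 - 2 * a)) \<le> 1/2"
  shows "measure (gauss m t) {g \<in> space (gauss m t). real m * \<theta> \<le> a * gauss_form m t z g} \<le> (1/2) ^ m"
proof -
  interpret prob_space "gauss m t" by (rule prob_space_gauss)
  let ?S = "{g \<in> space (gauss m t). real m * \<theta> \<le> a * gauss_form m t z g}"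
  have S: "?S \<in> events" by measurable
  have "emeasure (gauss m t) ?S \<le> (\<integral>\<^sup>+g. ennreal (exp (- (real m * \<theta>))) * ennreal (exp (a * gauss_form m t z g)) \<partial>gauss m t)"
    unfolding nn_integral_indicator[OF S, symmetric]
  proof (rule nn_integral_mono)
    fix g assume "g \<in> space (gauss m t)"
    show "indicator ?S g \<le> ennreal (exp (- (real m * \<theta>))) * ennreal (exp (a * gauss_form m t z g))"
    proof (cases "g \<in> ?S")
      case True
      then have "1 \<le> exp (- (real m * \<theta>)) * exp (a * gauss_form m t z g)"
        by (simp add: exp_add[symmetric])
      then show ?thesis using True by (simp add: ennreal_mult[symmetric])
    qed simp
  qed
  also have "\<dots> = ennreal (exp (- (real m * \<theta>))) * ennreal ((1 / sqrt (1 - 2 * a)) ^ m)"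
    by (subst nn_integral_cmult) (simp_all add: gauss_form_mgf[OF z a])
  also have "\<dots> = ennreal ((exp (- \<theta>) * (1 / sqrt (1 - 2 * a))) ^ m)"
    using a exp_of_nat_mult[of m "- \<theta>"] by (simp add: ennreal_mult[symmetric] power_mult_distrib[symmetric] power_divide del: power_mult_distrib)
  also have "\<dots> \<le> ennreal ((1/2) ^ m)"
    using b a by (intro ennreal_leI power_mono) auto
  finally show ?thesis by (simp add: emeasure_eq_measure)
qed

lemma gauss_form_scale: "gauss_form m t (\<lambda>r. c * z r) g = c\<^sup>2 * gauss_form m t z g"
proof -
  have "(\<Sum>r<t. g (k, r) * (c * z r)) = c * (\<Sum>r<t. g (k, r) * z r)" for k
    by (simp add: sum_distrib_left mult_ac)
  then have "gauss_form m t (\<lambda>r. c * z r) g = (\<Sum>k<m. (c * (\<Sum>r<t. g (k, r) * z r))\<^sup>2)"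
    by (simp only: gauss_form_def)
  also have "\<dots> = c\<^sup>2 * gauss_form m t z g"
    unfolding gauss_form_def sum_distrib_left[of "c\<^sup>2"] power_mult_distrib ..
  finally show ?thesis .
qed

lemma gauss_form_normalize:
  assumes "dotp t z z > 0"
  obtains u where "(\<Sum>r<t. (u r)\<^sup>2) = 1" "\<And>m g. gauss_form m t z g = dotp t z z * gauss_form m t u g"
proof
  let ?s = "sqrt (dotp t z z)"
  let ?u = "\<lambda>r. z r / ?s"
  show "(\<Sum>r<t. (?u r)\<^sup>2) = 1"
    using assms by (simp add: power_divide sum_divide_distrib[symmetric] dotp_def power2_eq_square[symmetric] sum_nonneg)
  have "z = (\<lambda>r. ?s * ?u r)" using assms by auto
  then have "gauss_form m t z g = ?s\<^sup>2 * gauss_form m t ?u g" for m g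
    using gauss_form_scale[of m t ?s ?u g] by simp
  then show "gauss_form m t z g = dotp t z z * gauss_form m t ?u g" for m g
    using assms by simp
qed

lemma gauss_form_zero: "dotp t z z = 0 \<Longrightarrow> gauss_form m t z g = 0"
  using dotp_self_eq_0[of t z] by (simp add: gauss_form_def)

text \<open>\<open>a = 1/4\<close> and \<open>\<theta> = 2\<close>: the factor per row is
  \<open>exp (-2) * sqrt 2\<close>, and \<open>8 = \<theta> / a\<close>. For \<open>z = 0\<close>
  the event is empty since the inequality is strict.\<close>

lemma gauss_form_upper:
  "measure (gauss m t) {g \<in> space (gauss m t). 8 * real m * dotp t z z < gauss_form m t z g} \<le> (1/2) ^ m"
proof (cases "dotp t z z = 0")
  case True
  then show ?thesis by (simp add: gauss_form_zero)
next
  case False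
  then have pos: "dotp t z z > 0" using dotp_nonneg[of t z] by simp
  then obtain u where u: "(\<Sum>r<t. (u r)\<^sup>2) = 1" "\<And>g. gauss_form m t z g = dotp t z z * gauss_form m t u g"
    using gauss_form_normalize by metis
  interpret prob_space "gauss m t" by (rule prob_space_gauss)
  have e2: "4 \<le> exp (2 :: real)"
  proof -
    have "(2 :: real) * 2 \<le> exp 1 * exp 1" using exp_ge_add_one_self[of 1] by (intro mult_mono) auto
    also have "\<dots> = exp 2" by (simp add: exp_add[symmetric])
    finally show ?thesis by simp
  qed
  have "sqrt 2 \<le> (2 :: real)" by (simp add: real_le_lsqrt)
  then have b: "exp (- 2) * (1 / sqrt (1 - 2 * (1/4))) \<le> (1/2 :: real)"
    using e2 by (simp add: exp_minus real_sqrt_divide field_simps)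
  have "prob {g \<in> space (gauss m t). 8 * real m * dotp t z z < gauss_form m t z g} \<le>
      prob {g \<in> space (gauss m t). real m * 2 \<le> 1/4 * gauss_form m t u g}"
    using pos by (intro finite_measure_mono) (auto simp: u(2) mult_ac)
  also have "\<dots> \<le> (1/2) ^ m" by (rule gauss_form_chernoff[OF u(1) _ b]) simp
  finally show ?thesis .
qed

text \<open>\<open>a = -6\<close> and \<open>\<theta> = -1/2\<close>: the factor per row is
  \<open>exp (1/2) / sqrt 13\<close>, and \<open>1/12 = \<theta> / a\<close>.\<close>

lemma gauss_form_lower:
  "measure (gauss m t) {g \<in> space (gauss m t). gauss_form m t z g < real m / 12 * dotp t z z} \<le> (1/2) ^ m"
proof (cases "dotp t z z = 0")
  case True
  then show ?thesis by (simp add: gauss_form_zero)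
next
  case False
  then have pos: "dotp t z z > 0" using dotp_nonneg[of t z] by simp
  then obtain u where u: "(\<Sum>r<t. (u r)\<^sup>2) = 1" "\<And>g. gauss_form m t z g = dotp t z z * gauss_form m t u g"
    using gauss_form_normalize by metis
  interpret prob_space "gauss m t" by (rule prob_space_gauss)
  have "exp (1/2) \<le> sqrt (3 :: real)"
  proof (rule real_le_rsqrt)
    have "(exp (1/2))\<^sup>2 = exp (1 :: real)" by (simp add: power2_eq_square exp_add[symmetric])
    then show "(exp (1/2))\<^sup>2 \<le> (3 :: real)" using exp_le by simp
  qed
  moreover have "2 * sqrt 3 \<le> sqrt (13 :: real)" by (rule real_le_rsqrt) (simp add: power_mult_distrib)
  ultimately have b: "exp (- (- (1/2))) * (1 / sqrt (1 - 2 * (- 6))) \<le> (1/2 :: real)"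
    by (simp add: field_simps)
  have "prob {g \<in> space (gauss m t). gauss_form m t z g < real m / 12 * dotp t z z} \<le>
      prob {g \<in> space (gauss m t). real m * (- (1/2)) \<le> (- 6) * gauss_form m t u g}"
    using pos by (intro finite_measure_mono) (auto simp: u(2) mult_ac)
  also have "\<dots> \<le> (1/2) ^ m" by (rule gauss_form_chernoff[OF u(1) _ b]) simp
  finally show ?thesis .
qed

text \<open>Weight the points of the box by \<open>2 ^ T * (\<Prod>j\<in>J. (1/2) ^ \<bar>k j\<bar>)\<close>, which is at least \<open>1\<close> on the ball;
  the total weight factorizes.\<close>

lemma card_lattice_ball:
  fixes H :: int
  assumes J: "finite J"
  shows "real (card {k \<in> PiE J (\<lambda>_. {-H..H}). (\<Sum>j\<in>J. (k j)\<^sup>2) \<le> int T}) \<le> 2 ^ T * 4 ^ card J"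
proof -
  let ?K = "PiE J (\<lambda>_. {-H..H})"
  let ?N = "{k \<in> ?K. (\<Sum>j\<in>J. (k j)\<^sup>2) \<le> int T}"
  have K: "finite ?K" using J by (intro finite_PiE) auto
  have one: "1 \<le> 2 ^ T * (\<Prod>j\<in>J. (1/2 :: real) ^ nat \<bar>k j\<bar>)" if "k \<in> ?N" for k
  proof -
    have "int (\<Sum>j\<in>J. nat \<bar>k j\<bar>) = (\<Sum>j\<in>J. \<bar>k j\<bar>)" by simp
    also have "\<dots> \<le> (\<Sum>j\<in>J. (k j)\<^sup>2)"
    proof (rule sum_mono)
      fix j
      show "\<bar>k j\<bar> \<le> (k j)\<^sup>2"
        using self_le_power[of "\<bar>k j\<bar>" 2] by (cases "k j = 0") auto
    qed
    also have "\<dots> \<le> int T" using that by simp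
    finally have le: "(\<Sum>j\<in>J. nat \<bar>k j\<bar>) \<le> T" by (simp only: of_nat_le_iff)
    have "1 = 2 ^ T * (1/2 :: real) ^ T" by (simp add: power_mult_distrib[symmetric])
    also have "\<dots> \<le> 2 ^ T * (1/2) ^ (\<Sum>j\<in>J. nat \<bar>k j\<bar>)"
      using le by (intro mult_left_mono power_decreasing) auto
    finally show ?thesis by (simp add: power_sum)
  qed
  \<comment> \<open>A two-sided geometric series; this is the factor 4 per coordinate.\<close>
  have two: "(\<Sum>i\<in>{-H..H}. (1/2 :: real) ^ nat \<bar>i\<bar>) \<le> 4"
  proof -
    have g: "(\<Sum>i\<le>N. (1/2 :: real) ^ i) \<le> 2" for N :: nat
    proof -
      have "(\<Sum>i\<le>N. (1/2 :: real) ^ i) = 2 - (1/2) ^ N" by (induction N) auto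
      then show ?thesis by simp
    qed
    let ?f = "\<lambda>i :: int. (1/2 :: real) ^ nat \<bar>i\<bar>"
    let ?A = "int ` {..nat H}" and ?B = "(\<lambda>i. - int i) ` {..nat H}"
    have sub: "{-H..H} \<subseteq> ?A \<union> ?B"
    proof
      fix i assume i: "i \<in> {-H..H}"
      show "i \<in> ?A \<union> ?B"
      proof (cases "i \<ge> 0")
        case True
        then have "i = int (nat i)" "nat i \<in> {..nat H}" using i by auto
        then show ?thesis by blast
      next
        case False
        then have "i = - int (nat (- i))" "nat (- i) \<in> {..nat H}" using i by auto
        then show ?thesis by blast
      qed
    qed
    have "sum ?f {-H..H} \<le> sum ?f (?A \<union> ?B)" by (rule sum_mono2[OF _ sub]) auto
    also have "\<dots> \<le> sum ?f ?A + sum ?f ?B"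
      using sum.union_inter[of ?A ?B ?f] sum_nonneg[of "?A \<inter> ?B" ?f] by simp
    also have "sum ?f ?A = (\<Sum>i\<le>nat H. (1/2) ^ i)" by (subst sum.reindex) (auto simp: inj_on_def)
    also have "sum ?f ?B = (\<Sum>i\<le>nat H. (1/2) ^ i)" by (subst sum.reindex) (auto simp: inj_on_def)
    finally show ?thesis using g[of "nat H"] by simp
  qed
  have "real (card ?N) = (\<Sum>k\<in>?N. 1)" by simp
  also have "\<dots> \<le> (\<Sum>k\<in>?N. 2 ^ T * (\<Prod>j\<in>J. (1/2) ^ nat \<bar>k j\<bar>))" using one by (rule sum_mono)
  also have "\<dots> \<le> (\<Sum>k\<in>?K. 2 ^ T * (\<Prod>j\<in>J. (1/2) ^ nat \<bar>k j\<bar>))"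
    using K by (intro sum_mono2) (auto intro!: mult_nonneg_nonneg prod_nonneg)
  also have "\<dots> = 2 ^ T * (\<Prod>j\<in>J. \<Sum>i\<in>{-H..H}. (1/2) ^ nat \<bar>i\<bar>)"
    using J by (subst prod_sum_PiE) (auto simp: sum_distrib_left)
  also have "\<dots> \<le> 2 ^ T * (\<Prod>j\<in>J. 4)"
    using two by (intro mult_left_mono prod_mono) (auto intro!: sum_nonneg)
  finally show ?thesis by simp
qed

text \<open>A convex function on a cube is maximal at a vertex.\<close>

lemma cube_vertex_bound:
  fixes a :: "'j \<Rightarrow> nat \<Rightarrow> real"
  assumes "finite J" "\<And>j. j \<in> J \<Longrightarrow> \<bar>c j\<bar> \<le> 1"
  shows "\<exists>s\<in>PiE J (\<lambda>_. {-1, 1}). (\<Sum>k<m. (u k + (\<Sum>j\<in>J. c j * a j k))\<^sup>2) \<le> (\<Sum>k<m. (u k + (\<Sum>j\<in>J. s j * a j k))\<^sup>2)"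
  using assms
proof (induction J arbitrary: u rule: finite_induct)
  case (insert j J)
  obtain s where s: "s \<in> PiE J (\<lambda>_. {-1, 1})"
    and le: "(\<Sum>k<m. ((u k + c j * a j k) + (\<Sum>j\<in>J. c j * a j k))\<^sup>2) \<le> (\<Sum>k<m. ((u k + c j * a j k) + (\<Sum>j\<in>J. s j * a j k))\<^sup>2)"
    using insert.IH[of "\<lambda>k. u k + c j * a j k"] insert.prems by auto
  define v where "v k = u k + (\<Sum>j\<in>J. s j * a j k)" for k
  define A B C where "A = (\<Sum>k<m. (v k)\<^sup>2)" and "B = (\<Sum>k<m. v k * a j k)" and "C = (\<Sum>k<m. (a j k)\<^sup>2)"
  have expand: "(\<Sum>k<m. (v k + x * a j k)\<^sup>2) = A + 2 * x * B + x\<^sup>2 * C" for x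
    by (simp add: A_def B_def C_def power2_eq_square algebra_simps sum.distrib sum_distrib_left)
  \<comment> \<open>Along coordinate \<open>j\<close> the sum of squares is a quadratic with leading
    coefficient \<open>C >= 0\<close>, so the endpoint on the side given by the sign of
    \<open>B\<close> does at least as well as \<open>c j\<close>.\<close>
  define \<sigma> :: real where "\<sigma> = (if B \<ge> 0 then 1 else -1)"
  have "c j * B \<le> \<bar>c j\<bar> * \<bar>B\<bar>" by (metis abs_ge_self abs_mult)
  also have "\<dots> \<le> 1 * \<bar>B\<bar>" using insert.prems by (intro mult_right_mono) auto
  also have "\<dots> = \<sigma> * B" by (simp add: \<sigma>_def)
  finally have 1: "c j * B \<le> \<sigma> * B" .
  have "\<bar>c j\<bar>\<^sup>2 \<le> 1" using insert.prems by (intro power_le_one) auto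
  then have 2: "(c j)\<^sup>2 * C \<le> \<sigma>\<^sup>2 * C" by (intro mult_right_mono) (auto simp: \<sigma>_def C_def sum_nonneg)
  have "(\<Sum>k<m. (u k + (\<Sum>j\<in>insert j J. c j * a j k))\<^sup>2) = (\<Sum>k<m. ((u k + c j * a j k) + (\<Sum>j\<in>J. c j * a j k))\<^sup>2)"
    using insert.hyps by (simp add: add.assoc)
  also have "\<dots> \<le> (\<Sum>k<m. (v k + c j * a j k)\<^sup>2)" using le by (simp add: v_def add_ac)
  also have "\<dots> \<le> (\<Sum>k<m. (v k + \<sigma> * a j k)\<^sup>2)" unfolding expand using 1 2 by simp
  also have "\<dots> = (\<Sum>k<m. (u k + (\<Sum>i\<in>insert j J. (s(j := \<sigma>)) i * a i k))\<^sup>2)"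
  proof -
    have "(\<Sum>i\<in>J. (if i = j then \<sigma> else s i) * a i k) = (\<Sum>i\<in>J. s i * a i k)" for k
      using insert.hyps by (intro sum.cong) auto
    then show ?thesis using insert.hyps by (simp add: v_def add_ac)
  qed
  finally show ?case using s insert.hyps
    by (intro bexI[of _ "s(j := \<sigma>)"]) (auto simp: \<sigma>_def PiE_iff extensional_def)
qed simp

section \<open>Subspace embedding by rounding to the lattice\<close>

definition lin_comb :: "nat set \<Rightarrow> (nat \<Rightarrow> nat \<Rightarrow> real) \<Rightarrow> (nat \<Rightarrow> real) \<Rightarrow> nat \<Rightarrow> real" where
  "lin_comb J e c i = (\<Sum>j\<in>J. c j * e j i)"

lemma dotp_lin_comb: "orthonormal n J e \<Longrightarrow> dotp n (lin_comb J e c) (lin_comb J e c) = (\<Sum>j\<in>J. (c j)\<^sup>2)"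
  using orthonormal_norm[of n J e c] unfolding lin_comb_def .

lemma gauss_form_L2: "sqrt (gauss_form m t z g) = L2_set (\<lambda>k. \<Sum>r<t. g (k, r) * z r) {..<m}"
  by (simp add: gauss_form_def L2_set_def)

lemma sqrt_gauss_form_add:
  "sqrt (gauss_form m t (\<lambda>r. y r + z r) g) \<le> sqrt (gauss_form m t y g) + sqrt (gauss_form m t z g)"
proof -
  have "(\<Sum>r<t. g (k, r) * (y r + z r)) = (\<Sum>r<t. g (k, r) * y r) + (\<Sum>r<t. g (k, r) * z r)" for k
    by (simp add: distrib_left sum.distrib)
  then show ?thesis unfolding gauss_form_L2 by (simp add: L2_set_triangle_ineq)
qed

lemma gauss_form_lin_comb:
  "gauss_form m t (lin_comb J e c) g = (\<Sum>k<m. (\<Sum>j\<in>J. c j * (\<Sum>r<t. g (k, r) * e j r))\<^sup>2)"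
proof -
  have "(\<Sum>r<t. g (k, r) * lin_comb J e c r) = (\<Sum>j\<in>J. c j * (\<Sum>r<t. g (k, r) * e j r))" for k
    unfolding lin_comb_def sum_distrib_left by (subst sum.swap) (simp add: mult_ac)
  then show ?thesis by (simp add: gauss_form_def)
qed

text \<open>Rounding towards zero never increases an absolute value. The lattice point thus stays in
  the ball whose points are counted, while the error stays in the unit cube.\<close>

lemma ex_lattice_rounding:
  fixes c :: "nat \<Rightarrow> real"
  assumes J: "finite J" and S: "(\<Sum>j\<in>J. (c j)\<^sup>2) = real T"
  obtains k where "k \<in> PiE J (\<lambda>_. {- int T..int T})" "(\<Sum>j\<in>J. (k j)\<^sup>2) \<le> int T"
    "\<And>j. j \<in> J \<Longrightarrow> \<bar>c j - real_of_int (k j)\<bar> \<le> 1"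
proof
  define k where "k = (\<lambda>j\<in>J. if c j \<ge> 0 then \<lfloor>c j\<rfloor> else \<lceil>c j\<rceil>)"
  have kc: "\<bar>real_of_int (k j)\<bar> \<le> \<bar>c j\<bar>" if "j \<in> J" for j
    using that by (auto simp: k_def)
  then have sq: "(real_of_int (k j))\<^sup>2 \<le> (c j)\<^sup>2" if "j \<in> J" for j
    using that by (simp add: abs_le_square_iff[symmetric])
  have "real_of_int (\<Sum>j\<in>J. (k j)\<^sup>2) \<le> (\<Sum>j\<in>J. (c j)\<^sup>2)" using sq by (simp add: sum_mono)
  then have "real_of_int (\<Sum>j\<in>J. (k j)\<^sup>2) \<le> real_of_int (int T)" using S by simp
  then show le: "(\<Sum>j\<in>J. (k j)\<^sup>2) \<le> int T" by (simp only: of_int_le_iff)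
  show "k \<in> PiE J (\<lambda>_. {- int T..int T})"
  proof (rule PiE_I)
    fix j assume "j \<in> J"
    have "\<bar>k j\<bar> \<le> (k j)\<^sup>2" using self_le_power[of "\<bar>k j\<bar>" 2] by (cases "k j = 0") auto
    also have "\<dots> \<le> (\<Sum>j\<in>J. (k j)\<^sup>2)" using J \<open>j \<in> J\<close> by (intro member_le_sum) auto
    finally show "k j \<in> {- int T..int T}" using le by auto
  qed (simp add: k_def)
  show "\<bar>c j - real_of_int (k j)\<bar> \<le> 1" if "j \<in> J" for j
    using that by (simp add: k_def) linarith
qed

text \<open>A vector of squared norm \<open>441 r\<close> is a lattice point plus an error in the unit cube.  A union
  bound over the lattice points controls the first part from below, and one over the
  vertices of the cube controls the second from above.\<close>

lemma gauss_embedding: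
  assumes on: "orthonormal t J e" and d: "card J \<le> d" "1 \<le> d" and m: "460 * d \<le> m"
  shows "\<exists>B\<in>sets (gauss m t). measure (gauss m t) B \<le> 1/50 \<and>
    (\<forall>g\<in>space (gauss m t) - B. \<forall>c. real m * (\<Sum>j\<in>J. (c j)\<^sup>2) \<le> 64 * gauss_form m t (lin_comb J e c) g)"
proof (cases "J = {}")
  case True
  then show ?thesis by (intro bexI[of _ "{}"]) (auto simp: gauss_form_nonneg)
next
  case False
  interpret prob_space "gauss m t" by (rule prob_space_gauss)
  have J: "finite J" using on by (simp add: orthonormal_def)
  define r where "r = card J"
  have r: "1 \<le> r" "r \<le> d" using False J d by (auto simp: r_def Suc_le_eq card_gt_0_iff)
  define T where "T = 441 * r"
  define N1 where "N1 = {k \<in> PiE J (\<lambda>_. {- int T..int T}). (\<Sum>j\<in>J. (k j)\<^sup>2) \<le> int T}"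
  define N2 where "N2 = PiE J (\<lambda>_. {-1, 1 :: real})"
  define ri where "ri k j = real_of_int (k j)" for k :: "nat \<Rightarrow> int" and j :: nat
  define B1 where "B1 = (\<Union>k\<in>N1. {g \<in> space (gauss m t). gauss_form m t (lin_comb J e (ri k)) g
      < real m / 12 * dotp t (lin_comb J e (ri k)) (lin_comb J e (ri k))})"
  define B2 where "B2 = (\<Union>s\<in>N2. {g \<in> space (gauss m t). 8 * real m * dotp t (lin_comb J e s) (lin_comb J e s)
      < gauss_form m t (lin_comb J e s) g})"
  have fin: "finite N1" "finite N2"
    unfolding N1_def N2_def using J by (auto intro!: finite_PiE intro: finite_subset[of _ "PiE J (\<lambda>_. {- int T..int T})"])
  have B1: "B1 \<in> events" unfolding B1_def by (intro sets.finite_UN fin) measurable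
  have B2: "B2 \<in> events" unfolding B2_def by (intro sets.finite_UN fin) measurable
  \<comment> \<open>\<open>443 = 441 + 2\<close>, since there are at most
    \<open>2 ^ (441 * r) * 4 ^ r\<close> lattice points. The other 17 rows give
    \<open>(1/2) ^ 17 <= 1/100\<close>, and \<open>443 * r + 17 <= 460 * d\<close> fixes the
    constant for \<open>t2\<close>.\<close>
  have m': "(443 * r + 17 :: nat) \<le> m" using m r by simp
  have "prob B1 \<le> (\<Sum>k\<in>N1. (1/2) ^ m)"
    unfolding B1_def by (rule finite_sum_UN_bound[OF prob_space_gauss fin(1) _ gauss_form_lower]) measurable
  also have "\<dots> = real (card N1) * (1/2) ^ m" by simp
  also have "\<dots> \<le> 2 ^ T * 4 ^ r * (1/2) ^ m"
    unfolding N1_def r_def using card_lattice_ball[OF J, of "int T" T] by (intro mult_right_mono) auto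
  also have "2 ^ T * 4 ^ r = (2 :: real) ^ (443 * r)"
  proof -
    have "(4 :: real) ^ r = 2 ^ (2 * r)" by (simp add: power_mult)
    then show ?thesis by (simp add: T_def power_add[symmetric])
  qed
  also have "2 ^ (443 * r) * (1/2) ^ m \<le> 2 ^ (443 * r) * (1/2 :: real) ^ (443 * r + 17)"
    using m' by (intro mult_left_mono power_decreasing) auto
  also have "\<dots> = (2 * (1/2)) ^ (443 * r) * (1/2) ^ 17" by (simp only: power_add power_mult_distrib mult.assoc)
  also have "\<dots> \<le> (1/100 :: real)" by (simp add: power_divide)
  finally have p1: "prob B1 \<le> 1/100" .
  have "prob B2 \<le> (\<Sum>s\<in>N2. (1/2) ^ m)"
    unfolding B2_def by (rule finite_sum_UN_bound[OF prob_space_gauss fin(2) _ gauss_form_upper]) measurable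
  also have "\<dots> = 2 ^ r * (1/2) ^ m" using J by (simp add: N2_def card_PiE r_def)
  also have "\<dots> \<le> 2 ^ r * (1/2 :: real) ^ (r + 17)"
    using m' by (intro mult_left_mono power_decreasing) auto
  also have "\<dots> = (2 * (1/2)) ^ r * (1/2) ^ 17" by (simp only: power_add power_mult_distrib mult.assoc)
  also have "\<dots> \<le> (1/100 :: real)" by (simp add: power_divide)
  finally have p2: "prob B2 \<le> 1/100" .
  have "real m * (\<Sum>j\<in>J. (c j)\<^sup>2) \<le> 64 * gauss_form m t (lin_comb J e c) g"
    if g: "g \<in> space (gauss m t) - (B1 \<union> B2)" for g c
  proof (cases "(\<Sum>j\<in>J. (c j)\<^sup>2) = 0")
    case True
    then show ?thesis by (simp add: gauss_form_nonneg)
  next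
    case False
    define S where "S = (\<Sum>j\<in>J. (c j)\<^sup>2)"
    have S: "S > 0" using False sum_nonneg[of J "\<lambda>j. (c j)\<^sup>2"] by (simp add: S_def)
    define \<alpha> where "\<alpha> = sqrt (real T / S)"
    have \<alpha>2: "\<alpha>\<^sup>2 = real T / S" using S by (simp add: \<alpha>_def)
    define c' where "c' j = \<alpha> * c j" for j
    have c'S: "(\<Sum>j\<in>J. (c' j)\<^sup>2) = real T"
    proof -
      have "(\<Sum>j\<in>J. (c' j)\<^sup>2) = \<alpha>\<^sup>2 * S" by (simp only: c'_def power_mult_distrib sum_distrib_left S_def)
      then show ?thesis using S by (simp add: \<alpha>2)
    qed
    obtain k where k: "k \<in> PiE J (\<lambda>_. {- int T..int T})" "(\<Sum>j\<in>J. (k j)\<^sup>2) \<le> int T"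
      "\<And>j. j \<in> J \<Longrightarrow> \<bar>c' j - real_of_int (k j)\<bar> \<le> 1"
      using ex_lattice_rounding[OF J c'S] by blast
    have kN: "k \<in> N1" using k by (simp add: N1_def)
    define \<epsilon> where "\<epsilon> j = c' j - ri k j" for j
    have \<epsilon>: "\<bar>\<epsilon> j\<bar> \<le> 1" if "j \<in> J" for j using k(3)[OF that] by (simp add: \<epsilon>_def ri_def)
    have err: "gauss_form m t (lin_comb J e (\<lambda>j. - \<epsilon> j)) g \<le> 8 * real m * real r"
    proof -
      obtain s where s: "s \<in> N2" "gauss_form m t (lin_comb J e (\<lambda>j. - \<epsilon> j)) g \<le> gauss_form m t (lin_comb J e s) g"
        using cube_vertex_bound[OF J, where c = "\<lambda>j. - \<epsilon> j" and m = m and u = "\<lambda>_. 0"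
          and a = "\<lambda>j k. \<Sum>r<t. g (k, r) * e j r"] \<epsilon>
        unfolding gauss_form_lin_comb N2_def by auto
      have "gauss_form m t (lin_comb J e s) g \<le> 8 * real m * dotp t (lin_comb J e s) (lin_comb J e s)"
        using g s(1) by (auto simp: B2_def not_less)
      also have "dotp t (lin_comb J e s) (lin_comb J e s) = (\<Sum>j\<in>J. (s j)\<^sup>2)" by (rule dotp_lin_comb[OF on])
      also have "\<dots> = (\<Sum>j\<in>J. 1)" using s(1) by (intro sum.cong) (auto simp: N2_def PiE_iff)
      finally show ?thesis using s(2) by (simp add: r_def)
    qed
    \<comment> \<open>\<open>441 = 21 * 21\<close>: the rounding error has norm at most
      \<open>sqrt r\<close>, leaving \<open>20 * sqrt r\<close> for the lattice point. As
      \<open>400 / 12 >= 32 = 4 * 8\<close>, the root of the lattice part is at least twice the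
      bound for the error part. Undoing the scaling costs \<open>441 / 8 <= 64\<close>.\<close>
    have main: "32 * real m * real r \<le> gauss_form m t (lin_comb J e (ri k)) g"
    proof -
      have "sqrt (real T) \<le> sqrt (\<Sum>j\<in>J. (ri k j)\<^sup>2) + sqrt (\<Sum>j\<in>J. (\<epsilon> j)\<^sup>2)"
        using L2_set_triangle_ineq[of "ri k" \<epsilon> J] c'S by (simp add: L2_set_def \<epsilon>_def)
      moreover have "sqrt (\<Sum>j\<in>J. (\<epsilon> j)\<^sup>2) \<le> sqrt (real r)"
      proof -
        have "(\<Sum>j\<in>J. (\<epsilon> j)\<^sup>2) \<le> (\<Sum>j\<in>J. 1)" using \<epsilon> by (intro sum_mono) (auto simp: abs_square_le_1)
        then show ?thesis by (simp add: r_def)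
      qed
      moreover have "sqrt (real T) = 21 * sqrt (real r)"
        by (simp add: T_def real_sqrt_mult real_sqrt_unique)
      ultimately have "20 * sqrt (real r) \<le> sqrt (\<Sum>j\<in>J. (ri k j)\<^sup>2)" by linarith
      then have "(20 * sqrt (real r))\<^sup>2 \<le> (sqrt (\<Sum>j\<in>J. (ri k j)\<^sup>2))\<^sup>2" by (intro power_mono) auto
      then have "400 * real r \<le> (\<Sum>j\<in>J. (ri k j)\<^sup>2)" by (simp add: power_mult_distrib sum_nonneg)
      then have "real m / 12 * (400 * real r) \<le> real m / 12 * dotp t (lin_comb J e (ri k)) (lin_comb J e (ri k))"
        unfolding dotp_lin_comb[OF on] by (intro mult_left_mono) auto
      also have "\<dots> \<le> gauss_form m t (lin_comb J e (ri k)) g"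
        using g kN by (auto simp: B1_def not_less)
      finally have "real m / 12 * (400 * real r) \<le> gauss_form m t (lin_comb J e (ri k)) g" .
      moreover have "32 * real m * real r \<le> real m / 12 * (400 * real r)" by simp
      ultimately show ?thesis by linarith
    qed
    have "lin_comb J e (ri k) = (\<lambda>i. lin_comb J e c' i + lin_comb J e (\<lambda>j. - \<epsilon> j) i)"
      by (auto simp: lin_comb_def \<epsilon>_def sum.distrib[symmetric] algebra_simps)
    then have "sqrt (gauss_form m t (lin_comb J e (ri k)) g) \<le>
        sqrt (gauss_form m t (lin_comb J e c') g) + sqrt (gauss_form m t (lin_comb J e (\<lambda>j. - \<epsilon> j)) g)"
      by (simp add: sqrt_gauss_form_add)
    moreover have "sqrt (32 * real m * real r) \<le> sqrt (gauss_form m t (lin_comb J e (ri k)) g)" using main by simp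
    moreover have "sqrt (gauss_form m t (lin_comb J e (\<lambda>j. - \<epsilon> j)) g) \<le> sqrt (8 * real m * real r)" using err by simp
    moreover have "sqrt (32 * real m * real r) = 2 * sqrt (8 * real m * real r)"
    proof -
      have "sqrt (32 * real m * real r) = sqrt (4 * (8 * real m * real r))" by simp
      also have "\<dots> = 2 * sqrt (8 * real m * real r)" by (subst real_sqrt_mult) simp
      finally show ?thesis .
    qed
    ultimately have "sqrt (8 * real m * real r) \<le> sqrt (gauss_form m t (lin_comb J e c') g)" by linarith
    then have "8 * real m * real r \<le> gauss_form m t (lin_comb J e c') g" by simp
    also have "lin_comb J e c' = (\<lambda>i. \<alpha> * lin_comb J e c i)" by (auto simp: lin_comb_def c'_def sum_distrib_left mult.assoc)
    also have "gauss_form m t (\<lambda>i. \<alpha> * lin_comb J e c i) g = real T / S * gauss_form m t (lin_comb J e c) g"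
      by (simp add: gauss_form_scale \<alpha>2)
    finally have "8 * real m * real r * S \<le> 441 * real r * gauss_form m t (lin_comb J e c) g"
      using S by (simp add: T_def field_simps)
    then have "real r * (8 * real m * S) \<le> real r * (441 * gauss_form m t (lin_comb J e c) g)" by (simp add: mult_ac)
    then have "8 * real m * S \<le> 441 * gauss_form m t (lin_comb J e c) g" using r by simp
    then show ?thesis using gauss_form_nonneg[of m t "lin_comb J e c" g] unfolding S_def[symmetric] by linarith
  qed
  moreover have "prob (B1 \<union> B2) \<le> 1/100 + 1/100"
    by (rule prob_Un_le[OF prob_space_gauss B1 B2 p1 p2])
  ultimately show ?thesis using B1 B2 by (intro bexI[of _ "B1 \<union> B2"]) auto
qed

section \<open>The sparse embedding\<close>

definition signs :: "nat \<Rightarrow> (nat \<Rightarrow> real) measure" where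
  "signs n = PiM {..<n} (\<lambda>_. uniform_count_measure {-1, 1})"

definition hashes :: "nat \<Rightarrow> nat \<Rightarrow> (nat \<Rightarrow> nat) measure" where
  "hashes n t = PiM {..<n} (\<lambda>_. uniform_count_measure {..<t})"

lemma prob_space_signs: "prob_space (signs n)"
  unfolding signs_def by (intro prob_space_PiM prob_space_uniform_count_measure) auto

lemma prob_space_hashes: "t > 0 \<Longrightarrow> prob_space (hashes n t)"
  unfolding hashes_def by (intro prob_space_PiM prob_space_uniform_count_measure) auto

lemma product_sigma_finite_uniform:
  "finite A \<Longrightarrow> A \<noteq> {} \<Longrightarrow> product_sigma_finite (\<lambda>_. uniform_count_measure A)"
  by (simp add: product_sigma_finite_def prob_space_uniform_count_measure prob_space_imp_sigma_finite)

lemma integrable_uniform_count_measure: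
  fixes f :: "'a \<Rightarrow> real"
  shows "finite A \<Longrightarrow> integrable (uniform_count_measure A) f"
  unfolding uniform_count_measure_def by (rule integrable_point_measure_finite)

lemma signs_moment:
  shows "integrable (signs n) (\<lambda>\<sigma>. \<Prod>i<n. \<sigma> i ^ m i)"
    and "(\<integral>\<sigma>. (\<Prod>i<n. \<sigma> i ^ m i) \<partial>signs n) = (if \<forall>i<n. even (m i) then 1 else 0)"
proof -
  interpret product_sigma_finite "\<lambda>_ :: nat. uniform_count_measure {-1, 1 :: real}"
    by (rule product_sigma_finite_uniform) auto
  show "integrable (signs n) (\<lambda>\<sigma>. \<Prod>i<n. \<sigma> i ^ m i)"
    unfolding signs_def by (intro product_integrable_prod integrable_uniform_count_measure) auto
  have "(\<integral>\<sigma>. (\<Prod>i<n. \<sigma> i ^ m i) \<partial>signs n) = (\<Prod>i<n. \<integral>x. x ^ m i \<partial>uniform_count_measure {-1, 1 :: real})"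
    unfolding signs_def by (intro product_integral_prod integrable_uniform_count_measure) auto
  also have "\<dots> = (\<Prod>i<n. if even (m i) then 1 else 0)"
    by (intro prod.cong refl) (simp add: integral_uniform_count_measure)
  also have "\<dots> = (if \<forall>i<n. even (m i) then 1 else 0)"
    by (auto intro!: prod.neutral)
  finally show "(\<integral>\<sigma>. (\<Prod>i<n. \<sigma> i ^ m i) \<partial>signs n) = (if \<forall>i<n. even (m i) then 1 else 0)" .
qed

lemma prod_power_delta: "a < n \<Longrightarrow> (\<Prod>i<n. x i ^ (if i = a then 1 else 0)) = (x a :: real)" for n :: nat
proof -
  assume a: "a < n"
  have "(\<Prod>i<n. x i ^ (if i = a then 1 else 0)) = (\<Prod>i<n. if i = a then x i else 1)"
    by (intro prod.cong) auto
  then show ?thesis using a by simp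
qed

text \<open>For two pairs of distinct indices all exponents are even exactly when the pairs agree as
  sets. In the square of the chaos, only a pair against itself and against its swap
  survives.\<close>

lemma signs_four:
  assumes "a < n" "b < n" "c < n" "e < n" "a \<noteq> b" "c \<noteq> e"
  shows "integrable (signs n) (\<lambda>\<sigma>. \<sigma> a * \<sigma> b * (\<sigma> c * \<sigma> e))"
    and "(\<integral>\<sigma>. \<sigma> a * \<sigma> b * (\<sigma> c * \<sigma> e) \<partial>signs n) = (if (c, e) = (a, b) \<or> (c, e) = (b, a) then 1 else 0)"
proof -
  define m where "m i = (if i = a then 1 else 0) + (if i = b then 1 else 0) +
    ((if i = c then 1 else 0) + (if i = e then 1 else (0 :: nat)))" for i
  have eq: "\<sigma> a * \<sigma> b * (\<sigma> c * \<sigma> e) = (\<Prod>i<n. \<sigma> i ^ m i)" for \<sigma> :: "nat \<Rightarrow> real"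
    unfolding m_def power_add prod.distrib using assms(1-4) by (simp only: prod_power_delta)
  show "integrable (signs n) (\<lambda>\<sigma>. \<sigma> a * \<sigma> b * (\<sigma> c * \<sigma> e))"
    unfolding eq by (rule signs_moment)
  have "(\<forall>i<n. even (m i)) \<longleftrightarrow> (c, e) = (a, b) \<or> (c, e) = (b, a)"
  proof
    assume ev: "\<forall>i<n. even (m i)"
    then have "even (m a)" "even (m b)" using assms by auto
    then show "(c, e) = (a, b) \<or> (c, e) = (b, a)" using assms(5,6)
      by (auto simp: m_def split: if_splits)
  qed (use assms(5,6) in \<open>auto simp: m_def\<close>)
  then show "(\<integral>\<sigma>. \<sigma> a * \<sigma> b * (\<sigma> c * \<sigma> e) \<partial>signs n) = (if (c, e) = (a, b) \<or> (c, e) = (b, a) then 1 else 0)"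
    unfolding eq signs_moment(2) by simp
qed

section \<open>Collisions and the off-diagonal chaos\<close>

definition collision :: "(nat \<Rightarrow> nat) \<Rightarrow> nat \<times> nat \<Rightarrow> real" where
  "collision h p = of_bool (h (fst p) = h (snd p))"

lemma measurable_hashes_coord: "i < n \<Longrightarrow> (\<lambda>h. h i) \<in> hashes n t \<rightarrow>\<^sub>M count_space UNIV"
proof -
  assume i: "i < n"
  have "(\<lambda>h. h i) \<in> hashes n t \<rightarrow>\<^sub>M uniform_count_measure {..<t}"
    unfolding hashes_def using i by (intro measurable_component_singleton) auto
  moreover have "id \<in> uniform_count_measure {..<t} \<rightarrow>\<^sub>M count_space UNIV"
    by (auto simp: measurable_def space_uniform_count_measure sets_uniform_count_measure)
  ultimately have "id \<circ> (\<lambda>h. h i) \<in> hashes n t \<rightarrow>\<^sub>M count_space UNIV" by (rule measurable_comp)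
  then show ?thesis by (simp add: o_def)
qed

lemma measurable_collision:
  assumes "fst p < n" "snd p < n"
  shows "(\<lambda>h. collision h p) \<in> borel_measurable (hashes n t)"
proof -
  have [measurable]: "(\<lambda>h. h (fst p)) \<in> hashes n t \<rightarrow>\<^sub>M count_space UNIV"
    "(\<lambda>h. h (snd p)) \<in> hashes n t \<rightarrow>\<^sub>M count_space UNIV"
    using assms by (auto intro: measurable_hashes_coord)
  show ?thesis unfolding collision_def by measurable
qed

lemma integrable_collision:
  assumes t: "t > 0" and "fst p < n" "snd p < n" "fst q < n" "snd q < n"
  shows "integrable (hashes n t) (\<lambda>h. collision h p * collision h q)"
proof -
  interpret prob_space "hashes n t" by (rule prob_space_hashes[OF t])
  show ?thesis
    by (rule integrable_const_bound[of _ 1]) (use assms in \<open>auto simp: collision_def intro!: borel_measurable_times measurable_collision[unfolded collision_def]\<close>)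
qed

text \<open>A collision splits into \<open>t\<close> disjoint cases by its common value, each a
  product of two independent indicators of mean \<open>1 / t\<close>.\<close>

lemma expectation_collision:
  assumes t: "t > 0" and a: "a < n" "b < n" "a \<noteq> b"
  shows "(\<integral>h. collision h (a, b) \<partial>hashes n t) = 1 / real t"
proof -
  interpret product_sigma_finite "\<lambda>_ :: nat. uniform_count_measure {..<t}"
    by (rule product_sigma_finite_uniform) (use t in auto)
  define f where "f r i x = (if i = a \<or> i = b then of_bool (x = r) else 1 :: real)" for r i x :: nat
  have prod: "(\<Prod>i<n. f r i (h i)) = of_bool (h a = r) * of_bool (h b = r)" for r h
  proof -
    have "(\<Prod>i<n. f r i (h i)) = (\<Prod>i\<in>{a, b}. f r i (h i))"
      using a by (intro prod.mono_neutral_right) (auto simp: f_def)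
    then show ?thesis using a by (simp add: f_def)
  qed
  have "(\<integral>h. collision h (a, b) \<partial>hashes n t) = (\<integral>h. (\<Sum>r<t. \<Prod>i<n. f r i (h i)) \<partial>hashes n t)"
  proof (rule Bochner_Integration.integral_cong[OF refl])
    fix h assume "h \<in> space (hashes n t)"
    then have "h a < t" using a by (auto simp: hashes_def space_PiM PiE_iff space_uniform_count_measure)
    then show "collision h (a, b) = (\<Sum>r<t. \<Prod>i<n. f r i (h i))"
    proof -
      have "(\<Sum>r<t. \<Prod>i<n. f r i (h i)) = (\<Sum>r<t. if h a = r then collision h (a, b) else 0)"
        unfolding prod by (intro sum.cong refl) (auto simp: collision_def)
      then show ?thesis using \<open>h a < t\<close> by simp
    qed
  qed
  also have "\<dots> = (\<Sum>r<t. \<integral>h. (\<Prod>i<n. f r i (h i)) \<partial>hashes n t)"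
    unfolding hashes_def
    by (intro Bochner_Integration.integral_sum product_integrable_prod integrable_uniform_count_measure) auto
  also have "\<dots> = (\<Sum>r<t. \<Prod>i<n. \<integral>x. f r i x \<partial>uniform_count_measure {..<t})"
    unfolding hashes_def
    by (intro sum.cong refl product_integral_prod integrable_uniform_count_measure) auto
  also have "\<dots> = (\<Sum>r<t. 1 / real t * (1 / real t))"
  proof (intro sum.cong refl)
    fix r assume r: "r \<in> {..<t}"
    have val: "(\<integral>x. f r i x \<partial>uniform_count_measure {..<t}) = (if i = a \<or> i = b then 1 / real t else 1)" for i
      using t r by (auto simp: integral_uniform_count_measure f_def of_bool_def)
    have "(\<Prod>i<n. \<integral>x. f r i x \<partial>uniform_count_measure {..<t}) = (\<Prod>i\<in>{a, b}. 1 / real t)"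
      unfolding val using a by (intro prod.mono_neutral_cong_right) auto
    then show "(\<Prod>i<n. \<integral>x. f r i x \<partial>uniform_count_measure {..<t}) = 1 / real t * (1 / real t)" using a by simp
  qed
  also have "\<dots> = 1 / real t" using t by simp
  finally show ?thesis .
qed

definition offdiag :: "nat \<Rightarrow> (nat \<times> nat) set" where
  "offdiag n = {(a, b). a < n \<and> b < n \<and> a \<noteq> b}"

lemma finite_offdiag: "finite (offdiag n)"
  by (rule finite_subset[of _ "{..<n} \<times> {..<n}"]) (auto simp: offdiag_def)

text \<open>The off-diagonal part of the inner product of two hashed vectors; the diagonal part is
  deterministic because signs square to 1.\<close>

definition chaos :: "nat \<Rightarrow> (nat \<Rightarrow> real) \<Rightarrow> (nat \<Rightarrow> real) \<Rightarrow> (nat \<Rightarrow> real) \<Rightarrow> (nat \<Rightarrow> nat) \<Rightarrow> real" where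
  "chaos n u v \<sigma> h = (\<Sum>p\<in>offdiag n. u (fst p) * v (snd p) * (\<sigma> (fst p) * \<sigma> (snd p)) * collision h p)"

lemma chaos_square:
  "(chaos n u v \<sigma> h)\<^sup>2 = (\<Sum>p\<in>offdiag n. \<Sum>q\<in>offdiag n.
     (u (fst p) * v (snd p)) * (u (fst q) * v (snd q)) *
     ((\<sigma> (fst p) * \<sigma> (snd p)) * (\<sigma> (fst q) * \<sigma> (snd q))) * (collision h p * collision h q))"
  unfolding chaos_def power2_eq_square sum_product by (intro sum.cong refl) (simp add: mult_ac)

text \<open>Up to the factor \<open>1 / t\<close>, the left-hand side is what remains of the second
  moment after averaging. The swapped products are bounded by the mean of two squares, whose sums
  agree by symmetry.\<close>

lemma chaos_second_moment_bound:
  "(\<Sum>p\<in>offdiag n. (u (fst p) * v (snd p))\<^sup>2 + (u (fst p) * v (snd p)) * (u (snd p) * v (fst p)))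
    \<le> 2 * (dotp n u u * dotp n v v)"
proof -
  have sq: "(\<Sum>p\<in>offdiag n. (u (fst p) * v (snd p))\<^sup>2) \<le> dotp n u u * dotp n v v"
  proof -
    have "(\<Sum>p\<in>offdiag n. (u (fst p) * v (snd p))\<^sup>2) \<le> (\<Sum>p\<in>{..<n} \<times> {..<n}. (u (fst p) * v (snd p))\<^sup>2)"
      by (intro sum_mono2) (auto simp: offdiag_def)
    also have "\<dots> = (\<Sum>a<n. \<Sum>b<n. u a * u a * (v b * v b))"
      unfolding sum.cartesian_product by (intro sum.cong refl) (auto simp: power2_eq_square mult_ac)
    also have "\<dots> = dotp n u u * dotp n v v" by (simp add: dotp_def sum_product)
    finally show ?thesis .
  qed
  have swap: "(\<Sum>p\<in>offdiag n. (u (snd p) * v (fst p))\<^sup>2) = (\<Sum>p\<in>offdiag n. (u (fst p) * v (snd p))\<^sup>2)"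
    by (rule sum.reindex_bij_witness[of _ "\<lambda>p. (snd p, fst p)" "\<lambda>p. (snd p, fst p)"]) (auto simp: offdiag_def)
  have "(\<Sum>p\<in>offdiag n. (u (fst p) * v (snd p))\<^sup>2 + (u (fst p) * v (snd p)) * (u (snd p) * v (fst p))) \<le>
      (\<Sum>p\<in>offdiag n. (u (fst p) * v (snd p))\<^sup>2 + ((u (fst p) * v (snd p))\<^sup>2 + (u (snd p) * v (fst p))\<^sup>2) / 2)"
  proof (intro sum_mono add_left_mono)
    fix p :: "nat \<times> nat"
    show "(u (fst p) * v (snd p)) * (u (snd p) * v (fst p)) \<le> ((u (fst p) * v (snd p))\<^sup>2 + (u (snd p) * v (fst p))\<^sup>2) / 2"
      using sum_squares_bound[of "u (fst p) * v (snd p)" "u (snd p) * v (fst p)"] by simp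
  qed
  also have "\<dots> = 2 * (\<Sum>p\<in>offdiag n. (u (fst p) * v (snd p))\<^sup>2)"
    by (simp add: sum.distrib sum_divide_distrib[symmetric] swap)
  finally show ?thesis using sq by simp
qed

text \<open>The average \<open>F\<close> over the hash function is kept as an explicit polynomial in
  the signs. Its integrability is then visible term by term, without measurability on the product of
  the two spaces.\<close>

lemma chaos_integral:
  assumes t: "t > 0"
  shows "\<exists>F. integrable (signs n) F \<and> (\<forall>\<sigma>. 0 \<le> F \<sigma> \<and> (\<integral>\<^sup>+h. ennreal ((chaos n u v \<sigma> h)\<^sup>2) \<partial>hashes n t) = ennreal (F \<sigma>)) \<and>
    (\<integral>\<sigma>. F \<sigma> \<partial>signs n) \<le> 2 / real t * (dotp n u u * dotp n v v)"
proof -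
  interpret H: prob_space "hashes n t" by (rule prob_space_hashes[OF t])
  interpret S: prob_space "signs n" by (rule prob_space_signs)
  define w where "w p = u (fst p) * v (snd p)" for p :: "nat \<times> nat"
  define s where "s \<sigma> p = \<sigma> (fst p) * \<sigma> (snd p)" for p :: "nat \<times> nat" and \<sigma> :: "nat \<Rightarrow> real"
  define \<epsilon> where "\<epsilon> p q = (\<integral>h. collision h p * collision h q \<partial>hashes n t)" for p q
  let ?I = "offdiag n"
  have I: "fst p < n" "snd p < n" "fst p \<noteq> snd p" if "p \<in> ?I" for p using that by (auto simp: offdiag_def)
  have intc: "integrable (hashes n t) (\<lambda>h. collision h p * collision h q)" if "p \<in> ?I" "q \<in> ?I" for p q
    using integrable_collision[OF t] I that by simp
  have ints: "integrable (signs n) (\<lambda>\<sigma>. s \<sigma> p * s \<sigma> q)"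
    and vals: "(\<integral>\<sigma>. s \<sigma> p * s \<sigma> q \<partial>signs n) = (if q = p \<or> q = (snd p, fst p) then 1 else 0)" if "p \<in> ?I" "q \<in> ?I" for p q
    unfolding s_def using signs_four[of "fst p" n "snd p" "fst q" "snd q"] I that by (auto simp: prod_eq_iff)
  define F where "F \<sigma> = (\<Sum>p\<in>?I. \<Sum>q\<in>?I. w p * w q * (s \<sigma> p * s \<sigma> q) * \<epsilon> p q)" for \<sigma>
  have inner: "(\<integral>\<^sup>+h. ennreal ((chaos n u v \<sigma> h)\<^sup>2) \<partial>hashes n t) = ennreal (F \<sigma>)" and F0: "0 \<le> F \<sigma>" for \<sigma>
  proof -
    have int: "integrable (hashes n t) (\<lambda>h. (chaos n u v \<sigma> h)\<^sup>2)"
      unfolding chaos_square by (intro Bochner_Integration.integrable_sum integrable_mult_right intc)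
    have F: "(\<integral>h. (chaos n u v \<sigma> h)\<^sup>2 \<partial>hashes n t) = F \<sigma>"
      unfolding chaos_square F_def w_def[symmetric] s_def[symmetric]
      by (simp add: Bochner_Integration.integral_sum Bochner_Integration.integrable_sum intc \<epsilon>_def)
    show "(\<integral>\<^sup>+h. ennreal ((chaos n u v \<sigma> h)\<^sup>2) \<partial>hashes n t) = ennreal (F \<sigma>)"
      using nn_integral_eq_integral[OF int] F by simp
    show "0 \<le> F \<sigma>" unfolding F[symmetric] by simp
  qed
  have intF: "integrable (signs n) F"
    unfolding F_def by (intro Bochner_Integration.integrable_sum integrable_mult_right integrable_mult_left ints)
  have "(\<integral>\<sigma>. F \<sigma> \<partial>signs n) = (\<Sum>p\<in>?I. \<Sum>q\<in>?I. w p * w q * (if q = p \<or> q = (snd p, fst p) then 1 else 0) * \<epsilon> p q)"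
    unfolding F_def
    by (simp add: Bochner_Integration.integral_sum Bochner_Integration.integrable_sum ints vals)
  also have "\<dots> = (\<Sum>p\<in>?I. 1 / real t * ((w p)\<^sup>2 + w p * w (snd p, fst p)))"
  proof (intro sum.cong refl)
    fix p assume p: "p \<in> ?I"
    let ?p = "(snd p, fst p)"
    have p': "?p \<in> ?I" "?p \<noteq> p" using p by (auto simp: offdiag_def prod_eq_iff)
    have e: "(\<integral>h. collision h p \<partial>hashes n t) = 1 / real t"
      using expectation_collision[OF t, of "fst p" n "snd p"] I[OF p] by simp
    have eps: "\<epsilon> p p = 1 / real t" "\<epsilon> p ?p = 1 / real t"
      unfolding \<epsilon>_def
      by (rule trans[OF Bochner_Integration.integral_cong[OF refl] e], auto simp: collision_def)+
    have "(\<Sum>q\<in>?I. w p * w q * (if q = p \<or> q = ?p then 1 else 0) * \<epsilon> p q) =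
        (\<Sum>q\<in>{p, ?p}. w p * w q * \<epsilon> p q)"
      using p p' by (intro sum.mono_neutral_cong_right finite_offdiag) auto
    also have "\<dots> = w p * w p * \<epsilon> p p + w p * w ?p * \<epsilon> p ?p" using p' by simp
    finally show "(\<Sum>q\<in>?I. w p * w q * (if q = p \<or> q = ?p then 1 else 0) * \<epsilon> p q) =
        1 / real t * ((w p)\<^sup>2 + w p * w ?p)"
      unfolding eps by (simp add: power2_eq_square algebra_simps add_divide_distrib)
  qed
  also have "\<dots> = 1 / real t * (\<Sum>p\<in>?I. (w p)\<^sup>2 + w p * w (snd p, fst p))" by (simp only: sum_distrib_left)
  also have "\<dots> \<le> 1 / real t * (2 * (dotp n u u * dotp n v v))"
    using chaos_second_moment_bound[where u = u and v = v and n = n]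
    by (intro mult_left_mono) (simp_all add: w_def)
  finally have "(\<integral>\<sigma>. F \<sigma> \<partial>signs n) \<le> 2 / real t * (dotp n u u * dotp n v v)" by simp
  then show ?thesis using inner F0 intF by blast
qed

lemma chaos_second_moment:
  assumes t: "t > 0"
  shows "(\<integral>\<^sup>+\<sigma>. \<integral>\<^sup>+h. ennreal ((chaos n u v \<sigma> h)\<^sup>2) \<partial>hashes n t \<partial>signs n) \<le>
      ennreal (2 / real t * (dotp n u u * dotp n v v))"
    and "(\<lambda>\<sigma>. \<integral>\<^sup>+h. ennreal ((chaos n u v \<sigma> h)\<^sup>2) \<partial>hashes n t) \<in> borel_measurable (signs n)"
proof -
  obtain F where F: "integrable (signs n) F" "\<And>\<sigma>. 0 \<le> F \<sigma>"
    and inner: "\<And>\<sigma>. (\<integral>\<^sup>+h. ennreal ((chaos n u v \<sigma> h)\<^sup>2) \<partial>hashes n t) = ennreal (F \<sigma>)"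
    and bound: "(\<integral>\<sigma>. F \<sigma> \<partial>signs n) \<le> 2 / real t * (dotp n u u * dotp n v v)"
    using chaos_integral[OF t, of n u v] by blast
  show "(\<integral>\<^sup>+\<sigma>. \<integral>\<^sup>+h. ennreal ((chaos n u v \<sigma> h)\<^sup>2) \<partial>hashes n t \<partial>signs n) \<le>
      ennreal (2 / real t * (dotp n u u * dotp n v v))"
    unfolding inner using nn_integral_eq_integral[OF F(1)] F(2) bound by (simp add: ennreal_leI)
  show "(\<lambda>\<sigma>. \<integral>\<^sup>+h. ennreal ((chaos n u v \<sigma> h)\<^sup>2) \<partial>hashes n t) \<in> borel_measurable (signs n)"
    unfolding inner using F(1) by measurable
qed

lemma measurable_chaos: "(\<lambda>h. chaos n u v \<sigma> h) \<in> borel_measurable (hashes n t)"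
  unfolding chaos_def
  by (intro borel_measurable_sum borel_measurable_times borel_measurable_const measurable_collision) (auto simp: offdiag_def)

section \<open>Hashed orthonormal frames\<close>

definition sparse_image :: "nat \<Rightarrow> (nat \<Rightarrow> real) \<Rightarrow> (nat \<Rightarrow> nat) \<Rightarrow> (nat \<Rightarrow> real) \<Rightarrow> nat \<Rightarrow> real" where
  "sparse_image n \<sigma> h u r = (\<Sum>i<n. if h i = r then \<sigma> i * u i else 0)"

text \<open>Summing over the buckets selects the colliding pairs of indices, and an index paired
  with itself contributes \<open>u a * v a\<close>.\<close>

lemma dotp_sparse_image:
  assumes \<sigma>: "\<And>i. i < n \<Longrightarrow> \<sigma> i = -1 \<or> \<sigma> i = 1" and h: "\<And>i. i < n \<Longrightarrow> h i < t"
  shows "dotp t (sparse_image n \<sigma> h u) (sparse_image n \<sigma> h v) = dotp n u v + chaos n u v \<sigma> h"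
proof -
  have "dotp t (sparse_image n \<sigma> h u) (sparse_image n \<sigma> h v) =
      (\<Sum>r<t. \<Sum>a<n. \<Sum>b<n. (if h a = r then \<sigma> a * u a else 0) * (if h b = r then \<sigma> b * v b else 0))"
    by (simp add: dotp_def sparse_image_def sum_product)
  also have "\<dots> = (\<Sum>a<n. \<Sum>b<n. \<Sum>r<t. (if h a = r then \<sigma> a * u a else 0) * (if h b = r then \<sigma> b * v b else 0))"
    by (rule trans[OF sum.swap], rule sum.cong[OF refl], rule sum.swap)
  also have "\<dots> = (\<Sum>a<n. \<Sum>b<n. u a * v b * (\<sigma> a * \<sigma> b) * collision h (a, b))"
  proof (intro sum.cong refl)
    fix a b assume "a \<in> {..<n}" "b \<in> {..<n}"
    have "(\<Sum>r<t. (if h a = r then \<sigma> a * u a else 0) * (if h b = r then \<sigma> b * v b else 0)) =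
        (\<Sum>r<t. if h a = r then u a * v b * (\<sigma> a * \<sigma> b) * collision h (a, b) else 0)"
      by (intro sum.cong refl) (auto simp: collision_def)
    also have "\<dots> = u a * v b * (\<sigma> a * \<sigma> b) * collision h (a, b)"
      using h \<open>a \<in> {..<n}\<close> by simp
    finally show "(\<Sum>r<t. (if h a = r then \<sigma> a * u a else 0) * (if h b = r then \<sigma> b * v b else 0)) =
        u a * v b * (\<sigma> a * \<sigma> b) * collision h (a, b)" .
  qed
  also have "\<dots> = (\<Sum>p\<in>{..<n} \<times> {..<n}. u (fst p) * v (snd p) * (\<sigma> (fst p) * \<sigma> (snd p)) * collision h p)"
    by (simp add: sum.cartesian_product case_prod_beta)
  also have "{..<n} \<times> {..<n} = (\<lambda>a. (a, a)) ` {..<n} \<union> offdiag n" by (auto simp: offdiag_def)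
  also have "(\<Sum>p\<in>\<dots>. u (fst p) * v (snd p) * (\<sigma> (fst p) * \<sigma> (snd p)) * collision h p) =
      (\<Sum>p\<in>(\<lambda>a. (a, a)) ` {..<n}. u (fst p) * v (snd p) * (\<sigma> (fst p) * \<sigma> (snd p)) * collision h p) + chaos n u v \<sigma> h"
    unfolding chaos_def by (rule sum.union_disjoint) (auto simp: finite_offdiag, auto simp: offdiag_def)
  also have "(\<Sum>p\<in>(\<lambda>a. (a, a)) ` {..<n}. u (fst p) * v (snd p) * (\<sigma> (fst p) * \<sigma> (snd p)) * collision h p) = dotp n u v"
    unfolding dotp_def by (subst sum.reindex) (auto simp: inj_on_def collision_def dest!: \<sigma> intro!: sum.cong)
  finally show ?thesis .
qed

text \<open>For an orthonormal frame, the squared Frobenius distance between the Gram matrix of its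
  hashed images and the identity.\<close>

definition frame_defect :: "nat \<Rightarrow> nat set \<Rightarrow> (nat \<Rightarrow> nat \<Rightarrow> real) \<Rightarrow> (nat \<Rightarrow> real) \<Rightarrow> (nat \<Rightarrow> nat) \<Rightarrow> real" where
  "frame_defect n J e \<sigma> h = (\<Sum>j\<in>J. \<Sum>k\<in>J. (chaos n (e j) (e k) \<sigma> h)\<^sup>2)"

lemma sparse_image_sum: "sparse_image n \<sigma> h (\<lambda>i. \<Sum>j\<in>J. c j * e j i) r = (\<Sum>j\<in>J. c j * sparse_image n \<sigma> h (e j) r)"
proof -
  have "sparse_image n \<sigma> h (\<lambda>i. \<Sum>j\<in>J. c j * e j i) r = (\<Sum>i<n. \<Sum>j\<in>J. c j * (if h i = r then \<sigma> i * e j i else 0))"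
    unfolding sparse_image_def by (intro sum.cong refl) (simp add: sum_distrib_left mult_ac)
  then show ?thesis by (subst (asm) sum.swap) (simp add: sparse_image_def sum_distrib_left)
qed

text \<open>The Frobenius norm dominates the operator norm: by Cauchy--Schwarz a defect of at most
  \<open>1/4\<close> perturbs the quadratic form by at most half the squared norm.\<close>

lemma sparse_image_lower:
  assumes on: "orthonormal n J e"
    and \<sigma>: "\<And>i. i < n \<Longrightarrow> \<sigma> i = -1 \<or> \<sigma> i = 1" and h: "\<And>i. i < n \<Longrightarrow> h i < t"
    and defect: "frame_defect n J e \<sigma> h \<le> 1/4"
  shows "(\<Sum>j\<in>J. (c j)\<^sup>2) \<le> 2 * dotp t (sparse_image n \<sigma> h (\<lambda>i. \<Sum>j\<in>J. c j * e j i)) (sparse_image n \<sigma> h (\<lambda>i. \<Sum>j\<in>J. c j * e j i))"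
proof -
  define y where "y = sparse_image n \<sigma> h (\<lambda>i. \<Sum>j\<in>J. c j * e j i)"
  define S where "S = (\<Sum>j\<in>J. (c j)\<^sup>2)"
  define X where "X p = chaos n (e (fst p)) (e (snd p)) \<sigma> h" for p :: "nat \<times> nat"
  have J: "finite J" using on by (simp add: orthonormal_def)
  have "y = (\<lambda>r. \<Sum>j\<in>J. c j * sparse_image n \<sigma> h (e j) r)" by (simp add: y_def sparse_image_sum fun_eq_iff)
  then have "dotp t y y = (\<Sum>j\<in>J. c j * (\<Sum>k\<in>J. c k * dotp t (sparse_image n \<sigma> h (e j)) (sparse_image n \<sigma> h (e k))))"
    by (simp add: dotp_sum_left dotp_sum_right dotp_scale_left dotp_scale_right sum_distrib_left)
  also have "\<dots> = (\<Sum>j\<in>J. c j * (\<Sum>k\<in>J. c k * ((if j = k then 1 else 0) + chaos n (e j) (e k) \<sigma> h)))"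
    using on by (intro sum.cong refl arg_cong2[where f = "(*)"]) (simp add: dotp_sparse_image[OF \<sigma> h] orthonormal_def)
  also have "\<dots> = (\<Sum>j\<in>J. (c j)\<^sup>2 + (\<Sum>k\<in>J. c j * c k * chaos n (e j) (e k) \<sigma> h))"
  proof (intro sum.cong refl)
    fix j assume "j \<in> J"
    have "(\<Sum>k\<in>J. c k * ((if j = k then 1 else 0) + chaos n (e j) (e k) \<sigma> h)) =
        (\<Sum>k\<in>J. if j = k then c k else 0) + (\<Sum>k\<in>J. c k * chaos n (e j) (e k) \<sigma> h)"
      unfolding sum.distrib[symmetric] by (intro sum.cong refl) (simp add: distrib_left)
    then show "c j * (\<Sum>k\<in>J. c k * ((if j = k then 1 else 0) + chaos n (e j) (e k) \<sigma> h)) =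
        (c j)\<^sup>2 + (\<Sum>k\<in>J. c j * c k * chaos n (e j) (e k) \<sigma> h)"
      using \<open>j \<in> J\<close> J by (simp add: distrib_left sum_distrib_left power2_eq_square mult_ac)
  qed
  also have "\<dots> = S + (\<Sum>p\<in>J \<times> J. (c (fst p) * c (snd p)) * X p)"
    by (simp add: sum.distrib S_def X_def sum.cartesian_product case_prod_beta)
  finally have eq: "dotp t y y = S + (\<Sum>p\<in>J \<times> J. (c (fst p) * c (snd p)) * X p)" .
  have "(\<Sum>p\<in>J \<times> J. (c (fst p) * c (snd p)) * X p)\<^sup>2 \<le>
      (\<Sum>p\<in>J \<times> J. (c (fst p) * c (snd p))\<^sup>2) * (\<Sum>p\<in>J \<times> J. (X p)\<^sup>2)"
    by (rule Cauchy_Schwarz_ineq_sum)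
  also have "(\<Sum>p\<in>J \<times> J. (c (fst p) * c (snd p))\<^sup>2) = S\<^sup>2"
    unfolding S_def power2_eq_square[of "sum _ _"] sum_product
    by (simp add: sum.cartesian_product case_prod_beta power_mult_distrib)
  also have "(\<Sum>p\<in>J \<times> J. (X p)\<^sup>2) = frame_defect n J e \<sigma> h"
    by (simp add: frame_defect_def X_def sum.cartesian_product case_prod_beta)
  also have "S\<^sup>2 * frame_defect n J e \<sigma> h \<le> S\<^sup>2 * (1/4)" using defect by (intro mult_left_mono) auto
  also have "\<dots> = (S / 2)\<^sup>2" by (simp add: power_divide)
  finally have "\<bar>\<Sum>p\<in>J \<times> J. (c (fst p) * c (snd p)) * X p\<bar> \<le> \<bar>S / 2\<bar>"
    by (simp only: abs_le_square_iff)
  moreover have "0 \<le> S" by (simp add: S_def sum_nonneg)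
  ultimately show ?thesis using eq unfolding y_def[symmetric] S_def[symmetric] by linarith
qed

lemma measurable_frame_defect: "(\<lambda>h. frame_defect n J e \<sigma> h) \<in> borel_measurable (hashes n t)"
  unfolding frame_defect_def by (intro borel_measurable_sum borel_measurable_power measurable_chaos)

text \<open>Each of the \<open>card J * card J\<close> pairs contributes at most
  \<open>2 / t\<close>. This is the source of the quadratic size of \<open>t1\<close>: a constant
  failure probability from Markov's inequality takes \<open>t\<close> to be a multiple of the
  squared dimension.\<close>

lemma frame_defect_moment:
  assumes t: "t > 0" and on: "orthonormal n J e"
  shows "(\<integral>\<^sup>+\<sigma>. \<integral>\<^sup>+h. ennreal (frame_defect n J e \<sigma> h) \<partial>hashes n t \<partial>signs n) \<le> ennreal (2 * (real (card J))\<^sup>2 / real t)"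
    and "(\<lambda>\<sigma>. \<integral>\<^sup>+h. ennreal (frame_defect n J e \<sigma> h) \<partial>hashes n t) \<in> borel_measurable (signs n)"
proof -
  have J: "finite J" using on by (simp add: orthonormal_def)
  note [measurable] = measurable_chaos chaos_second_moment(2)[OF t]
  have "ennreal (frame_defect n J e \<sigma> h) = (\<Sum>j\<in>J. \<Sum>k\<in>J. ennreal ((chaos n (e j) (e k) \<sigma> h)\<^sup>2))" for \<sigma> h
    unfolding frame_defect_def by (simp add: sum_nonneg)
  then have eq: "(\<integral>\<^sup>+h. ennreal (frame_defect n J e \<sigma> h) \<partial>hashes n t) =
      (\<Sum>j\<in>J. \<Sum>k\<in>J. \<integral>\<^sup>+h. ennreal ((chaos n (e j) (e k) \<sigma> h)\<^sup>2) \<partial>hashes n t)" for \<sigma>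
    by (simp add: nn_integral_sum del: sum_ennreal)
  show "(\<lambda>\<sigma>. \<integral>\<^sup>+h. ennreal (frame_defect n J e \<sigma> h) \<partial>hashes n t) \<in> borel_measurable (signs n)"
    unfolding eq by measurable
  have "(\<integral>\<^sup>+\<sigma>. \<integral>\<^sup>+h. ennreal (frame_defect n J e \<sigma> h) \<partial>hashes n t \<partial>signs n) =
      (\<integral>\<^sup>+\<sigma>. (\<Sum>j\<in>J. \<Sum>k\<in>J. \<integral>\<^sup>+h. ennreal ((chaos n (e j) (e k) \<sigma> h)\<^sup>2) \<partial>hashes n t) \<partial>signs n)"
    by (simp add: eq)
  also have "\<dots> = (\<Sum>j\<in>J. \<Sum>k\<in>J. \<integral>\<^sup>+\<sigma>. \<integral>\<^sup>+h. ennreal ((chaos n (e j) (e k) \<sigma> h)\<^sup>2) \<partial>hashes n t \<partial>signs n)"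
    by (simp add: nn_integral_sum)
  also have "\<dots> \<le> (\<Sum>j\<in>J. \<Sum>k\<in>J. ennreal (2 / real t))"
  proof (intro sum_mono)
    fix j k assume "j \<in> J" "k \<in> J"
    then show "(\<integral>\<^sup>+\<sigma>. \<integral>\<^sup>+h. ennreal ((chaos n (e j) (e k) \<sigma> h)\<^sup>2) \<partial>hashes n t \<partial>signs n) \<le> ennreal (2 / real t)"
      using chaos_second_moment(1)[OF t, of n "e j" "e k"] on by (simp add: orthonormal_def)
  qed
  also have "\<dots> = ennreal (2 * (real (card J))\<^sup>2 / real t)"
    by (simp add: ennreal_of_nat_eq_real_of_nat ennreal_mult[symmetric] power2_eq_square mult_ac)
  finally show "(\<integral>\<^sup>+\<sigma>. \<integral>\<^sup>+h. ennreal (frame_defect n J e \<sigma> h) \<partial>hashes n t \<partial>signs n) \<le>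
      ennreal (2 * (real (card J))\<^sup>2 / real t)" .
qed

section \<open>Measurability of the output\<close>

lemma measurable_dotp:
  assumes "\<And>j. (\<lambda>\<omega>. u \<omega> j) \<in> borel_measurable M" "\<And>j. (\<lambda>\<omega>. v \<omega> j) \<in> borel_measurable M"
  shows "(\<lambda>\<omega>. dotp D (u \<omega>) (v \<omega>)) \<in> borel_measurable M"
  unfolding dotp_def by (intro borel_measurable_sum borel_measurable_times assms)

text \<open>With total division, Gram--Schmidt consists of measurable real operations only. The
  discontinuity of the pseudoinverse at changes of rank therefore causes no difficulty.\<close>

lemma measurable_gs:
  assumes R: "\<And>i j. (\<lambda>\<omega>. R \<omega> i j) \<in> borel_measurable M"
  shows "(\<lambda>\<omega>. gs D (R \<omega>) i j) \<in> borel_measurable M"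
proof (induction i arbitrary: j rule: less_induct)
  case (less i)
  have "(\<lambda>\<omega>. gs_part D (R \<omega>) i k j) \<in> borel_measurable M" if "k \<le> i" for k j
    using that
  proof (induction k arbitrary: j)
    case 0
    then show ?case by (simp add: gs_part_0 R)
  next
    case (Suc k)
    have "\<And>j. (\<lambda>\<omega>. gs D (R \<omega>) k j) \<in> borel_measurable M" using Suc.prems by (intro less) simp
    then show ?case
      unfolding gs_part_Suc reduce_def
      by (intro borel_measurable_diff borel_measurable_times borel_measurable_divide measurable_dotp Suc.IH)
        (use Suc.prems in auto)
  qed
  from this[of i] show ?case by (simp add: gs_part_self)
qed

lemma measurable_lsq_solution:
  assumes M: "\<And>k j. k < m \<Longrightarrow> (\<lambda>\<omega>. F \<omega> k j) \<in> borel_measurable M"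
  shows "(\<lambda>\<omega>. lsq_solution m n (F \<omega>) j) \<in> borel_measurable M"
proof -
  have "(\<lambda>\<omega>. bordered_gram m n (F \<omega>) i j) \<in> borel_measurable M" for i j
    unfolding bordered_gram_def gram_def using M by (auto intro!: borel_measurable_sum borel_measurable_times)
  then show ?thesis
    unfolding lsq_solution_def by (intro borel_measurable_divide borel_measurable_uminus measurable_gs)
qed

lemma measurable_signs_coord: "i < n \<Longrightarrow> (\<lambda>\<sigma>. \<sigma> i) \<in> borel_measurable (signs n)"
proof -
  assume i: "i < n"
  have "(\<lambda>\<sigma>. \<sigma> i) \<in> signs n \<rightarrow>\<^sub>M uniform_count_measure {-1, 1}"
    unfolding signs_def using i by (intro measurable_component_singleton) auto
  moreover have "id \<in> borel_measurable (uniform_count_measure {-1, 1 :: real})"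
    by (auto simp: measurable_def space_uniform_count_measure sets_uniform_count_measure)
  ultimately have "id \<circ> (\<lambda>\<sigma>. \<sigma> i) \<in> borel_measurable (signs n)" by (rule measurable_comp)
  then show ?thesis by (simp add: o_def)
qed

section \<open>Approximation guarantee\<close>

context orlicz_function begin

lemma draws_eq: "draws G n t1 t2 = weights n \<Otimes>\<^sub>M signs n \<Otimes>\<^sub>M hashes n t1 \<Otimes>\<^sub>M gauss t2 t1"
  by (simp add: draws_def weights_def signs_def hashes_def gauss_def)

definition solution :: "nat \<Rightarrow> nat \<Rightarrow> nat \<Rightarrow> nat \<Rightarrow> (nat \<Rightarrow> nat \<Rightarrow> real) \<Rightarrow> draw \<Rightarrow> nat \<Rightarrow> real" where
  "solution n d t1 t2 B = (\<lambda>(w, \<sigma>, h, g). lsq_solution t2 d (gaussed t1 t2 g (hashed n w \<sigma> h B)))"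

lemma measurable_solution:
  "(\<lambda>\<omega>. solution n d t1 t2 B \<omega> j) \<in> borel_measurable (draws G n t1 t2)"
proof -
  let ?M = "weights n \<Otimes>\<^sub>M signs n \<Otimes>\<^sub>M hashes n t1 \<Otimes>\<^sub>M gauss t2 t1"
  have w: "(\<lambda>\<omega>. fst \<omega> i) \<in> borel_measurable ?M" if "i < n" for i
    by (rule measurable_compose[OF measurable_fst measurable_weights_coord[OF that]])
  have \<sigma>: "(\<lambda>\<omega>. fst (snd \<omega>) i) \<in> borel_measurable ?M" if "i < n" for i
    by (rule measurable_compose[OF measurable_compose[OF measurable_snd measurable_fst] measurable_signs_coord[OF that]])
  have h: "(\<lambda>\<omega>. fst (snd (snd \<omega>)) i) \<in> ?M \<rightarrow>\<^sub>M count_space UNIV" if "i < n" for i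
    by (rule measurable_compose[OF measurable_compose[OF measurable_compose[OF measurable_snd measurable_snd] measurable_fst]
      measurable_hashes_coord[OF that]])
  have g: "(\<lambda>\<omega>. snd (snd (snd \<omega>)) p) \<in> borel_measurable ?M" if "p \<in> {..<t2} \<times> {..<t1}" for p
    by (rule measurable_compose[OF measurable_compose[OF measurable_compose[OF measurable_snd measurable_snd] measurable_snd]
      measurable_gauss_coord[OF that]])
  have hashed: "(\<lambda>\<omega>. hashed n (fst \<omega>) (fst (snd \<omega>)) (fst (snd (snd \<omega>))) B r j) \<in> borel_measurable ?M" for r j
    unfolding hashed_def
  proof (intro borel_measurable_sum)
    fix i assume "i \<in> {..<n}"
    then have i: "i < n" by simp
    note [measurable] = w[OF i] \<sigma>[OF i] h[OF i]
    show "(\<lambda>\<omega>. if fst (snd (snd \<omega>)) i = r then fst (snd \<omega>) i * B i j / fst \<omega> i else 0) \<in> borel_measurable ?M"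
      by measurable
  qed
  have "(\<lambda>\<omega>. gaussed t1 t2 (snd (snd (snd \<omega>))) (hashed n (fst \<omega>) (fst (snd \<omega>)) (fst (snd (snd \<omega>))) B) k j) \<in> borel_measurable ?M"
    if "k < t2" for k j
    unfolding gaussed_def
    by (intro borel_measurable_sum borel_measurable_times borel_measurable_divide g hashed borel_measurable_const) (use that in auto)
  then have "(\<lambda>\<omega>. lsq_solution t2 d (gaussed t1 t2 (snd (snd (snd \<omega>))) (hashed n (fst \<omega>) (fst (snd \<omega>)) (fst (snd (snd \<omega>))) B)) j) \<in> borel_measurable ?M"
    by (rule measurable_lsq_solution)
  then show ?thesis unfolding draws_eq solution_def by (simp add: case_prod_beta')
qed

text \<open>For \<open>c > 0\<close> the set is a sublevel set of a finite sum. The case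
  \<open>c = 0\<close>, which occurs for solvable systems, is the common zero set of the
  coordinates.\<close>

lemma measurable_G_norm_le:
  assumes f: "\<And>i. i < n \<Longrightarrow> (\<lambda>\<omega>. f \<omega> i) \<in> borel_measurable M" and c: "0 \<le> c"
  shows "{\<omega> \<in> space M. G_norm n (f \<omega>) \<le> c} \<in> sets M"
proof (cases "c = 0")
  case True
  have "G_norm n (f \<omega>) \<le> 0 \<longleftrightarrow> (\<forall>i\<in>{..<n}. f \<omega> i = 0)" for \<omega>
  proof
    assume "G_norm n (f \<omega>) \<le> 0"
    then show "\<forall>i\<in>{..<n}. f \<omega> i = 0" using abs_le_G_norm[of _ n "f \<omega>"] by fastforce
  qed (use G_norm_le_sum_abs[of n "f \<omega>"] in simp)
  then have "{\<omega> \<in> space M. G_norm n (f \<omega>) \<le> c} = {\<omega> \<in> space M. \<forall>i\<in>{..<n}. f \<omega> i = 0}" using True by simp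
  also have "\<dots> \<in> sets M"
    by (intro sets.sets_Collect_finite_All finite_lessThan borel_measurable_eq f borel_measurable_const) simp
  finally show ?thesis .
next
  case False
  then have c: "c > 0" using c by simp
  have "(\<lambda>\<omega>. \<Sum>i<n. G (\<bar>f \<omega> i\<bar> / c)) \<in> borel_measurable M"
    using f by (intro borel_measurable_sum measurable_compose[OF _ measurable_G] borel_measurable_divide
        borel_measurable_abs borel_measurable_const) auto
  then have "{\<omega> \<in> space M. (\<Sum>i<n. G (\<bar>f \<omega> i\<bar> / c)) \<le> 1} \<in> sets M" by measurable
  then show ?thesis using G_norm_le_iff[OF c] by simp
qed

lemma weights_l2_upper_G_norm:
  "\<exists>K>0. \<forall>n\<ge>2. \<forall>f. \<exists>B\<in>sets (weights n). measure (weights n) B \<le> 1/25 \<and>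
      (\<forall>w\<in>space (weights n) - B. dotp n (\<lambda>i. f i / w i) (\<lambda>i. f i / w i) \<le> K * ln (real n) * (G_norm n f)\<^sup>2)"
proof -
  obtain K where K: "K > 0" "\<And>n f. n \<ge> 2 \<Longrightarrow> (\<Sum>i<n. G \<bar>f i\<bar>) \<le> 1 \<Longrightarrow>
    \<exists>B\<in>sets (weights n). measure (weights n) B \<le> 1/25 \<and>
      (\<forall>w\<in>space (weights n) - B. (\<Sum>i<n. (f i / w i)\<^sup>2) \<le> K * ln (real n))"
    using weights_l2_upper by blast
  have "\<exists>B\<in>sets (weights n). measure (weights n) B \<le> 1/25 \<and>
      (\<forall>w\<in>space (weights n) - B. dotp n (\<lambda>i. f i / w i) (\<lambda>i. f i / w i) \<le> K * ln (real n) * (G_norm n f)\<^sup>2)"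
    if n: "n \<ge> 2" for n f
  proof (cases "G_norm n f = 0")
    case True
    then have "f i = 0" if "i < n" for i using abs_le_G_norm[OF that, of f] by simp
    then show ?thesis by (intro bexI[of _ "{}"]) (auto simp: dotp_def True)
  next
    case False
    define a where "a = G_norm n f"
    have a: "a > 0" using False G_norm_nonneg[of n f] by (simp add: a_def)
    have "(\<Sum>i<n. G \<bar>f i / a\<bar>) \<le> 1" using G_norm_le_iff[OF a, of n f] a by (simp add: a_def)
    then obtain B where B: "B \<in> sets (weights n)" "measure (weights n) B \<le> 1/25"
      "\<And>w. w \<in> space (weights n) - B \<Longrightarrow> (\<Sum>i<n. (f i / a / w i)\<^sup>2) \<le> K * ln (real n)"
      using K(2)[OF n, of "\<lambda>i. f i / a"] by blast
    have "dotp n (\<lambda>i. f i / w i) (\<lambda>i. f i / w i) \<le> K * ln (real n) * a\<^sup>2" if "w \<in> space (weights n) - B" for w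
    proof -
      have "dotp n (\<lambda>i. f i / w i) (\<lambda>i. f i / w i) = (\<Sum>i<n. (f i / a / w i)\<^sup>2 * a\<^sup>2)"
        unfolding dotp_def using a by (intro sum.cong refl) (simp add: power2_eq_square field_simps)
      also have "\<dots> = (\<Sum>i<n. (f i / a / w i)\<^sup>2) * a\<^sup>2" by (simp add: sum_distrib_right)
      finally show ?thesis using B(3)[OF that] by (simp add: mult_right_mono)
    qed
    then show ?thesis using B unfolding a_def by blast
  qed
  then show ?thesis using K(1) by blast
qed

text \<open>Scaled to norm 2, the vector has coordinates at most 2 and norm above 1. Some coordinate
  then beats a multiple of its weight, and one coordinate already bounds the \<open>l2\<close> norm
  from below. The scaling turns 480 into 960.\<close>

lemma weights_no_contraction:
  assumes n: "n \<ge> 2"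
  shows "\<exists>B\<in>sets (weights n). measure (weights n) B \<le> 1/25 \<and>
    (\<forall>w\<in>space (weights n) - B. \<forall>x. G_norm n (\<lambda>i. \<Sum>j<d. A i j * x j) \<le>
       960 * real d * ln (real n) * sqrt (dotp n (\<lambda>i. (\<Sum>j<d. A i j * x j) / w i) (\<lambda>i. (\<Sum>j<d. A i j * x j) / w i)))"
proof -
  have lnn: "0 \<le> ln (real n)" using n by simp
  obtain J e where on: "orthonormal n J e" and cJ: "card J \<le> d"
    and span: "\<And>x. \<exists>c. \<forall>i<n. (\<Sum>j<d. A i j * x j) = (\<Sum>j\<in>J. c j * e j i)"
    using ex_orthonormal_spanning[of n d "\<lambda>j i. A i j"] by blast
  have zero: "G_norm n y \<le> 960 * real d * ln (real n) * sqrt (dotp n u u)" if "G_norm n y = 0" for y u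
    using that lnn by (simp add: dotp_nonneg)
  show ?thesis
  proof (cases "J = {}")
    case True
    have "G_norm n (\<lambda>i. \<Sum>j<d. A i j * x j) = 0" for x
    proof -
      have "(\<Sum>i<n. \<bar>\<Sum>j<d. A i j * x j\<bar>) = 0" using span[of x] True by auto
      then show ?thesis
        using G_norm_le_sum_abs[of n "\<lambda>i. \<Sum>j<d. A i j * x j"] G_norm_nonneg[of n "\<lambda>i. \<Sum>j<d. A i j * x j"] by simp
    qed
    then show ?thesis using zero by (intro bexI[of _ "{}"]) auto
  next
    case False
    obtain B where B: "B \<in> sets (weights n)" "measure (weights n) B \<le> 1/25"
      and pos: "\<And>w i. w \<in> space (weights n) - B \<Longrightarrow> i < n \<Longrightarrow> 0 < w i"
      and low: "\<And>w c. w \<in> space (weights n) - B \<Longrightarrow> (\<forall>i<n. \<bar>\<Sum>j\<in>J. c j * e j i\<bar> \<le> 2) \<Longrightarrow>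
         1 < (\<Sum>i<n. G \<bar>\<Sum>j\<in>J. c j * e j i\<bar>) \<Longrightarrow>
         \<exists>i<n. w i / (480 * real (card J) * ln (real n)) < \<bar>\<Sum>j\<in>J. c j * e j i\<bar>"
      using weights_sup_lower[OF n on False] by blast
    have "G_norm n (\<lambda>i. \<Sum>j<d. A i j * x j) \<le>
       960 * real d * ln (real n) * sqrt (dotp n (\<lambda>i. (\<Sum>j<d. A i j * x j) / w i) (\<lambda>i. (\<Sum>j<d. A i j * x j) / w i))"
      if w: "w \<in> space (weights n) - B" for w x
    proof -
      define y where "y i = (\<Sum>j<d. A i j * x j)" for i
      define a where "a = G_norm n y"
      show ?thesis
      proof (cases "a = 0")
        case True
        then show ?thesis using zero unfolding a_def y_def by blast
      next
        case a0: False
        then have a: "a > 0" using G_norm_nonneg[of n y] by (simp add: a_def)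
        obtain c where c: "\<And>i. i < n \<Longrightarrow> y i = (\<Sum>j\<in>J. c j * e j i)" using span[of x] unfolding y_def by blast
        have c': "(\<Sum>j\<in>J. (2 / a * c j) * e j i) = 2 / a * y i" if "i < n" for i
          using c[OF that] by (simp add: sum_distrib_left mult.assoc)
        have "\<bar>2 / a * y i\<bar> \<le> 2" if "i < n" for i
          using abs_le_G_norm[OF that, of y] a unfolding a_def[symmetric] by (simp add: abs_mult divide_le_eq)
        then have 1: "\<forall>i<n. \<bar>\<Sum>j\<in>J. (2 / a * c j) * e j i\<bar> \<le> 2" using c' by simp
        have "\<not> G_norm n y \<le> a / 2" using a by (simp add: a_def)
        then have "1 < (\<Sum>i<n. G (\<bar>y i\<bar> / (a / 2)))" using G_norm_le_iff[of "a / 2" n y] a by simp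
        also have "\<dots> = (\<Sum>i<n. G \<bar>\<Sum>j\<in>J. (2 / a * c j) * e j i\<bar>)"
          using c' a by (intro sum.cong refl) (simp add: abs_mult mult_ac)
        finally obtain i where i: "i < n" "w i / (480 * real (card J) * ln (real n)) < \<bar>\<Sum>j\<in>J. (2 / a * c j) * e j i\<bar>"
          using low[OF w 1] by blast
        have wi: "w i > 0" by (rule pos[OF w i(1)])
        have q: "0 < 480 * real (card J) * ln (real n)"
          using False on n by (auto simp: orthonormal_def card_gt_0_iff)
        have "w i / (480 * real (card J) * ln (real n)) < 2 / a * \<bar>y i\<bar>"
          using i(2) c'[OF i(1)] a by (simp add: abs_mult)
        then have "a < 960 * real (card J) * ln (real n) * (\<bar>y i\<bar> / w i)"
          using a wi q by (simp add: field_simps)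
        also have "\<dots> \<le> 960 * real d * ln (real n) * (\<bar>y i\<bar> / w i)"
          using cJ lnn wi by (intro mult_right_mono) auto
        also have "\<bar>y i\<bar> / w i \<le> sqrt (dotp n (\<lambda>i. y i / w i) (\<lambda>i. y i / w i))"
        proof (rule real_le_rsqrt)
          have "(\<bar>y i\<bar> / w i)\<^sup>2 = y i / w i * (y i / w i)" by (simp add: power2_eq_square)
          also have "\<dots> \<le> dotp n (\<lambda>i. y i / w i) (\<lambda>i. y i / w i)"
            unfolding dotp_def using i(1) by (intro member_le_sum) auto
          finally show "(\<bar>y i\<bar> / w i)\<^sup>2 \<le> dotp n (\<lambda>i. y i / w i) (\<lambda>i. y i / w i)" .
        qed
        finally have "a \<le> 960 * real d * ln (real n) * sqrt (dotp n (\<lambda>i. y i / w i) (\<lambda>i. y i / w i))"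
          using lnn by (simp add: mult_left_mono)
        then show ?thesis by (simp add: a_def y_def[abs_def])
      qed
    qed
    then show ?thesis using B by blast
  qed
qed

end

section \<open>Deterministic comparison after sketching\<close>

lemma gauss_form_eq_gaussed:
  assumes "t2 > 0" and v: "\<And>r. r < t1 \<Longrightarrow> v r = (\<Sum>j<d. P r j * x j) - s * P r d"
  shows "gauss_form t2 t1 v g = real t2 * (\<Sum>k<t2. ((\<Sum>j<d. gaussed t1 t2 g P k j * x j) - s * gaussed t1 t2 g P k d)\<^sup>2)"
proof -
  have "(\<Sum>r<t1. g (k, r) * v r) = sqrt (real t2) * ((\<Sum>j<d. gaussed t1 t2 g P k j * x j) - s * gaussed t1 t2 g P k d)" for k
  proof -
    have g: "sqrt (real t2) * gaussed t1 t2 g P k j = (\<Sum>r<t1. g (k, r) * P r j)" for j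
      using assms(1) by (simp add: gaussed_def sum_distrib_left)
    have "sqrt (real t2) * ((\<Sum>j<d. gaussed t1 t2 g P k j * x j) - s * gaussed t1 t2 g P k d) =
        (\<Sum>j<d. (sqrt (real t2) * gaussed t1 t2 g P k j) * x j) - s * (sqrt (real t2) * gaussed t1 t2 g P k d)"
      by (simp add: right_diff_distrib sum_distrib_left mult_ac)
    also have "\<dots> = (\<Sum>j<d. \<Sum>r<t1. g (k, r) * (P r j * x j)) - (\<Sum>r<t1. g (k, r) * (s * P r d))"
      unfolding g by (simp add: sum_distrib_left sum_distrib_right mult_ac)
    also have "(\<Sum>j<d. \<Sum>r<t1. g (k, r) * (P r j * x j)) = (\<Sum>r<t1. g (k, r) * (\<Sum>j<d. P r j * x j))"
      by (subst sum.swap) (simp add: sum_distrib_left)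
    also have "\<dots> - (\<Sum>r<t1. g (k, r) * (s * P r d)) = (\<Sum>r<t1. g (k, r) * v r)"
      by (simp add: v right_diff_distrib sum_subtractf)
    finally show ?thesis by simp
  qed
  then show ?thesis
    unfolding gauss_form_def by (simp add: power_mult_distrib sum_distrib_left)
qed

text \<open>As for the Gaussian factor, \<open>s = 0\<close> serves differences in the column space
  and \<open>s = 1\<close> the residual of a fixed competitor.\<close>

lemma sparse_image_combination:
  "sparse_image n \<sigma> h (\<lambda>i. ((\<Sum>j<d. B i j * x j) - s * B i d) / w i) r =
    (\<Sum>j<d. hashed n w \<sigma> h B r j * x j) - s * hashed n w \<sigma> h B r d"
proof -
  have "(\<Sum>j<d. hashed n w \<sigma> h B r j * x j) = (\<Sum>i<n. \<Sum>j<d. (if h i = r then \<sigma> i * B i j / w i else 0) * x j)"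
    unfolding hashed_def sum_distrib_right by (rule sum.swap)
  then show ?thesis
    unfolding sparse_image_def hashed_def sum_distrib_left sum_subtractf[symmetric]
    by (auto simp: sum_subtractf[symmetric] sum_distrib_left sum_divide_distrib diff_divide_distrib right_diff_distrib mult_ac
        intro!: sum.cong)
qed

text \<open>For a fixed draw, hashing shrinks the squared norm of \<open>u\<close> by at most 2, and
  the Gaussian matrix shrinks its image by at most 64. The sketch of \<open>u\<close> is bounded by
  the sketched residual of \<open>x0\<close>, and the sketch stretches \<open>z\<close> by at most 8
  and 2. Hence \<open>2048 = 2 * 64 * 8 * 2\<close>.\<close>

lemma sketched_residual_bound:
  fixes B :: "nat \<Rightarrow> nat \<Rightarrow> real"
  assumes \<sigma>: "\<And>i. i < n \<Longrightarrow> \<sigma> i = -1 \<or> \<sigma> i = 1" and h: "\<And>i. i < n \<Longrightarrow> h i < t1" and t2: "t2 > 0"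
    and on: "orthonormal n J e"
    and span: "\<And>x. \<exists>c. \<forall>i<n. (\<Sum>j<d. B i j / w i * x j) = (\<Sum>j\<in>J. c j * e j i)"
    and defect: "frame_defect n J e \<sigma> h \<le> 1/4"
    and z: "z = (\<lambda>i. ((\<Sum>j<d. B i j * x0 j) - B i d) / w i)"
    and chaos: "(chaos n z z \<sigma> h)\<^sup>2 \<le> (dotp n z z)\<^sup>2"
    and span': "\<And>x. \<exists>c. \<forall>r<t1. (\<Sum>j<d. hashed n w \<sigma> h B r j * x j) = (\<Sum>j\<in>J'. c j * e' j r)"
    and on': "orthonormal t1 J' e'"
    and low: "\<And>c. real t2 * (\<Sum>j\<in>J'. (c j)\<^sup>2) \<le> 64 * gauss_form t2 t1 (lin_comb J' e' c) g"
    and up: "gauss_form t2 t1 (sparse_image n \<sigma> h z) g \<le> 8 * real t2 * dotp t1 (sparse_image n \<sigma> h z) (sparse_image n \<sigma> h z)"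
    and u: "u = (\<lambda>i. (\<Sum>j<d. B i j * (lsq_solution t2 d (gaussed t1 t2 g (hashed n w \<sigma> h B)) j - x0 j)) / w i)"
  shows "dotp n u u \<le> 2048 * dotp n z z"
proof -
  define M where "M = gaussed t1 t2 g (hashed n w \<sigma> h B)"
  define \<delta> where "\<delta> j = lsq_solution t2 d M j - x0 j" for j
  have u': "u i = (\<Sum>j<d. B i j / w i * \<delta> j)" for i
    by (simp add: u \<delta>_def M_def sum_divide_distrib)
  obtain c where c: "\<And>i. i < n \<Longrightarrow> u i = (\<Sum>j\<in>J. c j * e j i)" using span[of \<delta>] unfolding u' by blast
  define v where "v = sparse_image n \<sigma> h u"
  have v_c: "v = sparse_image n \<sigma> h (\<lambda>i. \<Sum>j\<in>J. c j * e j i)"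
    unfolding v_def sparse_image_def using c by (auto simp: fun_eq_iff intro!: sum.cong)
  have "dotp n u u = (\<Sum>j\<in>J. (c j)\<^sup>2)"
    unfolding orthonormal_norm[OF on, symmetric] using c by (intro dotp_cong) auto
  also have "\<dots> \<le> 2 * dotp t1 v v" unfolding v_c by (rule sparse_image_lower[OF on \<sigma> h defect])
  finally have 1: "dotp n u u \<le> 2 * dotp t1 v v" .
  have v_eq: "v r = (\<Sum>j<d. hashed n w \<sigma> h B r j * \<delta> j) - 0 * hashed n w \<sigma> h B r d" for r
    using sparse_image_combination[where B = B and x = \<delta> and s = 0] unfolding v_def u \<delta>_def M_def by simp
  obtain c' where c': "\<And>r. r < t1 \<Longrightarrow> v r = lin_comb J' e' c' r" using span'[of \<delta>] v_eq unfolding lin_comb_def by auto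
  have gv: "gauss_form t2 t1 v g = gauss_form t2 t1 (lin_comb J' e' c') g"
    unfolding gauss_form_def using c' by simp
  have "dotp t1 v v = dotp t1 (lin_comb J' e' c') (lin_comb J' e' c')" using c' by (intro dotp_cong) auto
  also have "\<dots> = (\<Sum>j\<in>J'. (c' j)\<^sup>2)" by (rule dotp_lin_comb[OF on'])
  finally have 2: "real t2 * dotp t1 v v \<le> 64 * gauss_form t2 t1 v g" using low[of c'] gv by simp
  define y where "y = sparse_image n \<sigma> h z"
  have y_eq: "y r = (\<Sum>j<d. hashed n w \<sigma> h B r j * x0 j) - 1 * hashed n w \<sigma> h B r d" for r
    using sparse_image_combination[where B = B and x = x0 and s = 1] unfolding y_def z by simp
  have "gauss_form t2 t1 v g = real t2 * (\<Sum>k<t2. ((\<Sum>j<d. M k j * \<delta> j) - 0 * M k d)\<^sup>2)"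
    unfolding M_def by (rule gauss_form_eq_gaussed[OF t2 v_eq])
  also have "\<dots> \<le> real t2 * (\<Sum>k<t2. ((\<Sum>j<d. M k j * x0 j) - 1 * M k d)\<^sup>2)"
    using lsq_solution_minimizes[where M = M and x = x0] unfolding \<delta>_def by (intro mult_left_mono) simp_all
  also have "\<dots> = gauss_form t2 t1 y g"
    unfolding M_def by (rule gauss_form_eq_gaussed[OF t2 y_eq, symmetric])
  also have "\<dots> \<le> 8 * real t2 * dotp t1 y y" using up by (simp add: y_def)
  finally have 3: "gauss_form t2 t1 v g \<le> 8 * real t2 * dotp t1 y y" .
  have "dotp t1 y y = dotp n z z + chaos n z z \<sigma> h" unfolding y_def by (rule dotp_sparse_image[OF \<sigma> h])
  also have "chaos n z z \<sigma> h \<le> dotp n z z"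
    using chaos dotp_nonneg[of n z] abs_le_square_iff[of "chaos n z z \<sigma> h" "dotp n z z"] by simp
  finally have 4: "dotp t1 y y \<le> 2 * dotp n z z" by simp
  have "real t2 * dotp n u u \<le> real t2 * (2 * dotp t1 v v)" using 1 by (intro mult_left_mono) auto
  also have "\<dots> \<le> 128 * gauss_form t2 t1 v g" using 2 by simp
  also have "\<dots> \<le> 1024 * real t2 * dotp t1 y y" using 3 by simp
  also have "\<dots> \<le> 1024 * real t2 * (2 * dotp n z z)" using 4 by (intro mult_left_mono) auto
  finally have "real t2 * dotp n u u \<le> real t2 * (2048 * dotp n z z)" by simp
  then show ?thesis using t2 by simp
qed

section \<open>Failure probability and the final bound\<close>

context orlicz_function begin

text \<open>Contraction, sketching and expansion meet in the triangle inequality. Since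
  \<open>46 * 46 >= 2048\<close> and \<open>sqrt L <= 2 * L\<close> for \<open>L >= 1/2\<close>, the
  constant is \<open>960 * 46 * 2 = 88320\<close>; the same lower bound on \<open>L\<close> lets
  \<open>4 * d * L * L\<close> dominate 1 for the summand \<open>q\<close>.\<close>

lemma G_norm_deviation_le:
  assumes n: "n \<ge> 2" and d: "d \<ge> 1" and K: "K > 0"
    and contr: "G_norm n p \<le> 960 * real d * ln (real n) * sqrt U"
    and U: "U \<le> 2048 * Z" and Z: "Z \<le> K * ln (real n) * a\<^sup>2" and a: "0 \<le> a" "G_norm n q \<le> a"
  shows "G_norm n (\<lambda>i. p i + q i) \<le> (4 + 88320 * sqrt K) * real d * (ln (real n))\<^sup>2 * a"
proof -
  define L where "L = ln (real n)"
  have L: "1/2 \<le> L" unfolding L_def by (rule half_le_ln[OF n])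
  have L2: "1 \<le> 4 * L\<^sup>2" using power_mono[OF L, of 2] by (simp add: power2_eq_square)
  have "sqrt U \<le> 46 * (sqrt K * (2 * L) * a)"
  proof (rule real_le_lsqrt)
    have "L * 1 \<le> L * (4 * L)" using L by (intro mult_left_mono) auto
    then have "L \<le> (2 * L)\<^sup>2" by (simp add: power2_eq_square)
    have "U \<le> 2048 * (K * L * a\<^sup>2)" using U Z by (simp add: L_def)
    also have "\<dots> \<le> 46\<^sup>2 * (K * (2 * L)\<^sup>2 * a\<^sup>2)"
      using K \<open>L \<le> (2 * L)\<^sup>2\<close> L by (intro mult_mono mult_right_mono mult_left_mono) auto
    also have "\<dots> = (46 * (sqrt K * (2 * L) * a))\<^sup>2" using K by (simp add: power_mult_distrib)
    finally show "U \<le> (46 * (sqrt K * (2 * L) * a))\<^sup>2" .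
  qed (use K L a in auto)
  then have "G_norm n p \<le> 960 * real d * L * (46 * (sqrt K * (2 * L) * a))"
    using contr L unfolding L_def[symmetric] by (elim order_trans) (intro mult_left_mono, auto)
  also have "\<dots> = 88320 * sqrt K * real d * L\<^sup>2 * a" by (simp add: power2_eq_square)
  finally have 1: "G_norm n p \<le> 88320 * sqrt K * real d * L\<^sup>2 * a" .
  have "1 * 1 \<le> real d * (4 * L\<^sup>2)" using d L2 by (intro mult_mono) auto
  then have "1 * a \<le> real d * (4 * L\<^sup>2) * a" using a by (intro mult_right_mono) auto
  then have 2: "G_norm n q \<le> 4 * real d * L\<^sup>2 * a" using a by (simp add: mult_ac)
  have "G_norm n (\<lambda>i. p i + q i) \<le> G_norm n p + G_norm n q" by (rule G_norm_triangle)
  also have "\<dots> \<le> 88320 * sqrt K * real d * L\<^sup>2 * a + 4 * real d * L\<^sup>2 * a" using 1 2 by linarith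
  finally show ?thesis unfolding L_def[symmetric] by (simp add: algebra_simps)
qed

definition residual :: "nat \<Rightarrow> (nat \<Rightarrow> nat \<Rightarrow> real) \<Rightarrow> (nat \<Rightarrow> real) \<Rightarrow> nat \<Rightarrow> real" where
  "residual d B x i = (\<Sum>j<d. B i j * x j) - B i d"

text \<open>The bad events for the Gaussian matrix depend on \<open>\<sigma>\<close> and \<open>h\<close> through bases that need not be
  measurable.  Integrating the failure set \<open>T\<close> itself section by section, with Markov's
  inequality for \<open>D\<close> applied inside the integral, avoids any joint measurability of them.\<close>

lemma failure_given_weights:
  fixes B :: "nat \<Rightarrow> nat \<Rightarrow> real"
  assumes d: "d \<ge> 1" and t1: "400 * (real d)\<^sup>2 \<le> real t1" and t2: "460 * d \<le> t2"
    and T: "T \<in> sets (signs n \<Otimes>\<^sub>M hashes n t1 \<Otimes>\<^sub>M gauss t2 t1)"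
    and z: "z = (\<lambda>i. residual d B x0 i / w i)"
    and good: "\<And>\<sigma> h g u. (\<sigma>, h, g) \<in> T \<Longrightarrow>
       u = (\<lambda>i. (\<Sum>j<d. B i j * (lsq_solution t2 d (gaussed t1 t2 g (hashed n w \<sigma> h B)) j - x0 j)) / w i) \<Longrightarrow>
       \<not> dotp n u u \<le> 2048 * dotp n z z"
  shows "emeasure (signs n \<Otimes>\<^sub>M hashes n t1 \<Otimes>\<^sub>M gauss t2 t1) T \<le> ennreal (1/10)"
proof -
  have d1: "1 \<le> (real d)\<^sup>2" using d by simp
  have t1pos: "t1 > 0" using t1 d1 by (cases t1) auto
  have t2pos: "t2 > 0" using t2 d by simp
  interpret S: prob_space "signs n" by (rule prob_space_signs)
  interpret H: prob_space "hashes n t1" by (rule prob_space_hashes[OF t1pos])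
  interpret \<Gamma>: prob_space "gauss t2 t1" by (rule prob_space_gauss)
  interpret H\<Gamma>: pair_prob_space "hashes n t1" "gauss t2 t1" ..
  obtain J e where on: "orthonormal n J e" and cJ: "card J \<le> d"
    and span: "\<And>x. \<exists>c. \<forall>i<n. (\<Sum>j<d. B i j / w i * x j) = (\<Sum>j\<in>J. c j * e j i)"
    using ex_orthonormal_spanning[of n d "\<lambda>j i. B i j / w i"] by blast
  define q where "q = dotp n z z"
  have q0: "0 \<le> q" by (simp add: q_def dotp_nonneg)
  \<comment> \<open>One quantity for both Markov events. If \<open>D < 1\<close>, the defect is at
    most \<open>1/4\<close> and the squared chaos at most \<open>q * q\<close>; if
    \<open>D >= 1\<close>, the trivial bound 1 on a probability is at most \<open>D\<close>. For
    \<open>q = 0\<close> the chaos vanishes and division by zero drops its term.\<close>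
  define D where "D \<sigma> h = 4 * frame_defect n J e \<sigma> h + 1 / q\<^sup>2 * (chaos n z z \<sigma> h)\<^sup>2" for \<sigma> h
  have fd0: "0 \<le> frame_defect n J e \<sigma> h" for \<sigma> h by (simp add: frame_defect_def sum_nonneg)
  have D0: "0 \<le> D \<sigma> h" for \<sigma> h using fd0 by (simp add: D_def)
  have section_bound: "emeasure (gauss t2 t1) {g. (\<sigma>, h, g) \<in> T} \<le> ennreal (3/100) + ennreal (D \<sigma> h)"
    if \<sigma>: "\<sigma> \<in> space (signs n)" and h: "h \<in> space (hashes n t1)" for \<sigma> h
  proof (cases "D \<sigma> h < 1")
    case False
    have "emeasure (gauss t2 t1) {g. (\<sigma>, h, g) \<in> T} \<le> 1" by (rule \<Gamma>.measure_le_1)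
    also have "1 \<le> ennreal (D \<sigma> h)" using False by simp
    also have "ennreal (D \<sigma> h) \<le> ennreal (3/100) + ennreal (D \<sigma> h)" by simp
    finally show ?thesis .
  next
    case True
    have \<sigma>': "\<sigma> i = -1 \<or> \<sigma> i = 1" if "i < n" for i
      using \<sigma> that by (auto simp: signs_def space_PiM PiE_iff space_uniform_count_measure)
    have h': "h i < t1" if "i < n" for i
      using h that by (auto simp: hashes_def space_PiM PiE_iff space_uniform_count_measure)
    have "0 \<le> 1 / q\<^sup>2 * (chaos n z z \<sigma> h)\<^sup>2" by simp
    then have defect: "frame_defect n J e \<sigma> h \<le> 1/4" using True unfolding D_def by linarith
    have chaos: "(chaos n z z \<sigma> h)\<^sup>2 \<le> (dotp n z z)\<^sup>2"
    proof (cases "q = 0")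
      case True
      then have "z i = 0" if "i < n" for i using dotp_self_eq_0[of n z i] that by (simp add: q_def)
      then have "chaos n z z \<sigma> h = 0" unfolding chaos_def by (intro sum.neutral) (auto simp: offdiag_def)
      then show ?thesis by simp
    next
      case False
      have "1 / q\<^sup>2 * (chaos n z z \<sigma> h)\<^sup>2 \<le> 1" using True fd0[of \<sigma> h] unfolding D_def by linarith
      then show ?thesis using False by (simp add: q_def[symmetric] divide_le_eq)
    qed
    obtain J' e' where on': "orthonormal t1 J' e'" and cJ': "card J' \<le> d"
      and span': "\<And>x. \<exists>c. \<forall>r<t1. (\<Sum>j<d. hashed n w \<sigma> h B r j * x j) = (\<Sum>j\<in>J'. c j * e' j r)"
      using ex_orthonormal_spanning[of t1 d "\<lambda>j r. hashed n w \<sigma> h B r j"] by blast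
    obtain E1 where E1: "E1 \<in> sets (gauss t2 t1)" "measure (gauss t2 t1) E1 \<le> 1/50"
      and low: "\<And>g c. g \<in> space (gauss t2 t1) - E1 \<Longrightarrow>
        real t2 * (\<Sum>j\<in>J'. (c j)\<^sup>2) \<le> 64 * gauss_form t2 t1 (lin_comb J' e' c) g"
      using gauss_embedding[OF on' cJ' d t2] by blast
    define y where "y = sparse_image n \<sigma> h z"
    define E2 where "E2 = {g \<in> space (gauss t2 t1). 8 * real t2 * dotp t1 y y < gauss_form t2 t1 y g}"
    have E2: "E2 \<in> sets (gauss t2 t1)" unfolding E2_def by measurable
    have "measure (gauss t2 t1) E2 \<le> (1/2) ^ t2" unfolding E2_def by (rule gauss_form_upper)
    also have "\<dots> \<le> (1/2) ^ 7" using t2 d by (intro power_decreasing) auto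
    finally have pE2: "measure (gauss t2 t1) E2 \<le> 1/100" by (simp add: power_divide)
    have "{g. (\<sigma>, h, g) \<in> T} \<subseteq> E1 \<union> E2"
    proof
      fix g assume "g \<in> {g. (\<sigma>, h, g) \<in> T}"
      then have gT: "(\<sigma>, h, g) \<in> T" by simp
      then have gs: "g \<in> space (gauss t2 t1)" using sets.sets_into_space[OF T] by (auto simp: space_pair_measure)
      show "g \<in> E1 \<union> E2"
      proof (rule ccontr)
        assume "g \<notin> E1 \<union> E2"
        then have g: "g \<in> space (gauss t2 t1) - E1" "gauss_form t2 t1 y g \<le> 8 * real t2 * dotp t1 y y"
          using gs by (auto simp: E2_def)
        have "dotp n u u \<le> 2048 * dotp n z z"
          if u: "u = (\<lambda>i. (\<Sum>j<d. B i j * (lsq_solution t2 d (gaussed t1 t2 g (hashed n w \<sigma> h B)) j - x0 j)) / w i)" for u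
          by (rule sketched_residual_bound[OF \<sigma>' h' t2pos on span defect _ chaos span' on' low[OF g(1)] _ u])
            (use g(2) in \<open>simp_all add: z residual_def y_def\<close>)
        then show False using good[OF gT refl] by blast
      qed
    qed
    then have "emeasure (gauss t2 t1) {g. (\<sigma>, h, g) \<in> T} \<le> emeasure (gauss t2 t1) (E1 \<union> E2)"
      using E1 E2 by (intro emeasure_mono) auto
    also have "\<dots> \<le> ennreal (3/100)"
      using prob_Un_le[OF prob_space_gauss E1(1) E2 E1(2) pE2] by (simp add: \<Gamma>.emeasure_eq_measure ennreal_leI)
    finally show ?thesis by (rule order_trans) simp
  qed
  have sec: "Pair \<sigma> -` T \<in> sets (hashes n t1 \<Otimes>\<^sub>M gauss t2 t1)" for \<sigma> by (rule sets_Pair1[OF T])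
  have "emeasure (signs n \<Otimes>\<^sub>M hashes n t1 \<Otimes>\<^sub>M gauss t2 t1) T =
      (\<integral>\<^sup>+\<sigma>. emeasure (hashes n t1 \<Otimes>\<^sub>M gauss t2 t1) (Pair \<sigma> -` T) \<partial>signs n)"
    by (rule H\<Gamma>.emeasure_pair_measure_alt[OF T])
  also have "\<dots> = (\<integral>\<^sup>+\<sigma>. \<integral>\<^sup>+h. emeasure (gauss t2 t1) {g. (\<sigma>, h, g) \<in> T} \<partial>hashes n t1 \<partial>signs n)"
    by (subst \<Gamma>.emeasure_pair_measure_alt[OF sec]) (simp add: vimage_def)
  also have "\<dots> \<le> (\<integral>\<^sup>+\<sigma>. \<integral>\<^sup>+h. ennreal (3/100) + ennreal (D \<sigma> h) \<partial>hashes n t1 \<partial>signs n)"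
    by (intro nn_integral_mono section_bound)
  also have "\<dots> = ennreal (3/100) +
      (4 * (\<integral>\<^sup>+\<sigma>. \<integral>\<^sup>+h. ennreal (frame_defect n J e \<sigma> h) \<partial>hashes n t1 \<partial>signs n) +
       ennreal (1 / q\<^sup>2) * (\<integral>\<^sup>+\<sigma>. \<integral>\<^sup>+h. ennreal ((chaos n z z \<sigma> h)\<^sup>2) \<partial>hashes n t1 \<partial>signs n))"
  proof -
    note [measurable] = measurable_chaos measurable_frame_defect chaos_second_moment(2)[OF t1pos] frame_defect_moment(2)[OF t1pos on]
    have "ennreal (D \<sigma> h) = 4 * ennreal (frame_defect n J e \<sigma> h) + ennreal (1 / q\<^sup>2) * ennreal ((chaos n z z \<sigma> h)\<^sup>2)" for \<sigma> h
    proof -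
      have "ennreal (D \<sigma> h) = ennreal (4 * frame_defect n J e \<sigma> h) + ennreal (1 / q\<^sup>2 * (chaos n z z \<sigma> h)\<^sup>2)"
        unfolding D_def using fd0[of \<sigma> h] by (intro ennreal_plus) simp_all
      moreover have "ennreal (4 * frame_defect n J e \<sigma> h) = 4 * ennreal (frame_defect n J e \<sigma> h)"
        using fd0[of \<sigma> h] by (subst ennreal_mult) simp_all
      moreover have "ennreal (1 / q\<^sup>2 * (chaos n z z \<sigma> h)\<^sup>2) = ennreal (1 / q\<^sup>2) * ennreal ((chaos n z z \<sigma> h)\<^sup>2)"
        by (subst ennreal_mult) simp_all
      ultimately show ?thesis by simp
    qed
    then show ?thesis
      by (simp add: nn_integral_add nn_integral_cmult H.emeasure_space_1 S.emeasure_space_1)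
  qed
  also have "\<dots> \<le> ennreal (3/100) + (ennreal 4 * ennreal (2 * (real (card J))\<^sup>2 / real t1) +
      ennreal (1 / q\<^sup>2) * ennreal (2 / real t1 * (q * q)))"
    using frame_defect_moment(1)[OF t1pos on] chaos_second_moment(1)[OF t1pos, of n z z]
    by (intro add_mono mult_mono order_refl) (simp_all add: q_def)
  \<comment> \<open>With \<open>t1 >= 400 * d * d\<close> the two terms are at most
    \<open>8 / 400\<close> and \<open>2 / 400\<close>; the bound \<open>2/100\<close> is used for
    each.\<close>
  also have "ennreal 4 * ennreal (2 * (real (card J))\<^sup>2 / real t1) + ennreal (1 / q\<^sup>2) * ennreal (2 / real t1 * (q * q)) \<le> ennreal (7/100)"
  proof -
    have "(real (card J))\<^sup>2 \<le> (real d)\<^sup>2" using cJ by (intro power_mono) auto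
    then have "4 * (2 * (real (card J))\<^sup>2 / real t1) \<le> 8 * (real d)\<^sup>2 / real t1" by (simp add: divide_right_mono)
    also have "\<dots> \<le> 2/100" using t1 t1pos by (simp add: divide_le_eq)
    finally have 1: "4 * (2 * (real (card J))\<^sup>2 / real t1) \<le> 2/100" .
    have "1 / q\<^sup>2 * (2 / real t1 * (q * q)) \<le> 2 / real t1" by (cases "q = 0") (simp_all add: power2_eq_square)
    also have "\<dots> \<le> 2/100" using t1 t1pos d1 by (simp add: divide_le_eq)
    finally have 2: "1 / q\<^sup>2 * (2 / real t1 * (q * q)) \<le> 2/100" .
    have "ennreal 4 * ennreal (2 * (real (card J))\<^sup>2 / real t1) + ennreal (1 / q\<^sup>2) * ennreal (2 / real t1 * (q * q)) =
       ennreal (4 * (2 * (real (card J))\<^sup>2 / real t1) + 1 / q\<^sup>2 * (2 / real t1 * (q * q)))"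
    proof -
      have "ennreal 4 * ennreal (2 * (real (card J))\<^sup>2 / real t1) = ennreal (4 * (2 * (real (card J))\<^sup>2 / real t1))"
        by (subst ennreal_mult) simp_all
      moreover have "ennreal (1 / q\<^sup>2) * ennreal (2 / real t1 * (q * q)) = ennreal (1 / q\<^sup>2 * (2 / real t1 * (q * q)))"
        using q0 by (subst ennreal_mult) simp_all
      ultimately show ?thesis using q0 by (subst ennreal_plus) simp_all
    qed
    also have "\<dots> \<le> ennreal (7/100)" using 1 2 by (intro ennreal_leI) linarith
    finally show ?thesis .
  qed
  finally show ?thesis by (simp add: ennreal_plus[symmetric] del: ennreal_plus)
qed

lemma orlicz_norm_residual:
  assumes "A \<in> carrier_mat n d" "b \<in> carrier_vec n" "x \<in> carrier_vec d"
  shows "orlicz_norm G (A *\<^sub>v x - b) = G_norm n (residual d (augmented d A b) (\<lambda>j. x $ j))"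
proof -
  have "(A *\<^sub>v x - b) $ i = residual d (augmented d A b) (\<lambda>j. x $ j) i" if "i < n" for i
    using assms that by (simp add: residual_def augmented_def mult_mat_vec_index_sum[of _ n d] del: index_mult_mat_vec)
  then show ?thesis
    unfolding orlicz_norm_eq_G_norm using assms by (auto intro: G_norm_cong)
qed

text \<open>Attainment of the infimum is replaced by a factor 2, which a positive infimum permits.
  If the infimum is 0, the least-squares solution serves: its squared residual is at most
  \<open>n\<close> times the squared norm of any residual, hence zero.\<close>

lemma near_optimal:
  assumes A: "A \<in> carrier_mat n d" and b: "b \<in> carrier_vec n"
    and m: "m = (INF x\<in>carrier_vec d. orlicz_norm G (A *\<^sub>v x - b))"
  shows "0 \<le> m" and "\<exists>y. G_norm n (residual d (augmented d A b) y) \<le> 2 * m"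
proof -
  let ?B = "augmented d A b" and ?f = "\<lambda>x. orlicz_norm G (A *\<^sub>v x - b)"
  have f0: "0 \<le> ?f x" for x by (simp add: orlicz_norm_eq_G_norm G_norm_nonneg)
  have ne: "carrier_vec d \<noteq> ({} :: real Matrix.vec set)" using zero_carrier_vec by blast
  have bdd: "bdd_below (?f ` carrier_vec d)" using f0 by (intro bdd_belowI[of _ 0]) auto
  have attain: "\<exists>y. G_norm n (residual d ?B y) < e" if "m < e" for e
    using that cINF_less_iff[OF ne bdd, of e] orlicz_norm_residual[OF A b] unfolding m by force
  show m0: "0 \<le> m" unfolding m using f0 by (intro cINF_greatest ne)
  show "\<exists>y. G_norm n (residual d ?B y) \<le> 2 * m"
  proof (cases "m = 0")
    case False
    then show ?thesis using attain[of "2 * m"] m0 by (auto intro: less_imp_le)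
  next
    case True
    define y where "y = lsq_solution n d ?B"
    define \<rho> where "\<rho> = (\<Sum>i<n. (residual d ?B y i)\<^sup>2)"
    have low: "\<rho> \<le> real n * (G_norm n (residual d ?B v))\<^sup>2" for v
    proof -
      have "\<rho> \<le> (\<Sum>i<n. (residual d ?B v i)\<^sup>2)"
        unfolding \<rho>_def y_def residual_def by (rule lsq_solution_minimizes(2))
      also have "\<dots> \<le> (\<Sum>i<n. (G_norm n (residual d ?B v))\<^sup>2)"
      proof (rule sum_mono)
        fix i assume "i \<in> {..<n}"
        then have "\<bar>residual d ?B v i\<bar>\<^sup>2 \<le> (G_norm n (residual d ?B v))\<^sup>2"
          by (intro power_mono abs_le_G_norm) auto
        then show "(residual d ?B v i)\<^sup>2 \<le> (G_norm n (residual d ?B v))\<^sup>2" by simp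
      qed
      finally show ?thesis by simp
    qed
    have "\<rho> \<le> 0"
    proof (rule ccontr)
      assume "\<not> \<rho> \<le> 0"
      then have \<rho>: "\<rho> > 0" by simp
      then obtain v where v: "G_norm n (residual d ?B v) < sqrt (\<rho> / (real n + 1))"
        using attain[of "sqrt (\<rho> / (real n + 1))"] True by (auto simp: add_nonneg_pos)
      have "(G_norm n (residual d ?B v))\<^sup>2 \<le> (sqrt (\<rho> / (real n + 1)))\<^sup>2"
        using v G_norm_nonneg by (intro power_mono) auto
      then have "real n * (G_norm n (residual d ?B v))\<^sup>2 \<le> real n * (\<rho> / (real n + 1))"
        using \<rho> by (intro mult_left_mono) simp_all
      then have "\<rho> \<le> real n * (\<rho> / (real n + 1))" using low[of v] by linarith
      then show False using \<rho> by (simp add: field_simps)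
    qed
    moreover have "0 \<le> \<rho>" by (simp add: \<rho>_def sum_nonneg)
    ultimately have "(\<Sum>i<n. (residual d ?B y i)\<^sup>2) = 0" by (simp add: \<rho>_def)
    then have "\<forall>i\<in>{..<n}. (residual d ?B y i)\<^sup>2 = 0" by (subst (asm) sum_nonneg_eq_0_iff) auto
    then have "(\<Sum>i<n. \<bar>residual d ?B y i\<bar>) = 0" by simp
    then show ?thesis using G_norm_le_sum_abs[of n "residual d ?B y"] True by (intro exI[of _ y]) simp
  qed
qed

theorem approximation_guarantee:
  "\<exists>\<beta>>0. \<forall>t1 t2. sketch_sizes 400 460 t1 t2 \<longrightarrow>
    (\<forall>n\<ge>2. \<forall>d\<ge>1. \<forall>A\<in>carrier_mat n d. \<forall>b\<in>carrier_vec n.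
      measure (draws G n (t1 d) (t2 d))
        {\<omega> \<in> space (draws G n (t1 d) (t2 d)).
          orlicz_norm G (A *\<^sub>v x_hat A b (t1 d) (t2 d) \<omega> - b)
            \<le> \<beta> * real d * (ln (real n))\<^sup>2 * (INF x\<in>carrier_vec d. orlicz_norm G (A *\<^sub>v x - b))} \<ge> 0.8)"
proof -
  obtain K where K: "K > 0" "\<And>n f. n \<ge> 2 \<Longrightarrow> \<exists>W\<in>sets (weights n). measure (weights n) W \<le> 1/25 \<and>
      (\<forall>w\<in>space (weights n) - W. dotp n (\<lambda>i. f i / w i) (\<lambda>i. f i / w i) \<le> K * ln (real n) * (G_norm n f)\<^sup>2)"
    using weights_l2_upper_G_norm by blast
  define \<beta>0 where "\<beta>0 = 4 + 88320 * sqrt K"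
  have \<beta>0: "\<beta>0 > 0" using K(1) by (simp add: \<beta>0_def add_pos_pos)
  have "0.8 \<le> measure (draws G n t1 t2) {\<omega> \<in> space (draws G n t1 t2).
          orlicz_norm G (A *\<^sub>v x_hat A b t1 t2 \<omega> - b)
            \<le> 2 * \<beta>0 * real d * (ln (real n))\<^sup>2 * (INF x\<in>carrier_vec d. orlicz_norm G (A *\<^sub>v x - b))}"
    if t1: "400 * (real d)\<^sup>2 \<le> real t1" and t2: "460 * real d \<le> real t2"
      and n: "n \<ge> 2" and d: "d \<ge> 1" and A: "A \<in> carrier_mat n d" and b: "b \<in> carrier_vec n" for n d t1 t2 A b
  proof -
    let ?R = "signs n \<Otimes>\<^sub>M hashes n t1 \<Otimes>\<^sub>M gauss t2 t1"
    define M where "M = draws G n t1 t2"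
    have M: "M = weights n \<Otimes>\<^sub>M ?R" by (simp add: M_def draws_eq)
    have "0 < 400 * (real d)\<^sup>2" using d by simp
    then have t1pos: "t1 > 0" using t1 by (cases t1) auto
    interpret W: prob_space "weights n" by (rule prob_space_weights)
    interpret S: prob_space "signs n" by (rule prob_space_signs)
    interpret H: prob_space "hashes n t1" by (rule prob_space_hashes[OF t1pos])
    interpret \<Gamma>: prob_space "gauss t2 t1" by (rule prob_space_gauss)
    interpret H\<Gamma>: pair_prob_space "hashes n t1" "gauss t2 t1" ..
    interpret R: pair_prob_space "signs n" "hashes n t1 \<Otimes>\<^sub>M gauss t2 t1" ..
    interpret WR: pair_prob_space "weights n" ?R ..
    define B where "B = augmented d A b"
    define m where "m = (INF x\<in>carrier_vec d. orlicz_norm G (A *\<^sub>v x - b))"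
    have m0: "0 \<le> m" by (rule near_optimal(1)[OF A b m_def])
    obtain y where y: "G_norm n (residual d B y) \<le> 2 * m"
      unfolding B_def using near_optimal(2)[OF A b m_def] by blast
    define a where "a = G_norm n (residual d B y)"
    have a: "0 \<le> a" "a \<le> 2 * m" using y G_norm_nonneg by (auto simp: a_def)
    \<comment> \<open>The factor 2 pays for the competitor \<open>y\<close>, which is optimal only
      up to that factor.\<close>
    define c where "c = 2 * \<beta>0 * real d * (ln (real n))\<^sup>2 * m"
    have c0: "0 \<le> c" using m0 \<beta>0 by (simp add: c_def)
    define T where "T = {\<omega> \<in> space M. G_norm n (residual d B (solution n d t1 t2 B \<omega>)) \<le> c}"
    have T_eq: "{\<omega> \<in> space M. orlicz_norm G (A *\<^sub>v x_hat A b t1 t2 \<omega> - b) \<le> c} = T"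
    proof -
      have "orlicz_norm G (A *\<^sub>v x_hat A b t1 t2 \<omega> - b) = G_norm n (residual d B (solution n d t1 t2 B \<omega>))" for \<omega>
      proof -
        obtain w \<sigma> h g where \<omega>: "\<omega> = (w, \<sigma>, h, g)" by (cases \<omega>)
        show ?thesis
          unfolding \<omega> x_hat_eq[OF A b]
          by (subst orlicz_norm_residual[OF A b]) (auto simp: solution_def B_def residual_def intro!: G_norm_cong)
      qed
      then show ?thesis by (simp add: T_def)
    qed
    have T: "T \<in> sets M"
      unfolding T_def residual_def
      by (rule measurable_G_norm_le[OF _ c0], unfold M_def)
        (intro borel_measurable_diff borel_measurable_sum borel_measurable_times borel_measurable_const measurable_solution)
    obtain W1 where W1: "W1 \<in> sets (weights n)" "measure (weights n) W1 \<le> 1/25"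
      "\<And>w. w \<in> space (weights n) - W1 \<Longrightarrow>
        dotp n (\<lambda>i. residual d B y i / w i) (\<lambda>i. residual d B y i / w i) \<le> K * ln (real n) * a\<^sup>2"
      using K(2)[OF n, of "residual d B y"] unfolding a_def by blast
    obtain W2 where W2: "W2 \<in> sets (weights n)" "measure (weights n) W2 \<le> 1/25"
      "\<And>w x. w \<in> space (weights n) - W2 \<Longrightarrow> G_norm n (\<lambda>i. \<Sum>j<d. B i j * x j) \<le>
       960 * real d * ln (real n) * sqrt (dotp n (\<lambda>i. (\<Sum>j<d. B i j * x j) / w i) (\<lambda>i. (\<Sum>j<d. B i j * x j) / w i))"
      using weights_no_contraction[OF n, where A = B and d = d] by blast
    define F where "F = space M - T"
    have F: "F \<in> sets (weights n \<Otimes>\<^sub>M ?R)" using sets.compl_sets[OF T] unfolding F_def M .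
    \<comment> \<open>Outside the two bad weight events the sketch fails with conditional
      probability at most \<open>1/10\<close>. Integrated over the weights, the total is at most
      \<open>1/25 + 1/25 + 1/10 = 9/50\<close>, below \<open>1/5\<close>.\<close>
    have cond: "emeasure ?R (Pair w -` F) \<le> indicator (W1 \<union> W2) w + ennreal (1/10)" if w: "w \<in> space (weights n)" for w
    proof (cases "w \<in> W1 \<union> W2")
      case True
      have "emeasure ?R (Pair w -` F) \<le> 1" by (rule R.P.measure_le_1)
      then show ?thesis using True by (simp add: add_increasing2)
    next
      case False
      have "emeasure ?R (Pair w -` F) \<le> ennreal (1/10)"
      proof (rule failure_given_weights[OF d t1 _ sets_Pair1[OF F] refl])
        show "460 * d \<le> t2" using t2 by (metis (mono_tags) of_nat_le_iff of_nat_mult of_nat_numeral)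
        fix \<sigma> h g u
        assume in_F: "(\<sigma>, h, g) \<in> Pair w -` F"
          and u: "u = (\<lambda>i. (\<Sum>j<d. B i j * (lsq_solution t2 d (gaussed t1 t2 g (hashed n w \<sigma> h B)) j - y j)) / w i)"
        define x where "x = solution n d t1 t2 B (w, \<sigma>, h, g)"
        have u': "u = (\<lambda>i. (\<Sum>j<d. B i j * (x j - y j)) / w i)" by (simp add: u x_def solution_def)
        have fail: "\<not> G_norm n (residual d B x) \<le> c" using in_F by (auto simp: F_def T_def x_def)
        show "\<not> dotp n u u \<le> 2048 * dotp n (\<lambda>i. residual d B y i / w i) (\<lambda>i. residual d B y i / w i)"
        proof
          assume "dotp n u u \<le> 2048 * dotp n (\<lambda>i. residual d B y i / w i) (\<lambda>i. residual d B y i / w i)"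
          then have "G_norm n (\<lambda>i. (\<Sum>j<d. B i j * (x j - y j)) + residual d B y i) \<le> \<beta>0 * real d * (ln (real n))\<^sup>2 * a"
            unfolding \<beta>0_def
            by (rule G_norm_deviation_le[OF n d K(1), rotated])
              (use W1(3) W2(3) w False a in \<open>auto simp: a_def u'\<close>)
          also have "(\<lambda>i. (\<Sum>j<d. B i j * (x j - y j)) + residual d B y i) = residual d B x"
            by (simp add: fun_eq_iff residual_def right_diff_distrib sum_subtractf)
          also have "\<beta>0 * real d * (ln (real n))\<^sup>2 * a \<le> \<beta>0 * real d * (ln (real n))\<^sup>2 * (2 * m)"
            using a \<beta>0 by (intro mult_left_mono) auto
          finally show False using fail by (simp add: c_def mult_ac)
        qed
      qed
      then show ?thesis using False by simp
    qed
    have "emeasure M F = (\<integral>\<^sup>+w. emeasure ?R (Pair w -` F) \<partial>weights n)"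
      unfolding M by (rule R.P.emeasure_pair_measure_alt[OF F])
    also have "\<dots> \<le> (\<integral>\<^sup>+w. indicator (W1 \<union> W2) w + ennreal (1/10) \<partial>weights n)"
      by (rule nn_integral_mono[OF cond])
    also have "\<dots> = emeasure (weights n) (W1 \<union> W2) + ennreal (1/10)"
      using W1(1) W2(1) by (subst nn_integral_add) (auto simp: W.emeasure_space_1)
    also have "\<dots> \<le> ennreal (1/25 + 1/25) + ennreal (1/10)"
      using prob_Un_le[OF prob_space_weights W1(1) W2(1) W1(2) W2(2)]
      by (intro add_right_mono) (simp add: W.emeasure_eq_measure ennreal_leI)
    also have "\<dots> = ennreal (9/50)" by (subst ennreal_plus[symmetric]) simp_all
    finally have "measure M F \<le> 9/50" by (simp add: M WR.P.emeasure_eq_measure)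
    moreover have "measure M F = 1 - measure M T"
      unfolding F_def M by (rule WR.P.prob_compl) (use T M in simp)
    ultimately have "0.8 \<le> measure M T" by simp
    then show ?thesis unfolding T_eq[symmetric] c_def m_def M_def by simp
  qed
  then show ?thesis
    using \<beta>0 by (intro exI[of _ "2 * \<beta>0"]) (simp add: sketch_sizes_def)
qed

end

theorem theorem18:
  shows "\<exists>c1>0. \<exists>c2>0.
    (\<forall>G. property_P G \<longrightarrow>
      (\<exists>\<beta>>0. \<forall>t1 t2. sketch_sizes c1 c2 t1 t2 \<longrightarrow>
        (\<forall>n\<ge>2. \<forall>d\<ge>1. \<forall>A\<in>carrier_mat n d. \<forall>b\<in>carrier_vec n.
          measure (draws G n (t1 d) (t2 d))
            {\<omega> \<in> space (draws G n (t1 d) (t2 d)).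
              orlicz_norm G (A *\<^sub>v x_hat A b (t1 d) (t2 d) \<omega> - b)
                \<le> \<beta> * real d * (ln (real n))\<^sup>2
                    * (INF x\<in>carrier_vec d. orlicz_norm G (A *\<^sub>v x - b))} \<ge> 0.8))) \<and>
    (\<exists>prog C. \<forall>t1 t2. sketch_sizes c1 c2 t1 t2 \<longrightarrow>
      (\<exists>p :: nat poly. \<forall>G n d as bs. \<forall>A\<in>carrier_mat n d. \<forall>b\<in>carrier_vec n.
        property_P G \<and> coords_mat A as \<and> coords_vec b bs \<longrightarrow>
        (\<forall>\<omega>\<in>space (draws G n (t1 d) (t2 d)).
          \<exists>T s. exec prog (init_store n d (t1 d) (t2 d) as bs \<omega>) = (T, s) \<and>
            output_vec d s = x_hat A b (t1 d) (t2 d) \<omega> \<and>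
            T \<le> C * (nnz_mat A + nnz_vec b) + poly p d \<and>
            (nnz_vec b \<le> nnz_mat A \<longrightarrow> T \<le> C * nnz_mat A + poly p d))))"
  \<comment> \<open>400 is the threshold from the collision moments and 460 the one from the
    Gaussian net; neither depends on \<open>G\<close>.\<close>
  using orlicz_function.approximation_guarantee[unfolded orlicz_function_def] running_time[of 400 460]
  by (intro exI[of _ "400 :: real"] exI[of _ "460 :: real"] conjI) simp_all

end
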